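(* Let $N\geq 1$ be an integer. There exists a connected, compact, rationally convex set $X\subset B\subset \mathbb{C}^N$ of positive $2N$-dimensional Lebesgue measure such that the collection of polynomials that are zero-free on $X$ is dense in $P(\overline{B})$, and such that there is a set $P\subset X$ of full $2N$-dimensional Lebesgue measure in $X$ (i.e. $\mu(X\setminus P)=0$) such that $P$ is contained in a single Gleason part for $R(X)$ and at every point of $P$ the space of bounded point derivations for $R(X)$ has dimension $N$. Furthermore, given $\varepsilon>0$, the set $X$ can be chosen so that $\mu(B\setminus X)<\varepsilon$.
   Context: $B=\{z\in\mathbb{C}^N:\|z\|<1\}$ is the open unit ball of $\mathbb{C}^N$, $\overline{B}$ its closure, and $\mu$ is $2N$-dimensional Lebesgue measure on $\mathbb{C}^N=\mathbb{R}^{2N}$. "Polynomial" means polynomial in the complex coordinate functions $z_1,\dots,z_N$ with complex coefficients. For a compact set $X\subset\mathbb{C}^N$, $P(X)$ is the uniform closure on $X$ of the polynomials, and $R(X)$ is the uniform closure on $X$ of the rational functions holomorphic on a neighborhood of $X$; both are given the supremum norm on $X$. The rational hull of $X$ is $h_r(X)=\{z\in\mathbb{C}^N: p(z)\in p(X)\text{ for all polynomials } p\}$, and $X$ is rationally convex if $h_r(X)=X$. The maximal ideal space of $R(X)$ is naturally identified with $h_r(X)$ (so with $X$ itself when $X$ is rationally convex), a point $x\in X$ corresponding to evaluation at $x$. For a uniform algebra $A$ (a closed subalgebra of $C(X)$, $X$ compact Hausdorff, containing the constants and separating points of $X$), the Gleason parts of $A$ are the equivalence classes in the maximal ideal space of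 $A$ (the set of nonzero multiplicative linear functionals on $A$) under the equivalence relation $\varphi\sim\psi$ if $\|\varphi-\psi\|<2$ in the norm of the dual space $A^*$. For a multiplicative linear functional $\phi$ on $A$, a point derivation on $A$ at $\phi$ is a linear functional $\psi$ on $A$ with $\psi(fg)=\psi(f)\phi(g)+\phi(f)\psi(g)$ for all $f,g\in A$; it is bounded if it is continuous as a linear functional. A point derivation at a point $x\in X$ is one at evaluation at $x$; "dimension" is dimension as a complex vector space. *)

theory Defs
  imports "HOL-Analysis.Analysis" "HOL-Library.Function_Algebras"
begin

text \<open>
  \<open>\<complex>\<^sup>N\<close> is \<open>complex ^ 'n\<close> with \<open>N = CARD('n)\<close>; its norm is the Euclidean one, and \<open>lebesgue\<close>
  on this type is the \<open>2N\<close>-dimensional Lebesgue measure.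
\<close>

definition polynomials :: "(complex ^ 'n \<Rightarrow> complex) set" where
  "polynomials = {p. \<exists>(M :: ('n \<Rightarrow> nat) set) c. finite M \<and>
      p = (\<lambda>z. \<Sum>\<alpha>\<in>M. c \<alpha> * (\<Prod>i\<in>UNIV. (z $ i) ^ \<alpha> i))}"

definition rational_hull :: "(complex ^ 'n) set \<Rightarrow> (complex ^ 'n) set" where
  "rational_hull X = {z. \<forall>p\<in>polynomials. p z \<in> p ` X}"

definition rationally_convex :: "(complex ^ 'n) set \<Rightarrow> bool" where
  "rationally_convex X \<longleftrightarrow> rational_hull X = X"

definition holomorphic_vec_on :: "(complex ^ 'n \<Rightarrow> complex) \<Rightarrow> (complex ^ 'n) set \<Rightarrow> bool" where
  "holomorphic_vec_on f U \<longleftrightarrow>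
     (\<forall>z\<in>U. \<exists>D. (f has_derivative D) (at z) \<and> (\<forall>c v. D (c *s v) = c * D v))"

text \<open>
  The rational function \<open>p / q\<close> is holomorphic on \<open>U\<close> if it agrees off the (nowhere dense) zero set
  of \<open>q\<close> with a function \<open>f\<close> holomorphic on all of \<open>U\<close>; by continuity \<open>f\<close> is then unique on \<open>U\<close>.
  The values of \<open>f\<close> outside \<open>U\<close> are irrelevant.
\<close>

definition rationals_holomorphic_near :: "(complex ^ 'n) set \<Rightarrow> (complex ^ 'n \<Rightarrow> complex) set" where
  "rationals_holomorphic_near X = {f. \<exists>U. \<exists>p\<in>polynomials. \<exists>q\<in>polynomials.
      open U \<and> X \<subseteq> U \<and> holomorphic_vec_on f U \<and>
      (\<exists>z. q z \<noteq> 0) \<and> (\<forall>z\<in>U. q z \<noteq> 0 \<longrightarrow> f z = p z / q z)}"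

text \<open>
  A complex function on \<open>X\<close> is represented by its extension by \<open>0\<close> to the whole type, so that
  equality on \<open>X\<close> is equality, and sums, products and scalar multiples are the pointwise ones of
  the function type.
\<close>

definition uniform_closure :: "'a set \<Rightarrow> ('a \<Rightarrow> complex) set \<Rightarrow> ('a \<Rightarrow> complex) set" where
  "uniform_closure X F = {f. (\<forall>x. x \<notin> X \<longrightarrow> f x = 0) \<and>
      (\<forall>e>0. \<exists>g\<in>F. \<forall>x\<in>X. cmod (f x - g x) < e)}"

definition P_alg :: "(complex ^ 'n) set \<Rightarrow> (complex ^ 'n \<Rightarrow> complex) set" where
  "P_alg X = uniform_closure X polynomials"

definition R_alg :: "(complex ^ 'n) set \<Rightarrow> (complex ^ 'n \<Rightarrow> complex) set" where
  "R_alg X = uniform_closure X (rationals_holomorphic_near X)"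

definition sup_norm :: "'a set \<Rightarrow> ('a \<Rightarrow> complex) \<Rightarrow> real" where
  "sup_norm X f = (SUP x\<in>X. cmod (f x))"

definition fscale :: "complex \<Rightarrow> ('a \<Rightarrow> complex) \<Rightarrow> ('a \<Rightarrow> complex)" where
  "fscale c f = (\<lambda>x. c * f x)"

global_interpretation fun_vs: vector_space "fscale :: complex \<Rightarrow> ('a \<Rightarrow> complex) \<Rightarrow> 'a \<Rightarrow> complex"
  by unfold_locales (auto simp: fscale_def fun_eq_iff algebra_simps)

text \<open>
  In the following, \<open>A\<close> is a uniform algebra on \<open>X\<close>.  Functionals on \<open>A\<close> are likewise required to
  vanish off \<open>A\<close>, so that they are determined by their values on \<open>A\<close>; otherwise the dimension of
  a space of functionals would be wrong.
\<close>

definition linear_functional :: "('a \<Rightarrow> complex) set \<Rightarrow> (('a \<Rightarrow> complex) \<Rightarrow> complex) \<Rightarrow> bool" where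
  "linear_functional A \<phi> \<longleftrightarrow>
     (\<forall>f. f \<notin> A \<longrightarrow> \<phi> f = 0) \<and>
     (\<forall>f\<in>A. \<forall>g\<in>A. \<phi> (f + g) = \<phi> f + \<phi> g) \<and>
     (\<forall>c. \<forall>f\<in>A. \<phi> (fscale c f) = c * \<phi> f)"

definition continuous_functional ::
    "'a set \<Rightarrow> ('a \<Rightarrow> complex) set \<Rightarrow> (('a \<Rightarrow> complex) \<Rightarrow> complex) \<Rightarrow> bool" where
  "continuous_functional X A \<phi> \<longleftrightarrow>
     (\<forall>f\<in>A. \<forall>e>0. \<exists>d>0. \<forall>g\<in>A. sup_norm X (g - f) < d \<longrightarrow> cmod (\<phi> g - \<phi> f) < e)"

definition dual_norm ::
    "'a set \<Rightarrow> ('a \<Rightarrow> complex) set \<Rightarrow> (('a \<Rightarrow> complex) \<Rightarrow> complex) \<Rightarrow> ereal" where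
  "dual_norm X A \<phi> = (SUP f\<in>{f \<in> A. sup_norm X f \<le> 1}. ereal (cmod (\<phi> f)))"

definition max_ideal_space :: "('a \<Rightarrow> complex) set \<Rightarrow> (('a \<Rightarrow> complex) \<Rightarrow> complex) set" where
  "max_ideal_space A = {\<phi>. linear_functional A \<phi> \<and>
      (\<forall>f\<in>A. \<forall>g\<in>A. \<phi> (f * g) = \<phi> f * \<phi> g) \<and> (\<exists>f\<in>A. \<phi> f \<noteq> 0)}"

definition gleason_rel :: "'a set \<Rightarrow> ('a \<Rightarrow> complex) set \<Rightarrow> (('a \<Rightarrow> complex) \<Rightarrow> complex) rel" where
  "gleason_rel X A = {(\<phi>, \<psi>). \<phi> \<in> max_ideal_space A \<and> \<psi> \<in> max_ideal_space A \<and>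
      dual_norm X A (\<phi> - \<psi>) < 2}"

definition gleason_parts ::
    "'a set \<Rightarrow> ('a \<Rightarrow> complex) set \<Rightarrow> (('a \<Rightarrow> complex) \<Rightarrow> complex) set set" where
  "gleason_parts X A = max_ideal_space A // gleason_rel X A"

definition evaluation :: "('a \<Rightarrow> complex) set \<Rightarrow> 'a \<Rightarrow> ('a \<Rightarrow> complex) \<Rightarrow> complex" where
  "evaluation A x = (\<lambda>f. if f \<in> A then f x else 0)"

definition point_derivation ::
    "('a \<Rightarrow> complex) set \<Rightarrow> (('a \<Rightarrow> complex) \<Rightarrow> complex) \<Rightarrow> (('a \<Rightarrow> complex) \<Rightarrow> complex) \<Rightarrow> bool" where
  "point_derivation A \<phi> \<psi> \<longleftrightarrow> linear_functional A \<psi> \<and>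
     (\<forall>f\<in>A. \<forall>g\<in>A. \<psi> (f * g) = \<psi> f * \<phi> g + \<phi> f * \<psi> g)"

definition bounded_point_derivations ::
    "'a set \<Rightarrow> ('a \<Rightarrow> complex) set \<Rightarrow> (('a \<Rightarrow> complex) \<Rightarrow> complex) \<Rightarrow> (('a \<Rightarrow> complex) \<Rightarrow> complex) set" where
  "bounded_point_derivations X A \<phi> =
     {\<psi>. point_derivation A \<phi> \<psi> \<and> continuous_functional X A \<psi>}"

end

theory Submission
  imports Defs "HOL-Complex_Analysis.Great_Picard" "HOL-Complex_Analysis.Residue_Theorem"
begin

text \<open>
  The set is a closed ball, slightly smaller than \<open>B\<close>, from which a thin tube \<open>cmod (p n z) < e n\<close>
  around the zero set of a polynomial \<open>p n\<close> is removed for every \<open>n\<close>.  If the \<open>p n\<close> are uniformly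
  dense in the polynomials, then the polynomials without zeros on the remaining set \<open>X\<close> are dense; and
  \<open>X\<close> is rationally convex because every removed point is separated from \<open>X\<close> by a linear form or by
  one of the \<open>p n\<close>.  Thin tubes have small volume.

  What must be controlled is how far removing a tube enlarges the unit ball of bounded holomorphic
  functions.  The zero set of a polynomial is removable for bounded functions
  (\<open>unit_slice_hol_extension\<close>), so by a normal family argument a function bounded by 1 outside a
  sufficiently thin tube is close, together with its first derivatives, to a function bounded by 1 on
  the domain before the removal, on any compact set given in advance that avoids the zeros
  (\<open>unit_slice_hol_near\<close>).  On a compact subset of a connected domain the maximum principle gives
  \<open>cmod (f x - f y) \<le> 2 - b\<close> for all \<open>f\<close> bounded by 1 (\<open>unit_slice_hol_gleason\<close>), and Cauchy's estimate
  bounds the derivatives.  If each tube is chosen only after the constants \<open>b\<close> of the earlier stages,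
  half of the gap \<open>b\<close> and the bounds on the derivatives survive at all later stages.  By the
  Borel--Cantelli lemma almost every point of \<open>X\<close> belongs, from some stage on, to the compact sets on
  which these estimates hold.  These points form the set \<open>P\<close>.

  The argument needs connected domains at every stage, whose closures exceed them by null sets only.
  For this the zero sets are made transversal to the boundary of the domain, which has corners: an
  affine perturbation \<open>q z + c + pairing l z\<close> is transversal for almost all \<open>(c, l)\<close>, since the
  exceptional parameters form a Lipschitz image of a set of smaller dimension
  (\<open>negligible_tangent_params\<close>).  At a transversal zero there are directions pointing into the domain
  along which \<open>cmod p\<close> grows (\<open>growth_near_zeros\<close>), so a thin tube cuts off no component near the
  boundary (\<open>connected_remove_tube\<close>).  Then \<open>X\<close> is a decreasing intersection of connected compact sets.

  At a point of \<open>P\<close> the partial derivatives extend to bounded point derivations of \<open>R(X)\<close>, which are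
  independent.  Conversely, the product rule expresses a derivation on a quotient \<open>p / q\<close> with
  \<open>q x \<noteq> 0\<close> by its values on the coordinates; a rational function that is holomorphic near \<open>X\<close> but
  written with a denominator vanishing at \<open>x\<close> is a uniform limit of translates for which this does
  not happen (\<open>derivation_rational\<close>).
\<close>

section \<open>Polynomials on complex coordinate space\<close>

definition monom_fun :: "('n::finite \<Rightarrow> nat) \<Rightarrow> complex ^ 'n \<Rightarrow> complex" where
  "monom_fun \<alpha> z = (\<Prod>i\<in>UNIV. (z $ i) ^ \<alpha> i)"

lemma polynomials_alt:
  "p \<in> polynomials \<longleftrightarrow> (\<exists>M c. finite M \<and> p = (\<lambda>z. \<Sum>\<alpha>\<in>M. c \<alpha> * monom_fun \<alpha> z))"
  unfolding polynomials_def monom_fun_def by blast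

lemma polynomials_monom: "(\<lambda>z. c * monom_fun \<alpha> z) \<in> polynomials"
  unfolding polynomials_alt by (rule exI[of _ "{\<alpha>}"], rule exI[of _ "\<lambda>_. c"]) simp

lemma polynomials_add:
  assumes "p \<in> polynomials" "q \<in> polynomials"
  shows "(\<lambda>z. p z + q z) \<in> polynomials"
proof -
  obtain M c where M: "finite M" "p = (\<lambda>z. \<Sum>\<alpha>\<in>M. c \<alpha> * monom_fun \<alpha> z)"
    using assms(1) unfolding polynomials_alt by blast
  obtain L d where L: "finite L" "q = (\<lambda>z. \<Sum>\<alpha>\<in>L. d \<alpha> * monom_fun \<alpha> z)"
    using assms(2) unfolding polynomials_alt by blast
  define e where "e \<alpha> = (if \<alpha> \<in> M then c \<alpha> else 0) + (if \<alpha> \<in> L then d \<alpha> else 0)" for \<alpha>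
  have "p z + q z = (\<Sum>\<alpha>\<in>M \<union> L. e \<alpha> * monom_fun \<alpha> z)" for z
  proof -
    have "p z = (\<Sum>\<alpha>\<in>M \<union> L. (if \<alpha> \<in> M then c \<alpha> else 0) * monom_fun \<alpha> z)"
      unfolding M(2) by (rule sum.mono_neutral_cong_left) (use M(1) L(1) in auto)
    moreover have "q z = (\<Sum>\<alpha>\<in>M \<union> L. (if \<alpha> \<in> L then d \<alpha> else 0) * monom_fun \<alpha> z)"
      unfolding L(2) by (rule sum.mono_neutral_cong_left) (use M(1) L(1) in auto)
    ultimately show ?thesis
      by (simp add: e_def distrib_right flip: sum.distrib)
  qed
  then show ?thesis
    unfolding polynomials_alt using M(1) L(1) by blast
qed

lemma polynomials_const: "(\<lambda>z::complex^'n::finite. c) \<in> polynomials"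
proof -
  have "(\<lambda>z::complex^'n. c) = (\<lambda>z. c * monom_fun (\<lambda>_. 0) z)"
    by (simp add: monom_fun_def)
  then show ?thesis using polynomials_monom[of c "\<lambda>_. 0"] by simp
qed

lemma polynomials_coord: "(\<lambda>z::complex^'n::finite. z $ i) \<in> polynomials"
proof -
  have "z $ i = 1 * monom_fun (\<lambda>j. if j = i then 1 else 0) z" for z :: "complex^'n"
  proof -
    have "monom_fun (\<lambda>j. if j = i then 1 else 0) z = (\<Prod>j\<in>UNIV. if j = i then z $ j else 1)"
      unfolding monom_fun_def by (rule prod.cong) auto
    also have "\<dots> = z $ i" by (simp add: prod.delta)
    finally show ?thesis by simp
  qed
  then show ?thesis using polynomials_monom[of 1 "\<lambda>j. if j = i then 1 else 0"] by simp
qed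

lemma polynomials_sum:
  assumes "finite I" "\<And>i. i \<in> I \<Longrightarrow> p i \<in> polynomials"
  shows "(\<lambda>z. \<Sum>i\<in>I. p i z) \<in> polynomials"
  using assms by (induction I rule: finite_induct) (auto intro: polynomials_const polynomials_add)

lemma polynomials_mult:
  assumes "p \<in> polynomials" "q \<in> polynomials"
  shows "(\<lambda>z. p z * q z) \<in> polynomials"
proof -
  obtain M c where M: "finite M" "p = (\<lambda>z. \<Sum>\<alpha>\<in>M. c \<alpha> * monom_fun \<alpha> z)"
    using assms(1) unfolding polynomials_alt by blast
  obtain L d where L: "finite L" "q = (\<lambda>z. \<Sum>\<alpha>\<in>L. d \<alpha> * monom_fun \<alpha> z)"
    using assms(2) unfolding polynomials_alt by blast
  have "(\<lambda>z. p z * q z) = (\<lambda>z. \<Sum>\<alpha>\<in>M. \<Sum>\<beta>\<in>L. (c \<alpha> * d \<beta>) * monom_fun (\<lambda>i. \<alpha> i + \<beta> i) z)"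
    unfolding M(2) L(2)
    by (simp add: sum_product monom_fun_def power_add prod.distrib mult_ac)
  also have "\<dots> \<in> polynomials"
    by (intro polynomials_sum M L polynomials_monom)
  finally show ?thesis .
qed

lemma polynomials_prod:
  assumes "finite I" "\<And>i. i \<in> I \<Longrightarrow> p i \<in> polynomials"
  shows "(\<lambda>z. \<Prod>i\<in>I. p i z) \<in> polynomials"
  using assms by (induction I rule: finite_induct) (auto intro: polynomials_const polynomials_mult)

lemma polynomials_power: "p \<in> polynomials \<Longrightarrow> (\<lambda>z. p z ^ k) \<in> polynomials"
  by (induction k) (auto intro: polynomials_const polynomials_mult)

text \<open>
  Every polynomial is built from constants and coordinates by sums and products, so that a property
  stable under these operations need only be checked on them.
\<close>

lemma polynomials_induct [consumes 1, case_names const coord add mult]: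
  fixes p :: "complex ^ 'n::finite \<Rightarrow> complex"
  assumes "p \<in> polynomials"
    and const: "\<And>c. Q (\<lambda>z. c)"
    and coord: "\<And>i. Q (\<lambda>z. z $ i)"
    and add: "\<And>p q. p \<in> polynomials \<Longrightarrow> q \<in> polynomials \<Longrightarrow> Q p \<Longrightarrow> Q q \<Longrightarrow> Q (\<lambda>z. p z + q z)"
    and mult: "\<And>p q. p \<in> polynomials \<Longrightarrow> q \<in> polynomials \<Longrightarrow> Q p \<Longrightarrow> Q q \<Longrightarrow> Q (\<lambda>z. p z * q z)"
  shows "Q p"
proof -
  obtain M c where M: "finite M" "p = (\<lambda>z. \<Sum>\<alpha>\<in>M. c \<alpha> * monom_fun \<alpha> z)"
    using assms(1) unfolding polynomials_alt by blast
  have pow: "Q (\<lambda>z. (z $ i) ^ k)" for i and k :: nat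
  proof (induction k)
    case (Suc k)
    show ?case
      using mult[OF polynomials_coord polynomials_power[OF polynomials_coord] coord Suc]
      by simp
  qed (simp add: const)
  have prd: "Q (\<lambda>z. \<Prod>i\<in>I. (z $ i) ^ \<alpha> i)" if "finite I" for I and \<alpha> :: "'n \<Rightarrow> nat"
    using that
    by (induction I rule: finite_induct)
       (auto intro!: const mult[of "\<lambda>z. (z $ _) ^ _"] pow polynomials_prod polynomials_power polynomials_coord)
  have mon: "Q (\<lambda>z. c * monom_fun \<alpha> z)" for c \<alpha>
    unfolding monom_fun_def
    by (intro mult const prd polynomials_const polynomials_prod polynomials_power polynomials_coord) auto
  have "Q (\<lambda>z. \<Sum>\<alpha>\<in>M. c \<alpha> * monom_fun \<alpha> z)"
    using M(1) by (induction M rule: finite_induct)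
       (auto intro!: const add mon polynomials_sum polynomials_monom)
  then show ?thesis using M(2) by simp
qed

text \<open>
  The partial derivatives are polynomials again, so that the gradient is itself differentiable.
\<close>

lemma polynomials_has_gradient:
  fixes p :: "complex ^ 'n::finite \<Rightarrow> complex"
  assumes "p \<in> polynomials"
  shows "\<exists>P. (\<forall>j. P j \<in> polynomials) \<and> (\<forall>z. (p has_derivative (\<lambda>h. \<Sum>j\<in>UNIV. P j z * h $ j)) (at z))"
  using assms
proof (induction p rule: polynomials_induct)
  case (const c)
  show ?case by (rule exI[of _ "\<lambda>j z. 0"]) (auto intro: polynomials_const)
next
  case (coord i)
  have "(\<lambda>h. \<Sum>j\<in>UNIV. (if j = i then 1 else 0) * h $ j) = (\<lambda>h::complex^'n. h $ i)"
    by (rule ext) (simp add: sum.delta if_distrib[of "\<lambda>x. x * _"] cong: if_cong)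
  moreover have "((\<lambda>z::complex^'n. z $ i) has_derivative (\<lambda>h. h $ i)) (at z)" for z
    by (rule bounded_linear_imp_has_derivative) (rule bounded_linear_vec_nth)
  ultimately show ?case
    by (intro exI[of _ "\<lambda>j z. if j = i then 1 else 0"]) (auto intro: polynomials_const)
next
  case (add p q)
  then obtain P R where P: "\<And>j. P j \<in> polynomials" "\<And>z. (p has_derivative (\<lambda>h. \<Sum>j\<in>UNIV. P j z * h $ j)) (at z)"
    and R: "\<And>j. R j \<in> polynomials" "\<And>z. (q has_derivative (\<lambda>h. \<Sum>j\<in>UNIV. R j z * h $ j)) (at z)"
    by blast
  show ?case
  proof (intro exI[of _ "\<lambda>j z. P j z + R j z"] conjI allI)
    show "((\<lambda>z. p z + q z) has_derivative (\<lambda>h. \<Sum>j\<in>UNIV. (P j z + R j z) * h $ j)) (at z)" for z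
      using has_derivative_add[OF P(2)[of z] R(2)[of z]]
      by (simp add: distrib_right sum.distrib)
  qed (intro polynomials_add P R)
next
  case (mult p q)
  then obtain P R where P: "\<And>j. P j \<in> polynomials" "\<And>z. (p has_derivative (\<lambda>h. \<Sum>j\<in>UNIV. P j z * h $ j)) (at z)"
    and R: "\<And>j. R j \<in> polynomials" "\<And>z. (q has_derivative (\<lambda>h. \<Sum>j\<in>UNIV. R j z * h $ j)) (at z)"
    by blast
  show ?case
  proof (intro exI[of _ "\<lambda>j z. p z * R j z + P j z * q z"] conjI allI)
    show "((\<lambda>z. p z * q z) has_derivative (\<lambda>h. \<Sum>j\<in>UNIV. (p z * R j z + P j z * q z) * h $ j)) (at z)" for z
      using has_derivative_mult[OF P(2)[of z] R(2)[of z]]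
      by (simp add: algebra_simps sum.distrib sum_distrib_left)
  qed (intro polynomials_add polynomials_mult P R mult)
qed

lemma polynomials_differentiable: "p \<in> polynomials \<Longrightarrow> p differentiable (at z)"
  using polynomials_has_gradient[of p] unfolding differentiable_def by blast

lemma polynomials_continuous_on: "p \<in> polynomials \<Longrightarrow> continuous_on A p"
  using polynomials_differentiable[of p]
  by (meson continuous_at_imp_continuous_on differentiable_imp_continuous_within)

lemma polynomials_translate:
  assumes "p \<in> polynomials"
  shows "(\<lambda>z. p (z + t)) \<in> polynomials"
  using assms
proof (induction p rule: polynomials_induct)
  case (coord i)
  show ?case using polynomials_add[OF polynomials_coord polynomials_const[of "t $ i"]] by simp
qed (auto intro: polynomials_const polynomials_add polynomials_mult)

lemma polynomials_slice_holomorphic: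
  assumes "p \<in> polynomials"
  shows "(\<lambda>\<zeta>. p (z + \<zeta> *s v)) holomorphic_on A"
  using assms
  by (induction p rule: polynomials_induct) (auto intro!: holomorphic_intros)

text \<open>
  On the complex line through a zero and a non-zero, a polynomial is an entire function of one
  variable, so the identity theorem forbids it to vanish near the zero.
\<close>

lemma polynomials_nonzero_dense:
  fixes p :: "complex ^ 'n::finite \<Rightarrow> complex"
  assumes "p \<in> polynomials" "p w \<noteq> 0" "open D" "D \<noteq> {}"
  shows "\<exists>z\<in>D. p z \<noteq> 0"
proof (rule ccontr)
  assume con: "\<not> ?thesis"
  obtain z where z: "z \<in> D" using assms(4) by blast
  define f where "f \<zeta> = p (z + \<zeta> *s (w - z))" for \<zeta>
  have hol: "f holomorphic_on UNIV"
    unfolding f_def by (rule polynomials_slice_holomorphic[OF assms(1)])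
  define T where "T = {\<zeta>. z + \<zeta> *s (w - z) \<in> D}"
  have cont: "continuous_on UNIV (\<lambda>\<zeta>. z + \<zeta> *s (w - z))"
    unfolding vector_scalar_mult_def by (intro continuous_intros)
  have "open T"
    using open_vimage[OF assms(3) cont] by (simp add: T_def vimage_def)
  moreover have "0 \<in> T" using z by (simp add: T_def)
  ultimately have lim: "0 islimpt T" by (simp add: interior_limit_point interior_open)
  have "f 1 = 0"
  proof (rule analytic_continuation[OF hol open_UNIV connected_UNIV _ _ lim])
    show "f \<zeta> = 0" if "\<zeta> \<in> T" for \<zeta>
      using con that by (auto simp: T_def f_def)
  qed auto
  then show False using assms(2) by (simp add: f_def)
qed

lemma polynomials_mult_nonzero:
  fixes p q :: "complex ^ 'n::finite \<Rightarrow> complex"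
  assumes "p \<in> polynomials" "q \<in> polynomials" "p w \<noteq> 0" "q w' \<noteq> 0"
  shows "\<exists>z. p z * q z \<noteq> 0"
proof -
  have "open (p -` (-{0}))"
    by (rule open_vimage) (auto intro: polynomials_continuous_on assms)
  moreover have "w \<in> p -` (-{0})" using assms by auto
  ultimately obtain z where "z \<in> p -` (-{0})" "q z \<noteq> 0"
    using polynomials_nonzero_dense[OF assms(2,4)] by blast
  then show ?thesis by auto
qed

text \<open>
  Rounding the coefficients to points of a countable dense set gives a countable uniformly dense
  family.
\<close>

lemma polynomials_countable_dense:
  shows "\<exists>D :: (complex ^ 'n::finite \<Rightarrow> complex) set. countable D \<and> D \<noteq> {} \<and> D \<subseteq> polynomials \<and>
    (\<forall>p\<in>polynomials. \<forall>e>0. \<exists>d\<in>D. \<forall>z\<in>cball 0 1. cmod (p z - d z) < e)"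
proof -
  obtain Q :: "complex set" where Q: "countable Q" "\<And>x e. e > 0 \<Longrightarrow> \<exists>y\<in>Q. dist x y < e"
  proof -
    obtain B :: "complex set" where B: "countable B" "\<And>X. open X \<Longrightarrow> X \<noteq> {} \<Longrightarrow> \<exists>d\<in>B. d \<in> X"
      using countable_dense_setE by metis
    show ?thesis
    proof (rule that[OF B(1)])
      fix x :: complex and e :: real assume "e > 0"
      then show "\<exists>y\<in>B. dist x y < e" using B(2)[of "ball x e"] by auto
    qed
  qed
  define F where "F S = (\<lambda>z::complex^'n. \<Sum>(\<alpha>,a)\<in>S. a * monom_fun \<alpha> z)" for S
  define D where "D = F ` {S. finite S \<and> S \<subseteq> UNIV \<times> Q}"
  have "countable (UNIV \<times> Q :: (('n \<Rightarrow> nat) \<times> complex) set)"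
    using Q(1) by (intro countable_SIGMA) auto
  then have cD: "countable D"
    unfolding D_def by (intro countable_image countable_Collect_finite_subset)
  have neD: "D \<noteq> {}" unfolding D_def by blast
  have sub: "D \<subseteq> polynomials"
    unfolding D_def F_def by (auto simp: case_prod_unfold intro!: polynomials_sum polynomials_monom)
  have "\<exists>d\<in>D. \<forall>z\<in>cball 0 1. cmod (p z - d z) < e" if p: "p \<in> polynomials" and e: "e > 0" for p e
  proof -
    obtain M c where M: "finite M" "p = (\<lambda>z. \<Sum>\<alpha>\<in>M. c \<alpha> * monom_fun \<alpha> z)"
      using p unfolding polynomials_alt by blast
    define \<delta> where "\<delta> = e / (real (card M) + 1)"
    have \<delta>: "\<delta> > 0" using e by (simp add: \<delta>_def)
    have "\<forall>\<alpha>. \<exists>y. y \<in> Q \<and> dist (c \<alpha>) y < \<delta>" using Q(2)[OF \<delta>] by blast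
    then obtain c' where c': "\<And>\<alpha>. c' \<alpha> \<in> Q" "\<And>\<alpha>. dist (c \<alpha>) (c' \<alpha>) < \<delta>"
      using choice by metis
    have FS: "F ((\<lambda>\<alpha>. (\<alpha>, c' \<alpha>)) ` M) z = (\<Sum>\<alpha>\<in>M. c' \<alpha> * monom_fun \<alpha> z)" for z
      unfolding F_def by (subst sum.reindex) (auto simp: inj_on_def)
    have mb: "cmod (monom_fun \<alpha> z) \<le> 1" if "z \<in> cball 0 1" for \<alpha> and z :: "complex^'n"
    proof -
      have "cmod (z $ i) \<le> 1" for i
        using that Finite_Cartesian_Product.norm_nth_le[of z i] by (simp add: dist_norm)
      then show ?thesis
        unfolding monom_fun_def by (auto simp: norm_power power_le_one simp flip: prod_norm intro!: prod_le_1)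
    qed
    have "cmod (p z - F ((\<lambda>\<alpha>. (\<alpha>, c' \<alpha>)) ` M) z) < e" if z: "z \<in> cball 0 1" for z
    proof -
      have "p z - F ((\<lambda>\<alpha>. (\<alpha>, c' \<alpha>)) ` M) z = (\<Sum>\<alpha>\<in>M. (c \<alpha> - c' \<alpha>) * monom_fun \<alpha> z)"
        by (simp add: FS M(2) sum_subtractf left_diff_distrib)
      also have "cmod \<dots> \<le> (\<Sum>\<alpha>\<in>M. \<delta> * 1)"
      proof (rule sum_norm_le)
        show "cmod ((c \<alpha> - c' \<alpha>) * monom_fun \<alpha> z) \<le> \<delta> * 1" for \<alpha>
          unfolding norm_mult using c'(2)[of \<alpha>] mb[OF z] \<delta> by (intro mult_mono) (auto simp: dist_norm)
      qed
      also have "\<dots> < e" using e by (simp add: \<delta>_def field_simps)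
      finally show ?thesis .
    qed
    moreover have "F ((\<lambda>\<alpha>. (\<alpha>, c' \<alpha>)) ` M) \<in> D"
      unfolding D_def using c'(1) M(1) by blast
    ultimately show ?thesis by blast
  qed
  then show ?thesis using cD neD sub by blast
qed

section \<open>Functions holomorphic on every complex line\<close>

text \<open>
  For continuous functions, holomorphy on all complex lines is the same as holomorphy (Osgood's lemma).
  In this form it passes to locally uniform limits by the theorem of Weierstrass in one variable.
\<close>

definition slice_hol :: "(complex ^ 'n::finite \<Rightarrow> complex) \<Rightarrow> (complex ^ 'n) set \<Rightarrow> bool" where
  "slice_hol f W \<longleftrightarrow> continuous_on W f \<and>
     (\<forall>z v. (\<lambda>\<zeta>. f (z + \<zeta> *s v)) holomorphic_on {\<zeta>. z + \<zeta> *s v \<in> W})"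

definition unit_slice_hol :: "(complex ^ 'n::finite) set \<Rightarrow> (complex ^ 'n \<Rightarrow> complex) set" where
  "unit_slice_hol W = {f. slice_hol f W \<and> (\<forall>w\<in>W. cmod (f w) \<le> 1)}"

definition dir_deriv :: "'n \<Rightarrow> (complex ^ 'n::finite \<Rightarrow> complex) \<Rightarrow> complex ^ 'n \<Rightarrow> complex" where
  "dir_deriv i f x = deriv (\<lambda>\<zeta>. f (x + \<zeta> *s axis i 1)) 0"

lemma norm_cmult_vec: "norm (c *s v) = cmod c * norm v" for v :: "complex ^ 'n::finite"
  by (simp add: norm_vec_def vector_scalar_mult_def norm_mult L2_set_right_distrib)

lemma continuous_on_line: "continuous_on A (\<lambda>\<zeta>. z + \<zeta> *s v)" for v :: "complex ^ 'n::finite"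
  unfolding vector_scalar_mult_def by (intro continuous_intros)

lemma open_line: "open W \<Longrightarrow> open {\<zeta>. z + \<zeta> *s v \<in> W}" for v :: "complex ^ 'n::finite"
  using open_vimage[OF _ continuous_on_line[of UNIV z v]] by (simp add: vimage_def)

lemma dist_line: "dist (z + a *s v) (z + b *s v) = cmod (a - b) * norm v" for v :: "complex ^ 'n::finite"
proof -
  have "(z + a *s v) - (z + b *s v) = (a - b) *s v" by (simp add: vec_eq_iff algebra_simps)
  then show ?thesis by (simp only: dist_norm norm_cmult_vec)
qed

lemma slice_hol_subset: "slice_hol f W \<Longrightarrow> V \<subseteq> W \<Longrightarrow> slice_hol f V"
  unfolding slice_hol_def
  by (blast intro: continuous_on_subset holomorphic_on_subset)

lemma unit_slice_hol_subset: "f \<in> unit_slice_hol W \<Longrightarrow> V \<subseteq> W \<Longrightarrow> f \<in> unit_slice_hol V"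
  unfolding unit_slice_hol_def using slice_hol_subset by blast

lemma slice_hol_cong: "slice_hol f W \<Longrightarrow> (\<And>z. z \<in> W \<Longrightarrow> f z = g z) \<Longrightarrow> slice_hol g W"
  unfolding slice_hol_def
  by (metis (mono_tags, lifting) continuous_on_cong holomorphic_cong mem_Collect_eq)

lemma slice_hol_polynomial: "p \<in> polynomials \<Longrightarrow> slice_hol p W"
  unfolding slice_hol_def by (simp add: polynomials_continuous_on polynomials_slice_holomorphic)

lemma slice_hol_const: "slice_hol (\<lambda>z. c) W"
  by (rule slice_hol_polynomial[OF polynomials_const])

lemma slice_hol_diff: "slice_hol f W \<Longrightarrow> slice_hol g W \<Longrightarrow> slice_hol (\<lambda>z. f z - g z) W"
  unfolding slice_hol_def by (auto intro!: continuous_intros holomorphic_intros)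

lemma slice_hol_mult: "slice_hol f W \<Longrightarrow> slice_hol g W \<Longrightarrow> slice_hol (\<lambda>z. f z * g z) W"
  unfolding slice_hol_def by (auto intro!: continuous_intros holomorphic_intros)

lemma slice_hol_local:
  assumes "\<And>z. z \<in> W \<Longrightarrow> \<exists>r>0. slice_hol f (ball z r)"
  shows "slice_hol f W"
  unfolding slice_hol_def
proof (intro conjI allI)
  show "continuous_on W f"
  proof (rule continuous_at_imp_continuous_on, rule ballI)
    fix z assume "z \<in> W"
    then obtain r where "r > 0" "slice_hol f (ball z r)" using assms by blast
    then show "isCont f z"
      unfolding slice_hol_def using continuous_on_eq_continuous_at[OF open_ball, of z r f] by auto
  qed
  fix z v
  show "(\<lambda>\<zeta>. f (z + \<zeta> *s v)) holomorphic_on {\<zeta>. z + \<zeta> *s v \<in> W}"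
    unfolding holomorphic_on_def
  proof (rule ballI)
    fix \<zeta> assume "\<zeta> \<in> {\<zeta>. z + \<zeta> *s v \<in> W}"
    then obtain r where r: "r > 0" "slice_hol f (ball (z + \<zeta> *s v) r)" using assms by blast
    define T where "T = {\<xi>. z + \<xi> *s v \<in> ball (z + \<zeta> *s v) r}"
    have "(\<lambda>\<zeta>. f (z + \<zeta> *s v)) holomorphic_on T"
      using r(2) unfolding slice_hol_def T_def by blast
    moreover have "open T" unfolding T_def by (rule open_line) simp
    moreover have "\<zeta> \<in> T" using r(1) by (simp add: T_def)
    ultimately have "(\<lambda>\<zeta>. f (z + \<zeta> *s v)) field_differentiable (at \<zeta>)"
      by (rule holomorphic_on_imp_differentiable_at)
    then show "(\<lambda>\<zeta>. f (z + \<zeta> *s v)) field_differentiable at \<zeta> within {\<zeta>. z + \<zeta> *s v \<in> W}"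
      by (rule field_differentiable_at_within)
  qed
qed

text \<open>Cauchy's estimate on the disc of half the radius, where \<open>\<phi>\<close> is continuous up to the boundary.\<close>

lemma deriv_bound:
  assumes "\<phi> holomorphic_on ball a R" "R > 0" "\<And>\<zeta>. \<zeta> \<in> ball a R \<Longrightarrow> cmod (\<phi> \<zeta>) \<le> B"
  shows "cmod (deriv \<phi> a) \<le> 2 * B / R"
proof -
  have sub: "cball a (R/2) \<subseteq> ball a R" using assms(2) by auto
  have "norm ((deriv ^^ 1) \<phi> a) \<le> fact 1 * B / (R/2) ^ 1"
  proof (rule Cauchy_inequality)
    show "\<phi> holomorphic_on ball a (R/2)"
      using assms(1) by (rule holomorphic_on_subset) (use assms(2) in auto)
    show "continuous_on (cball a (R/2)) \<phi>"
      using holomorphic_on_imp_continuous_on[OF assms(1)] sub continuous_on_subset by blast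
    show "cmod (\<phi> x) \<le> B" if "cmod (a - x) = R/2" for x
      using assms(2) that by (intro assms(3)) (auto simp: dist_norm)
  qed (use assms(2) in auto)
  then show ?thesis by (simp add: mult.commute)
qed

lemma disc_lipschitz:
  assumes "\<phi> holomorphic_on ball 0 R" "R > 2" "\<And>\<zeta>. \<zeta> \<in> ball 0 R \<Longrightarrow> cmod (\<phi> \<zeta>) \<le> 1"
  shows "cmod (\<phi> 1 - \<phi> 0) \<le> 4 / R"
proof -
  have sub: "ball \<zeta> (R/2) \<subseteq> ball 0 R" if "\<zeta> \<in> ball 0 (R/2)" for \<zeta> :: complex
  proof
    fix x assume "x \<in> ball \<zeta> (R/2)"
    then show "x \<in> ball 0 R" using that dist_triangle[of 0 x \<zeta>] by simp
  qed
  have "cmod (\<phi> 1 - \<phi> 0) \<le> 4 / R * cmod (1 - 0)"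
  proof (rule field_differentiable_bound[of "ball 0 (R/2)" \<phi> "deriv \<phi>"])
    fix \<zeta> :: complex assume z: "\<zeta> \<in> ball 0 (R/2)"
    have "\<zeta> \<in> ball 0 R" using z assms(2) by auto
    then show "(\<phi> has_field_derivative deriv \<phi> \<zeta>) (at \<zeta> within ball 0 (R/2))"
      using holomorphic_derivI[OF assms(1) open_ball] by blast
    have "cmod (deriv \<phi> \<zeta>) \<le> 2 * 1 / (R/2)"
      using assms(2,3) sub[OF z] holomorphic_on_subset[OF assms(1) sub[OF z]]
      by (intro deriv_bound) auto
    then show "cmod (deriv \<phi> \<zeta>) \<le> 4 / R" by simp
  qed (use assms(2) in auto)
  then show ?thesis by simp
qed

text \<open>
  Functions bounded by 1 are Lipschitz with a constant that depends only on the distance to the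
  complement of the domain; this equicontinuity is what makes them a normal family.
\<close>

lemma unit_slice_hol_lipschitz:
  assumes f: "f \<in> unit_slice_hol W" and r: "ball x r \<subseteq> W" and d: "dist x y < r / 2"
  shows "cmod (f y - f x) \<le> 4 / r * dist x y"
proof (cases "x = y")
  case False
  define R where "R = r / dist x y"
  have dp: "dist x y > 0" using False by simp
  have rp: "r > 0" using d dp by linarith
  have R: "R > 2" using d dp by (simp add: R_def field_simps)
  define \<phi> where "\<phi> \<zeta> = f (x + \<zeta> *s (y - x))" for \<zeta>
  have inb: "x + \<zeta> *s (y - x) \<in> W" if "\<zeta> \<in> ball 0 R" for \<zeta>
  proof -
    have "dist x (x + \<zeta> *s (y - x)) = cmod \<zeta> * dist x y"
      using dist_line[of x 0 "y - x" \<zeta>] by (simp add: dist_norm norm_minus_commute)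
    also have "\<dots> < r" using that dp by (simp add: R_def field_simps)
    finally show ?thesis using r by auto
  qed
  have "\<phi> holomorphic_on {\<zeta>. x + \<zeta> *s (y - x) \<in> W}"
    using f unfolding \<phi>_def unit_slice_hol_def slice_hol_def by blast
  then have "\<phi> holomorphic_on ball 0 R"
    by (rule holomorphic_on_subset) (use inb in auto)
  then have "cmod (\<phi> 1 - \<phi> 0) \<le> 4 / R"
  proof (rule disc_lipschitz[OF _ R])
    show "cmod (\<phi> \<zeta>) \<le> 1" if "\<zeta> \<in> ball 0 R" for \<zeta>
      using inb[OF that] f by (simp only: unit_slice_hol_def \<phi>_def mem_Collect_eq)
  qed
  moreover have "4 / R = 4 / r * dist x y" using dp rp by (simp add: R_def)
  ultimately show ?thesis by (simp add: \<phi>_def)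
qed simp

lemma dir_deriv_bound:
  assumes "slice_hol f (ball x s)" "s > 0" "\<And>w. w \<in> ball x s \<Longrightarrow> cmod (f w) \<le> B"
  shows "cmod (dir_deriv i f x) \<le> 2 * B / s"
proof -
  have inb: "x + \<zeta> *s axis i 1 \<in> ball x s" if "\<zeta> \<in> ball 0 s" for \<zeta>
  proof -
    have "norm (axis i (1::complex)) = 1" by simp
    then show ?thesis using that dist_line[of x 0 "axis i 1" \<zeta>] by simp
  qed
  have "(\<lambda>\<zeta>. f (x + \<zeta> *s axis i 1)) holomorphic_on {\<zeta>. x + \<zeta> *s axis i 1 \<in> ball x s}"
    using assms(1) unfolding slice_hol_def by blast
  then have "(\<lambda>\<zeta>. f (x + \<zeta> *s axis i 1)) holomorphic_on ball 0 s"
    by (rule holomorphic_on_subset) (use inb in auto)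
  then show ?thesis
    unfolding dir_deriv_def using assms(2,3) inb by (intro deriv_bound) auto
qed

lemma slice_hol_field_differentiable:
  assumes "slice_hol f W" "open W" "x \<in> W"
  shows "(\<lambda>\<zeta>. f (x + \<zeta> *s v)) field_differentiable (at 0)"
proof (rule holomorphic_on_imp_differentiable_at)
  show "(\<lambda>\<zeta>. f (x + \<zeta> *s v)) holomorphic_on {\<zeta>. x + \<zeta> *s v \<in> W}"
    using assms(1) unfolding slice_hol_def by blast
qed (use assms in \<open>auto intro: open_line\<close>)

lemma dir_deriv_diff:
  assumes "slice_hol f W" "slice_hol g W" "open W" "x \<in> W"
  shows "dir_deriv i (\<lambda>z. f z - g z) x = dir_deriv i f x - dir_deriv i g x"
  unfolding dir_deriv_def
  by (rule deriv_diff) (use assms in \<open>auto intro: slice_hol_field_differentiable\<close>)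

lemma slice_hol_uniform_limit:
  assumes "\<And>z. z \<in> W \<Longrightarrow> \<exists>r>0. (\<forall>\<^sub>F k in sequentially. slice_hol (f k) (ball z r)) \<and>
              uniform_limit (ball z r) f h sequentially"
  shows "slice_hol h W"
proof (rule slice_hol_local)
  fix z0 assume "z0 \<in> W"
  then obtain r where r: "r > 0" "\<forall>\<^sub>F k in sequentially. slice_hol (f k) (ball z0 r)"
    "uniform_limit (ball z0 r) f h sequentially" using assms by blast
  then obtain N where N: "\<And>k. k \<ge> N \<Longrightarrow> slice_hol (f k) (ball z0 r)"
    unfolding eventually_sequentially by blast
  have ul: "uniform_limit (ball z0 r) (\<lambda>k. f (k + N)) h sequentially"
    unfolding uniform_limit_iff
  proof (intro allI impI)
    fix e :: real assume "e > 0"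
    then have "\<forall>\<^sub>F k in sequentially. \<forall>x\<in>ball z0 r. dist (f k x) (h x) < e"
      using r(3) by (rule uniform_limitD[rotated])
    then show "\<forall>\<^sub>F k in sequentially. \<forall>x\<in>ball z0 r. dist (f (k + N) x) (h x) < e"
      using eventually_sequentially_seg[of "\<lambda>k. \<forall>x\<in>ball z0 r. dist (f k x) (h x) < e" N] by simp
  qed
  have "slice_hol h (ball z0 r)"
    unfolding slice_hol_def
  proof (intro conjI allI)
    show "continuous_on (ball z0 r) h"
      using ul by (rule uniform_limit_theorem[rotated]) (use N in \<open>auto simp: slice_hol_def\<close>)
    fix z v
    define T where "T = {\<zeta>. z + \<zeta> *s v \<in> ball z0 r}"
    show "(\<lambda>\<zeta>. h (z + \<zeta> *s v)) holomorphic_on T"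
    proof (rule holomorphic_uniform_sequence)
      show T: "open T" unfolding T_def by (rule open_line) simp
      show "(\<lambda>\<zeta>. f (n + N) (z + \<zeta> *s v)) holomorphic_on T" for n
        using N[of "n + N"] unfolding slice_hol_def T_def by auto
      fix x assume "x \<in> T"
      then obtain d where d: "d > 0" "cball x d \<subseteq> T" using T open_contains_cball by blast
      have "uniform_limit (cball x d) (\<lambda>n \<zeta>. f (n + N) (z + \<zeta> *s v)) (\<lambda>\<zeta>. h (z + \<zeta> *s v)) sequentially"
        using ul by (rule uniform_limit_compose') (use d in \<open>auto simp: T_def\<close>)
      then show "\<exists>d>0. cball x d \<subseteq> T \<and>
          uniform_limit (cball x d) (\<lambda>n \<zeta>. f (n + N) (z + \<zeta> *s v)) (\<lambda>\<zeta>. h (z + \<zeta> *s v)) sequentially"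
        using d by blast
    qed
  qed
  then show "\<exists>r>0. slice_hol h (ball z0 r)" using r(1) by blast
qed

lemma compact_finite_ball_cover:
  fixes L :: "'a::metric_space set"
  assumes L: "compact L" and d: "\<And>z. z \<in> L \<Longrightarrow> d z > 0"
  obtains F where "F \<subseteq> L" "finite F" "L \<subseteq> (\<Union>z\<in>F. ball z (d z))"
proof (rule compactE_image[OF L])
  show "open (ball z (d z))" for z by simp
  show "L \<subseteq> (\<Union>z\<in>L. ball z (d z))" using d by force
qed (use that in blast)

text \<open>
  Montel's theorem on growing domains: a diagonal subsequence converges on a countable dense set,
  and equicontinuity turns this into locally uniform convergence.
\<close>

lemma unit_slice_hol_Montel:
  fixes g :: "nat \<Rightarrow> complex ^ 'n::finite \<Rightarrow> complex"
  assumes g: "\<And>k. g k \<in> unit_slice_hol (V k)"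
    and V: "\<And>z. z \<in> W \<Longrightarrow> \<exists>r>0. \<exists>k0. \<forall>k\<ge>k0. ball z r \<subseteq> V k" and "open W"
  shows "\<exists>\<sigma> h. strict_mono (\<sigma> :: nat \<Rightarrow> nat) \<and> h \<in> unit_slice_hol W \<and>
    (\<forall>L. compact L \<longrightarrow> L \<subseteq> W \<longrightarrow> uniform_limit L (\<lambda>k. g (\<sigma> k)) h sequentially)"
proof -
  obtain Q0 :: "(complex ^ 'n) set" where Q0: "countable Q0" "\<And>X. open X \<Longrightarrow> X \<noteq> {} \<Longrightarrow> \<exists>d\<in>Q0. d \<in> X"
    using countable_dense_setE by metis
  define Q where "Q = Q0 \<inter> W"
  \<comment> \<open>\<open>g k\<close> is bounded only on \<open>V k\<close>, but subsequences are chosen at all points of a countable set\<close>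
  define G where "G k z = (if z \<in> V k then g k z else 0)" for k z
  have G1: "cmod (G k z) \<le> 1" for k z
    using g[of k] by (auto simp: G_def unit_slice_hol_def)
  have "countable Q" using Q0(1) by (simp add: Q_def)
  then obtain \<sigma> where \<sigma>: "strict_mono \<sigma>" "\<And>q. q \<in> Q \<Longrightarrow> \<exists>l. (\<lambda>n. G (\<sigma> n) q) \<longlonglongrightarrow> l"
    using function_convergent_subsequence[of Q G 1] G1 by metis
  have \<sigma>_ge: "\<sigma> k \<ge> k" for k using \<sigma>(1) by (rule strict_mono_imp_increasing)
  have G: "G k \<in> unit_slice_hol (V k)" for k
    using g[of k] slice_hol_cong[of "g k" "V k" "G k"] by (auto simp: G_def unit_slice_hol_def)
  \<comment> \<open>all functions vary by at most \<open>e/8\<close> near \<open>z\<close>, and the sequence converges at a point \<open>q\<close> near \<open>z\<close>\<close>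
  have cau: "\<exists>d>0. \<exists>N. \<forall>k\<ge>N. \<forall>l\<ge>N. \<forall>w\<in>ball z d. cmod (G (\<sigma> k) w - G (\<sigma> l) w) < e"
    if z: "z \<in> W" and e: "e > 0" for z e
  proof -
    obtain r k0 where r: "r > 0" "\<And>k. k \<ge> k0 \<Longrightarrow> ball z r \<subseteq> V k" using V[OF z] by blast
    define d where "d = min (r/2) (e * r / 32)"
    have d: "d > 0" using r(1) e by (simp add: d_def)
    have lip: "cmod (G (\<sigma> k) w - G (\<sigma> k) z) \<le> e / 8" if "k \<ge> k0" "w \<in> ball z d" for k w
    proof -
      have "cmod (G (\<sigma> k) w - G (\<sigma> k) z) \<le> 4 / r * dist z w"
        using that r(2)[of "\<sigma> k"] \<sigma>_ge[of k]
        by (intro unit_slice_hol_lipschitz[OF G]) (auto simp: d_def)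
      also have "\<dots> \<le> 4 / r * (e * r / 32)"
        using that r(1) by (intro mult_left_mono) (auto simp: d_def)
      finally show ?thesis using r(1) by simp
    qed
    have "z \<in> ball z d \<inter> W" "open (ball z d \<inter> W)" using z d assms(3) by auto
    then have "\<exists>q\<in>Q0. q \<in> ball z d \<inter> W" using Q0(2) by blast
    then obtain q where q: "q \<in> Q" "q \<in> ball z d" by (auto simp: Q_def)
    have "Cauchy (\<lambda>n. G (\<sigma> n) q)" using \<sigma>(2)[OF q(1)] convergent_Cauchy convergentI by blast
    then obtain M where M: "\<And>k l. k \<ge> M \<Longrightarrow> l \<ge> M \<Longrightarrow> cmod (G (\<sigma> k) q - G (\<sigma> l) q) < e/4"
      using e unfolding Cauchy_def dist_norm by (metis zero_less_divide_iff zero_less_numeral)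
    have "cmod (G (\<sigma> k) w - G (\<sigma> l) w) < e" if "k \<ge> max M k0" "l \<ge> max M k0" "w \<in> ball z d" for k l w
    proof -
      have b: "cmod (G (\<sigma> k) w - G (\<sigma> k) z) \<le> e/8" "cmod (G (\<sigma> l) w - G (\<sigma> l) z) \<le> e/8"
        "cmod (G (\<sigma> k) q - G (\<sigma> k) z) \<le> e/8" "cmod (G (\<sigma> l) q - G (\<sigma> l) z) \<le> e/8"
        using that lip q(2) by auto
      have c: "cmod (G (\<sigma> k) q - G (\<sigma> l) q) < e/4" using M that by auto
      have eq: "G (\<sigma> k) w - G (\<sigma> l) w = (G (\<sigma> k) w - G (\<sigma> k) z) - (G (\<sigma> k) q - G (\<sigma> k) z)
          + (G (\<sigma> k) q - G (\<sigma> l) q) + (G (\<sigma> l) q - G (\<sigma> l) z) - (G (\<sigma> l) w - G (\<sigma> l) z)"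
        by simp
      have "cmod (G (\<sigma> k) w - G (\<sigma> l) w) \<le> cmod (G (\<sigma> k) w - G (\<sigma> k) z)
          + cmod (G (\<sigma> k) q - G (\<sigma> k) z) + cmod (G (\<sigma> k) q - G (\<sigma> l) q)
          + cmod (G (\<sigma> l) q - G (\<sigma> l) z) + cmod (G (\<sigma> l) w - G (\<sigma> l) z)"
        by (subst eq) (smt (verit) norm_triangle_ineq norm_triangle_ineq4)
      then show ?thesis using b c e by linarith
    qed
    then show ?thesis using d by blast
  qed
  define h where "h z = lim (\<lambda>n. G (\<sigma> n) z)" for z
  have lim: "(\<lambda>n. G (\<sigma> n) z) \<longlonglongrightarrow> h z" if "z \<in> W" for z
  proof -
    have "Cauchy (\<lambda>n. G (\<sigma> n) z)"
      unfolding Cauchy_def dist_norm using cau[OF that] by (meson centre_in_ball)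
    then show ?thesis unfolding h_def using Cauchy_convergent convergent_LIMSEQ_iff by blast
  qed
  have loc: "\<exists>d>0. \<exists>N. \<forall>k\<ge>N. \<forall>w\<in>ball z d \<inter> W. cmod (G (\<sigma> k) w - h w) < e"
    if z: "z \<in> W" and e: "e > 0" for z e
  proof -
    obtain d N where d: "d > 0" "\<And>k l w. k \<ge> N \<Longrightarrow> l \<ge> N \<Longrightarrow> w \<in> ball z d \<Longrightarrow> cmod (G (\<sigma> k) w - G (\<sigma> l) w) < e/2"
      using cau[OF z half_gt_zero[OF e]] by blast
    have "cmod (G (\<sigma> k) w - h w) < e" if k: "k \<ge> N" and w: "w \<in> ball z d \<inter> W" for k w
    proof -
      have "(\<lambda>l. cmod (G (\<sigma> k) w - G (\<sigma> l) w)) \<longlonglongrightarrow> cmod (G (\<sigma> k) w - h w)"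
        using w by (intro tendsto_intros lim) auto
      then have "cmod (G (\<sigma> k) w - h w) \<le> e/2"
        by (rule Lim_bounded[of _ _ N]) (use d(2)[OF k] w in \<open>auto intro: less_imp_le\<close>)
      then show ?thesis using e by simp
    qed
    then show ?thesis using d(1) by blast
  qed
  have unif: "uniform_limit L (\<lambda>k. G (\<sigma> k)) h sequentially" if L: "compact L" "L \<subseteq> W" for L
  proof (rule uniform_limitI)
    fix e :: real assume e: "e > 0"
    have ex: "\<forall>z. \<exists>d N. z \<in> L \<longrightarrow> d > 0 \<and> (\<forall>k\<ge>N. \<forall>w\<in>ball z d \<inter> W. cmod (G (\<sigma> k) w - h w) < e)"
      using loc[OF _ e] L(2) by blast
    from choice[OF ex] obtain d where d: "\<forall>z. \<exists>N. z \<in> L \<longrightarrow> d z > 0 \<and> (\<forall>k\<ge>N. \<forall>w\<in>ball z (d z) \<inter> W. cmod (G (\<sigma> k) w - h w) < e)"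
      by blast
    from choice[OF d] obtain N where dN: "\<And>z. z \<in> L \<Longrightarrow> d z > 0"
      "\<And>z k w. z \<in> L \<Longrightarrow> k \<ge> N z \<Longrightarrow> w \<in> ball z (d z) \<Longrightarrow> w \<in> W \<Longrightarrow> cmod (G (\<sigma> k) w - h w) < e"
      by blast
    obtain F where F: "F \<subseteq> L" "finite F" "L \<subseteq> (\<Union>z\<in>F. ball z (d z))"
      by (rule compact_finite_ball_cover[OF L(1) dN(1)])
    have "dist (G (\<sigma> k) w) (h w) < e" if k: "k \<ge> Max (insert 0 (N ` F))" and w: "w \<in> L" for k w
    proof -
      obtain z where z: "z \<in> F" "w \<in> ball z (d z)" using F(3) w by blast
      have "N z \<le> k" using k F(2) z(1) by auto
      then show ?thesis using dN(2)[of z k w] z F(1) w L(2) by (auto simp: dist_norm)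
    qed
    then show "\<forall>\<^sub>F k in sequentially. \<forall>w\<in>L. dist (G (\<sigma> k) w) (h w) < e"
      unfolding eventually_sequentially by blast
  qed
  have ev: "\<forall>\<^sub>F k in sequentially. \<forall>w\<in>L. w \<in> V (\<sigma> k)" if L: "compact L" "L \<subseteq> W" for L
  proof -
    have ex: "\<forall>z. \<exists>d N. z \<in> L \<longrightarrow> d > 0 \<and> (\<forall>k\<ge>N. ball z d \<subseteq> V k)"
      using V L(2) by blast
    from choice[OF ex] obtain d where d: "\<forall>z. \<exists>N. z \<in> L \<longrightarrow> d z > 0 \<and> (\<forall>k\<ge>N. ball z (d z) \<subseteq> V k)"
      by blast
    from choice[OF d] obtain N where dN: "\<And>z. z \<in> L \<Longrightarrow> d z > 0"
      "\<And>z k. z \<in> L \<Longrightarrow> k \<ge> N z \<Longrightarrow> ball z (d z) \<subseteq> V k"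
      by blast
    obtain F where F: "F \<subseteq> L" "finite F" "L \<subseteq> (\<Union>z\<in>F. ball z (d z))"
      by (rule compact_finite_ball_cover[OF L(1) dN(1)])
    have "w \<in> V (\<sigma> k)" if k: "k \<ge> Max (insert 0 (N ` F))" and w: "w \<in> L" for k w
    proof -
      obtain z where z: "z \<in> F" "w \<in> ball z (d z)" using F(3) w by blast
      have "N z \<le> \<sigma> k" using k F(2) z(1) \<sigma>_ge[of k] by (meson Max_ge finite_imageI finite_insert imageI insertCI le_trans)
      then show ?thesis using dN(2)[of z "\<sigma> k"] z F(1) by blast
    qed
    then show ?thesis unfolding eventually_sequentially by blast
  qed
  show ?thesis
  proof (intro exI conjI allI impI)
    show "strict_mono \<sigma>" by (rule \<sigma>(1))
    have "slice_hol h W"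
    proof (rule slice_hol_uniform_limit)
      fix z assume z: "z \<in> W"
      then obtain r k0 where r: "r > 0" "\<And>k. k \<ge> k0 \<Longrightarrow> ball z r \<subseteq> V k" using V by blast
      obtain s where s: "s > 0" "cball z s \<subseteq> W" using z assms(3) open_contains_cball by blast
      define t where "t = min r s"
      have "uniform_limit (ball z t) (\<lambda>k. G (\<sigma> k)) h sequentially"
        by (rule uniform_limit_on_subset[OF unif[OF compact_cball s(2)]]) (auto simp: t_def)
      moreover have "\<forall>\<^sub>F k in sequentially. slice_hol (G (\<sigma> k)) (ball z t)"
        unfolding eventually_sequentially
      proof (intro exI[of _ k0] allI impI)
        fix k assume "k0 \<le> k"
        then have "ball z t \<subseteq> V (\<sigma> k)" using r(2)[of "\<sigma> k"] \<sigma>_ge[of k] by (auto simp: t_def)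
        then show "slice_hol (G (\<sigma> k)) (ball z t)"
          using G slice_hol_subset unfolding unit_slice_hol_def by blast
      qed
      ultimately show "\<exists>r>0. (\<forall>\<^sub>F k in sequentially. slice_hol (G (\<sigma> k)) (ball z r)) \<and>
          uniform_limit (ball z r) (\<lambda>k. G (\<sigma> k)) h sequentially"
        using r(1) s(1) by (intro exI[of _ t]) (auto simp: t_def)
    qed
    moreover have "cmod (h w) \<le> 1" if "w \<in> W" for w
      using tendsto_norm[OF lim[OF that]] by (rule Lim_bounded) (use G1 in auto)
    ultimately show "h \<in> unit_slice_hol W" by (simp add: unit_slice_hol_def)
    fix L assume L: "compact L" "L \<subseteq> W"
    show "uniform_limit L (\<lambda>k. g (\<sigma> k)) h sequentially"
      using unif[OF L] by (rule uniform_limit_cong[THEN iffD1, rotated -1])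
        (use ev[OF L] in \<open>auto elim!: eventually_mono simp: G_def\<close>)
  qed
qed

section \<open>Removing the zero set of a polynomial\<close>

text \<open>
  A bounded function with isolated singularities obeys the maximum principle, because the
  singularities are removable.
\<close>

lemma max_modulus_off_zeros:
  assumes q: "q holomorphic_on UNIV" and q0: "q 0 \<noteq> 0"
    and s: "0 < s" "s < s'"
    and hol: "\<phi> holomorphic_on {\<zeta>. cmod \<zeta> < s' \<and> q \<zeta> \<noteq> 0}"
    and bd: "\<And>\<zeta>. cmod \<zeta> < s' \<Longrightarrow> q \<zeta> \<noteq> 0 \<Longrightarrow> cmod (\<phi> \<zeta>) \<le> M"
    and sph: "\<And>\<zeta>. cmod \<zeta> = s \<Longrightarrow> q \<zeta> \<noteq> 0 \<and> cmod (\<phi> \<zeta>) \<le> B"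
  shows "cmod (\<phi> 0) \<le> B"
proof -
  obtain t where t: "s < t" "t < s'" using s(2) dense by blast
  define X where "X = {\<zeta> \<in> cball 0 t. q \<zeta> = 0}"
  have finX: "finite X"
  proof (cases "q constant_on UNIV")
    case True
    then have "X = {}" using q0 unfolding constant_on_def X_def by auto
    then show ?thesis by simp
  next
    case False
    show ?thesis unfolding X_def
      by (rule holomorphic_compact_finite_zeros[OF q open_UNIV connected_UNIV compact_cball _ False]) simp
  qed
  define Y where "Y = X \<inter> ball 0 t"
  have "\<exists>g. g holomorphic_on ball 0 t \<and> (\<forall>z\<in>ball 0 t - Y. g z = \<phi> z)"
  proof (rule removable_singularities)
    show "finite Y" using finX by (simp add: Y_def)
    show "Y \<subseteq> interior (ball 0 t)" by (simp add: Y_def)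
    show "\<phi> holomorphic_on ball 0 t - Y"
      by (rule holomorphic_on_subset[OF hol]) (use t in \<open>auto simp: Y_def X_def\<close>)
    fix z assume z: "z \<in> Y"
    have ev: "\<forall>\<^sub>F \<zeta> in at z. \<zeta> \<in> ball 0 t - Y"
    proof -
      have "open (ball 0 t - (Y - {z}))"
        using finX by (intro open_Diff finite_imp_closed) (auto simp: Y_def)
      moreover have "z \<in> ball 0 t - (Y - {z})" using z by (auto simp: Y_def)
      ultimately have "\<forall>\<^sub>F \<zeta> in at z. \<zeta> \<in> ball 0 t - (Y - {z})"
        by (rule eventually_at_in_open')
      then show ?thesis
        using eventually_neq_at_within[of z z UNIV] by eventually_elim auto
    qed
    show "\<phi> \<in> O[at z](\<lambda>_. 1)"
    proof (rule landau_o.bigI[of "max M 1"])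
      show "\<forall>\<^sub>F \<zeta> in at z. norm (\<phi> \<zeta>) \<le> max M 1 * norm (1::complex)"
        using ev
      proof eventually_elim
        case (elim \<zeta>)
        then have "cmod (\<phi> \<zeta>) \<le> M" using t by (intro bd) (auto simp: Y_def X_def)
        then show ?case by simp
      qed
    qed simp
  qed
  then obtain g where g: "g holomorphic_on ball 0 t" "\<And>z. z \<in> ball 0 t - Y \<Longrightarrow> g z = \<phi> z" by blast
  have "cmod (g 0) \<le> B"
  proof (rule maximum_modulus_frontier[of g "cball 0 s"])
    show "g holomorphic_on interior (cball 0 s)"
      by (rule holomorphic_on_subset[OF g(1)]) (use t in auto)
    show "continuous_on (closure (cball 0 s)) g"
      by (rule continuous_on_subset[OF holomorphic_on_imp_continuous_on[OF g(1)]]) (use t in auto)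
    fix z :: complex assume "z \<in> frontier (cball 0 s)"
    then have z: "cmod z = s" by (simp add: dist_norm)
    have "z \<notin> Y" using sph[OF z] by (auto simp: Y_def X_def)
    then have "g z = \<phi> z" using z t by (intro g(2)) auto
    then show "cmod (g z) \<le> B" using sph[OF z] by simp
  qed (use s in auto)
  moreover have "g 0 = \<phi> 0" using q0 t s by (intro g(2)) (auto simp: Y_def X_def)
  ultimately show ?thesis by simp
qed

text \<open>
  The zeros of \<open>q\<close> are isolated, and a continuous function has no isolated singularities.
\<close>

lemma continuous_holomorphic_off_zeros:
  assumes q: "q holomorphic_on UNIV" and q1: "q \<eta> \<noteq> 0"
    and D: "open D" and cont: "continuous_on D \<phi>"
    and hol: "\<phi> holomorphic_on {\<zeta> \<in> D. q \<zeta> \<noteq> 0}"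
  shows "\<phi> holomorphic_on D"
proof -
  have oq: "open {\<zeta> \<in> D. q \<zeta> \<noteq> 0}"
  proof -
    have "open (D \<inter> q -` (-{0}))"
      using D holomorphic_on_imp_continuous_on[OF q]
      by (intro continuous_open_preimage) (auto intro: continuous_on_subset)
    moreover have "D \<inter> q -` (-{0}) = {\<zeta> \<in> D. q \<zeta> \<noteq> 0}" by auto
    ultimately show ?thesis by simp
  qed
  have "\<phi> field_differentiable (at \<zeta>)" if z: "\<zeta> \<in> D" for \<zeta>
  proof (cases "q \<zeta> = 0")
    case False
    then show ?thesis using holomorphic_on_imp_differentiable_at[OF hol oq] z by auto
  next
    case True
    obtain r where r: "r > 0" "\<And>z. z \<in> ball \<zeta> r - {\<zeta>} \<Longrightarrow> q z \<noteq> 0"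
      using isolated_zeros[OF q open_UNIV connected_UNIV UNIV_I True UNIV_I q1] by metis
    obtain r' where r': "r' > 0" "ball \<zeta> r' \<subseteq> D" using D z open_contains_ball by blast
    define t where "t = min r r'"
    have "\<phi> holomorphic_on ball \<zeta> t"
    proof (rule no_isolated_singularity)
      show "continuous_on (ball \<zeta> t) \<phi>"
        by (rule continuous_on_subset[OF cont]) (use r' in \<open>auto simp: t_def\<close>)
      show "\<phi> holomorphic_on ball \<zeta> t - {\<zeta>}"
      proof (rule holomorphic_on_subset[OF hol], safe)
        fix x assume x: "x \<in> ball \<zeta> t" "x \<noteq> \<zeta>"
        show "x \<in> D" using x r' by (auto simp: t_def)
        show False if "q x = 0" using r(2)[of x] x that by (auto simp: t_def)
      qed
    qed auto
    then show ?thesis using r(1) r'(1)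
      by (intro holomorphic_on_imp_differentiable_at[of _ "ball \<zeta> t"]) (auto simp: t_def)
  qed
  then show ?thesis
    unfolding holomorphic_on_def using field_differentiable_at_within by blast
qed

text \<open>
  Near a zero \<open>z0\<close> of \<open>p\<close> there is a small circle, on a complex line through \<open>z0\<close>, on which \<open>p\<close>
  has no zero.  On the translates of the disc the maximum principle bounds \<open>f z - f z'\<close> by its
  values on the circle, where \<open>f\<close> is Lipschitz.  So \<open>f\<close> is uniformly continuous off the zeros of \<open>p\<close>
  and extends continuously.  The extension is holomorphic on lines not contained in the zero set, and
  on the remaining ones as a uniform limit of such lines.
\<close>

lemma unit_slice_hol_extension_local:
  fixes p :: "complex ^ 'n::finite \<Rightarrow> complex"
  assumes p: "p \<in> polynomials" "p w \<noteq> 0" and U: "open U"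
    and f: "f \<in> unit_slice_hol (U \<inter> {z. p z \<noteq> 0})" and z0: "z0 \<in> U"
  shows "\<exists>r>0. \<exists>F. ball z0 r \<subseteq> U \<and> slice_hol F (ball z0 r) \<and> (\<forall>z\<in>ball z0 r. p z \<noteq> 0 \<longrightarrow> F z = f z)"
proof -
  define A where "A = U \<inter> {z. p z \<noteq> 0}"
  have openp: "open {z. p z \<noteq> 0}"
    using open_vimage[of "-{0}" p] polynomials_continuous_on[OF p(1)] by (auto simp: vimage_def)
  have oA: "open A" unfolding A_def using U openp by (rule open_Int)
  show ?thesis
  proof (cases "p z0 = 0")
    case False
    then have "z0 \<in> A" using z0 by (simp add: A_def)
    then obtain r where r: "r > 0" "ball z0 r \<subseteq> A" using oA open_contains_ball by blast
    then show ?thesis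
      using f slice_hol_subset[of f A "ball z0 r"]
      by (intro exI[of _ r] conjI exI[of _ f]) (auto simp: A_def unit_slice_hol_def)
  next
    case True
    define v where "v = w - z0"
    define q where "q z \<zeta> = p (z + \<zeta> *s v)" for z \<zeta>
    have qhol: "q z holomorphic_on S" for z S
      unfolding q_def by (rule polynomials_slice_holomorphic[OF p(1)])
    have "q z0 0 = 0" "q z0 1 \<noteq> 0" using True p(2) by (auto simp: q_def v_def)
    then obtain s0 where s0: "s0 > 0" "\<And>\<zeta>. \<zeta> \<in> ball 0 s0 - {0} \<Longrightarrow> q z0 \<zeta> \<noteq> 0"
      using isolated_zeros[OF qhol open_UNIV connected_UNIV UNIV_I _ UNIV_I, of z0 0 1] by metis
    have "open {\<zeta>. z0 + \<zeta> *s v \<in> U}" using U by (rule open_line)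
    moreover have "0 \<in> {\<zeta>. z0 + \<zeta> *s v \<in> U}" using z0 by simp
    ultimately obtain s1 where s1: "s1 > 0" "cball 0 s1 \<subseteq> {\<zeta>. z0 + \<zeta> *s v \<in> U}"
      using open_contains_cball by blast
    define s' where "s' = min s0 s1"
    define s where "s = s' / 2"
    have s: "0 < s" "s < s'" "s' \<le> s1" "s' \<le> s0" using s0(1) s1(1) by (auto simp: s_def s'_def)
    have "compact ((\<lambda>\<zeta>. z0 + \<zeta> *s v) ` cball 0 s')"
      by (intro compact_continuous_image continuous_on_line compact_cball)
    moreover have "(\<lambda>\<zeta>. z0 + \<zeta> *s v) ` cball 0 s' \<subseteq> U" using s1(2) s by (auto simp: subset_iff)
    ultimately obtain e1 where e1: "e1 > 0" "(\<Union>x\<in>(\<lambda>\<zeta>. z0 + \<zeta> *s v) ` cball 0 s'. ball x e1) \<subseteq> U"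
      using compact_subset_open_imp_ball_epsilon_subset U by metis
    have "compact ((\<lambda>\<zeta>. z0 + \<zeta> *s v) ` sphere 0 s)"
      by (intro compact_continuous_image continuous_on_line compact_sphere)
    moreover have "(\<lambda>\<zeta>. z0 + \<zeta> *s v) ` sphere 0 s \<subseteq> A"
    proof
      fix y assume "y \<in> (\<lambda>\<zeta>. z0 + \<zeta> *s v) ` sphere 0 s"
      then obtain \<zeta> where \<zeta>0: "\<zeta> \<in> sphere 0 s" "y = z0 + \<zeta> *s v" by blast
      then have \<zeta>: "y = z0 + \<zeta> *s v" "cmod \<zeta> = s" by (simp_all only: mem_sphere_0)
      have "\<zeta> \<in> cball 0 s1" "\<zeta> \<in> ball 0 s0 - {0}" using \<zeta>(2) s by auto
      then have "z0 + \<zeta> *s v \<in> U" "q z0 \<zeta> \<noteq> 0" using s1(2) s0(2) by blast+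
      then show "y \<in> A" using \<zeta>(1) by (simp add: A_def q_def)
    qed
    ultimately obtain e2 where e2: "e2 > 0" "(\<Union>x\<in>(\<lambda>\<zeta>. z0 + \<zeta> *s v) ` sphere 0 s. ball x e2) \<subseteq> A"
      using compact_subset_open_imp_ball_epsilon_subset oA by metis
    define e where "e = min e1 e2"
    define r where "r = e / 8"
    have r: "r > 0" "e > 0" using e1(1) e2(1) by (auto simp: r_def e_def)
    have inU: "z + \<zeta> *s v \<in> U" if "z \<in> ball z0 r" "cmod \<zeta> \<le> s'" for z \<zeta>
    proof -
      have "dist (z0 + \<zeta> *s v) (z + \<zeta> *s v) < e1" using that r by (simp add: r_def e_def dist_norm)
      then show ?thesis using e1(2) that(2) by force
    qed
    have inA: "ball (z + \<zeta> *s v) (e/2) \<subseteq> A" if "z \<in> ball z0 r" "cmod \<zeta> = s" for z \<zeta>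
    proof
      fix y assume y: "y \<in> ball (z + \<zeta> *s v) (e/2)"
      have "dist (z0 + \<zeta> *s v) (z + \<zeta> *s v) < e / 2" using that r by (simp add: r_def dist_norm)
      then have "dist (z0 + \<zeta> *s v) y < e2"
        using y dist_triangle[of "z0 + \<zeta> *s v" y "z + \<zeta> *s v"] by (simp add: e_def)
      then show "y \<in> A" using e2(2) that(2) by force
    qed
    define R where "R = ball z0 r \<inter> {z. p z \<noteq> 0}"
    have ballU: "ball z0 r \<subseteq> U" using inU[of _ 0] s by auto
    have lip: "cmod (f y - f z) \<le> 8 / e * dist z y" if z: "z \<in> R" and y: "y \<in> R" for z y
    proof -
      define \<phi> where "\<phi> \<zeta> = f (y + \<zeta> *s v) - f (z + \<zeta> *s v)" for \<zeta>
      define Q where "Q \<zeta> = q y \<zeta> * q z \<zeta>" for \<zeta>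
      have zb: "z \<in> ball z0 r" "y \<in> ball z0 r" using z y by (auto simp: R_def)
      have "cmod (\<phi> 0) \<le> 8 / e * dist z y"
      proof (rule max_modulus_off_zeros[of Q s s' \<phi> 2])
        show "Q holomorphic_on UNIV" unfolding Q_def by (intro holomorphic_intros qhol)
        show "Q 0 \<noteq> 0" using z y by (simp add: Q_def q_def R_def)
        have fh: "(\<lambda>\<zeta>. f (x + \<zeta> *s v)) holomorphic_on {\<zeta>. x + \<zeta> *s v \<in> A}" for x
          using f unfolding unit_slice_hol_def slice_hol_def A_def by blast
        show "\<phi> holomorphic_on {\<zeta>. cmod \<zeta> < s' \<and> Q \<zeta> \<noteq> 0}"
          unfolding \<phi>_def
          by (intro holomorphic_on_diff holomorphic_on_subset[OF fh])
             (use inU zb in \<open>auto simp: A_def Q_def q_def\<close>)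
        show "cmod (\<phi> \<zeta>) \<le> 2" if "cmod \<zeta> < s'" "Q \<zeta> \<noteq> 0" for \<zeta>
        proof -
          have "y + \<zeta> *s v \<in> A" "z + \<zeta> *s v \<in> A"
            using inU zb that by (auto simp: A_def Q_def q_def)
          then have "cmod (f (y + \<zeta> *s v)) \<le> 1" "cmod (f (z + \<zeta> *s v)) \<le> 1"
            using f by (auto simp: unit_slice_hol_def A_def)
          then show ?thesis unfolding \<phi>_def using norm_triangle_ineq4 by (smt (verit))
        qed
        show "Q \<zeta> \<noteq> 0 \<and> cmod (\<phi> \<zeta>) \<le> 8 / e * dist z y" if "cmod \<zeta> = s" for \<zeta>
        proof
          have c: "y + \<zeta> *s v \<in> A" "z + \<zeta> *s v \<in> A"
            using inA[OF zb(1) that] inA[OF zb(2) that] r(2) by (meson centre_in_ball half_gt_zero subsetD)+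
          then show "Q \<zeta> \<noteq> 0" by (auto simp: A_def Q_def q_def)
          have dd: "dist (z + \<zeta> *s v) (y + \<zeta> *s v) = dist z y" by (simp add: dist_norm)
          have "dist z y < e/2/2"
            using zb dist_triangle2[of z y z0] by (simp add: dist_commute r_def)
          then have "cmod (f (y + \<zeta> *s v) - f (z + \<zeta> *s v)) \<le> 4 / (e/2) * dist (z + \<zeta> *s v) (y + \<zeta> *s v)"
            using inA[OF zb(1) that] f unfolding dd[symmetric] A_def
            by (intro unit_slice_hol_lipschitz)
          then show "cmod (\<phi> \<zeta>) \<le> 8 / e * dist z y" by (simp add: \<phi>_def dd)
        qed
      qed (use s in auto)
      then show ?thesis by (simp add: \<phi>_def)
    qed
    have "uniformly_continuous_on R f"
      unfolding uniformly_continuous_on_def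
    proof (intro allI impI)
      fix \<epsilon> :: real assume "\<epsilon> > 0"
      have "dist (f x') (f x) < \<epsilon>" if "x \<in> R" "x' \<in> R" "dist x' x < \<epsilon> * e / 8" for x x'
      proof -
        have "dist (f x') (f x) \<le> 8 / e * dist x x'" using lip[OF that(1,2)] by (simp add: dist_norm)
        also have "\<dots> < 8 / e * (\<epsilon> * e / 8)"
          using that(3) r(2) by (intro mult_strict_left_mono) (auto simp: dist_commute)
        finally show ?thesis using r(2) by simp
      qed
      then show "\<exists>d>0. \<forall>x\<in>R. \<forall>x'\<in>R. dist x' x < d \<longrightarrow> dist (f x') (f x) < \<epsilon>"
        using \<open>\<epsilon> > 0\<close> r(2) by (intro exI[of _ "\<epsilon> * e / 8"]) auto
    qed
    then obtain F where F: "uniformly_continuous_on (closure R) F" "\<And>x. x \<in> R \<Longrightarrow> f x = F x"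
      using uniformly_continuous_on_extension_on_closure by metis
    have dens: "\<exists>y\<in>R. dist y x < \<delta>" if "x \<in> ball z0 r" "\<delta> > 0" for x \<delta>
    proof -
      have "x \<in> ball z0 r \<inter> ball x \<delta>" using that by simp
      then obtain y where "y \<in> ball z0 r \<inter> ball x \<delta>" "p y \<noteq> 0"
        using polynomials_nonzero_dense[OF p, of "ball z0 r \<inter> ball x \<delta>"] by blast
      then show ?thesis by (auto simp: R_def dist_commute)
    qed
    have sub: "ball z0 r \<subseteq> closure R"
    proof
      fix x assume "x \<in> ball z0 r"
      then show "x \<in> closure R" unfolding closure_approachable using dens by simp
    qed
    have ucF: "uniformly_continuous_on (ball z0 r) F"
      using F(1) sub unfolding uniformly_continuous_on_def by (meson subsetD)
    have contF: "continuous_on (ball z0 r) F"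
      using ucF by (rule uniformly_continuous_imp_continuous)
    have "slice_hol F (ball z0 r)"
      unfolding slice_hol_def
    proof (intro conjI contF allI)
      fix z u :: "complex ^ 'n"
      define T where "T = {\<zeta>. z + \<zeta> *s u \<in> ball z0 r}"
      have oT: "open T" unfolding T_def by (rule open_line) simp
      have "(\<lambda>\<zeta>. F (z + \<zeta> *s u)) field_differentiable (at \<eta>)" if \<eta>: "\<eta> \<in> T" for \<eta>
      proof -
        obtain \<delta>0 where \<delta>0: "\<delta>0 > 0" "cball \<eta> \<delta>0 \<subseteq> T" using oT \<eta> open_contains_cball by blast
        have "compact ((\<lambda>\<zeta>. z + \<zeta> *s u) ` cball \<eta> \<delta>0)"
          by (intro compact_continuous_image continuous_on_line compact_cball)
        moreover have "(\<lambda>\<zeta>. z + \<zeta> *s u) ` cball \<eta> \<delta>0 \<subseteq> ball z0 r" using \<delta>0 by (auto simp: T_def)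
        ultimately obtain \<rho> where \<rho>: "\<rho> > 0" "(\<Union>x\<in>(\<lambda>\<zeta>. z + \<zeta> *s u) ` cball \<eta> \<delta>0. ball x \<rho>) \<subseteq> ball z0 r"
          using compact_subset_open_imp_ball_epsilon_subset open_ball by metis
        have ze: "z + \<eta> *s u \<in> ball z0 r" using \<eta> by (simp add: T_def)
        have "\<forall>k::nat. \<exists>y. y \<in> R \<and> dist y (z + \<eta> *s u) < min \<rho> (1 / (real k + 1))"
        proof
          fix k :: nat
          have "min \<rho> (1 / (real k + 1)) > 0" using \<rho>(1) by simp
          then show "\<exists>y. y \<in> R \<and> dist y (z + \<eta> *s u) < min \<rho> (1 / (real k + 1))"
            using dens[OF ze] by blast
        qed
        from choice[OF this] obtain y where "\<forall>k::nat. y k \<in> R \<and> dist (y k) (z + \<eta> *s u) < min \<rho> (1 / (real k + 1))" ..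
        then have y: "\<And>k::nat. y k \<in> R" "\<And>k. dist (y k) (z + \<eta> *s u) < \<rho>"
          "\<And>k. dist (y k) (z + \<eta> *s u) < 1 / (real k + 1)"
          by (auto simp only: min_less_iff_conj)
        \<comment> \<open>the lines parallel to the given one through points where \<open>p\<close> does not vanish\<close>
        define b where "b k = y k - \<eta> *s u" for k
        have by0: "b k + \<eta> *s u = y k" for k by (simp add: b_def)
        have bd: "dist (b k + \<zeta> *s u) (z + \<zeta> *s u) = dist (y k) (z + \<eta> *s u)" for k \<zeta>
          by (simp add: b_def dist_norm algebra_simps)
        have bin: "b k + \<zeta> *s u \<in> ball z0 r" if "\<zeta> \<in> cball \<eta> \<delta>0" for k \<zeta>
        proof -
          have "b k + \<zeta> *s u \<in> ball (z + \<zeta> *s u) \<rho>" using bd[of k \<zeta>] y(2)[of k] by (simp add: dist_commute)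
          then show ?thesis using \<rho>(2) that by blast
        qed
        have hk: "(\<lambda>\<zeta>. F (b k + \<zeta> *s u)) holomorphic_on ball \<eta> \<delta>0" for k
        proof (rule continuous_holomorphic_off_zeros[of "\<lambda>\<zeta>. p (b k + \<zeta> *s u)" \<eta>])
          show "(\<lambda>\<zeta>. p (b k + \<zeta> *s u)) holomorphic_on UNIV"
            by (rule polynomials_slice_holomorphic[OF p(1)])
          show "p (b k + \<eta> *s u) \<noteq> 0" using y(1)[of k] by (simp only: by0) (simp add: R_def)
          show "continuous_on (ball \<eta> \<delta>0) (\<lambda>\<zeta>. F (b k + \<zeta> *s u))"
            by (rule continuous_on_compose2[OF contF continuous_on_line]) (use bin in auto)
          have "(\<lambda>\<zeta>. f (b k + \<zeta> *s u)) holomorphic_on {\<zeta>. b k + \<zeta> *s u \<in> A}"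
            using f unfolding unit_slice_hol_def slice_hol_def A_def by blast
          then have "(\<lambda>\<zeta>. f (b k + \<zeta> *s u)) holomorphic_on {\<zeta> \<in> ball \<eta> \<delta>0. p (b k + \<zeta> *s u) \<noteq> 0}"
            by (rule holomorphic_on_subset) (use bin ballU in \<open>auto simp: A_def\<close>)
          then show "(\<lambda>\<zeta>. F (b k + \<zeta> *s u)) holomorphic_on {\<zeta> \<in> ball \<eta> \<delta>0. p (b k + \<zeta> *s u) \<noteq> 0}"
            by (rule holomorphic_transform) (use bin F(2) in \<open>auto simp: R_def\<close>)
        qed auto
        have "uniform_limit (ball \<eta> \<delta>0) (\<lambda>k \<zeta>. F (b k + \<zeta> *s u)) (\<lambda>\<zeta>. F (z + \<zeta> *s u)) sequentially"
        proof (rule uniform_limitI)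
          fix \<epsilon> :: real assume "\<epsilon> > 0"
          then obtain d where d: "d > 0"
            "\<And>x x'. x \<in> ball z0 r \<Longrightarrow> x' \<in> ball z0 r \<Longrightarrow> dist x' x < d \<Longrightarrow> dist (F x') (F x) < \<epsilon>"
            using ucF unfolding uniformly_continuous_on_def by metis
          obtain N :: nat where N: "1 / (real N + 1) < d"
            using d(1) reals_Archimedean[of d] by (auto simp: inverse_eq_divide add.commute)
          have "dist (F (b k + \<zeta> *s u)) (F (z + \<zeta> *s u)) < \<epsilon>" if "k \<ge> N" "\<zeta> \<in> ball \<eta> \<delta>0" for k \<zeta>
          proof (rule d(2))
            show "z + \<zeta> *s u \<in> ball z0 r" using \<delta>0 that(2) by (auto simp: T_def subset_iff)
            show "b k + \<zeta> *s u \<in> ball z0 r" using bin that(2) by auto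
            have "1 / (real k + 1) \<le> 1 / (real N + 1)" using that(1) by (intro divide_left_mono) auto
            then show "dist (b k + \<zeta> *s u) (z + \<zeta> *s u) < d" using bd[of k \<zeta>] y(3)[of k] N by linarith
          qed
          then show "\<forall>\<^sub>F k in sequentially. \<forall>\<zeta>\<in>ball \<eta> \<delta>0. dist (F (b k + \<zeta> *s u)) (F (z + \<zeta> *s u)) < \<epsilon>"
            unfolding eventually_sequentially by blast
        qed
        then have ul: "\<exists>d>0. cball x d \<subseteq> ball \<eta> \<delta>0 \<and>
            uniform_limit (cball x d) (\<lambda>k \<zeta>. F (b k + \<zeta> *s u)) (\<lambda>\<zeta>. F (z + \<zeta> *s u)) sequentially"
          if "x \<in> ball \<eta> \<delta>0" for x
          using that by (meson open_contains_cball open_ball uniform_limit_on_subset)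
        have "(\<lambda>\<zeta>. F (z + \<zeta> *s u)) holomorphic_on ball \<eta> \<delta>0"
          by (rule holomorphic_uniform_sequence[OF open_ball hk ul])
        then show ?thesis
          using \<delta>0(1) by (intro holomorphic_on_imp_differentiable_at[of _ "ball \<eta> \<delta>0"]) auto
      qed
      then show "(\<lambda>\<zeta>. F (z + \<zeta> *s u)) holomorphic_on {\<zeta>. z + \<zeta> *s u \<in> ball z0 r}"
        unfolding holomorphic_on_def T_def using field_differentiable_at_within by blast
    qed
    then show ?thesis
      using r(1) ballU F(2) by (intro exI[of _ r] conjI exI[of _ F]) (auto simp: R_def)
  qed
qed

text \<open>
  The local extensions are determined by continuity, since the zero set is nowhere dense; hence they
  fit together.
\<close>

lemma unit_slice_hol_extension:
  fixes p :: "complex ^ 'n::finite \<Rightarrow> complex"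
  assumes p: "p \<in> polynomials" "p w \<noteq> 0" and U: "open U"
    and f: "f \<in> unit_slice_hol (U \<inter> {z. p z \<noteq> 0})"
  obtains h where "h \<in> unit_slice_hol U" "\<And>z. z \<in> U \<Longrightarrow> p z \<noteq> 0 \<Longrightarrow> h z = f z"
proof -
  define A where "A = U \<inter> {z. p z \<noteq> 0}"
  define h where "h z = Lim (at z within A) f" for z
  have loc: "\<exists>r>0. slice_hol h (ball z0 r) \<and> (\<forall>z\<in>ball z0 r. p z \<noteq> 0 \<longrightarrow> h z = f z) \<and> cmod (h z0) \<le> 1"
    if z0: "z0 \<in> U" for z0
  proof -
    obtain r F where r: "r > 0" "ball z0 r \<subseteq> U" and F: "slice_hol F (ball z0 r)"
      "\<And>z. z \<in> ball z0 r \<Longrightarrow> p z \<noteq> 0 \<Longrightarrow> F z = f z"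
      using unit_slice_hol_extension_local[OF assms z0] by blast
    have key: "h z = F z \<and> cmod (F z) \<le> 1" if z: "z \<in> ball z0 r" for z
    proof -
      have isl: "z islimpt A"
        unfolding islimpt_def
      proof (intro allI impI)
        fix T assume T: "z \<in> T" "open T"
        define D where "D = T \<inter> ball z0 r - {z}"
        have oD: "open D" using T by (auto simp: D_def)
        have "z islimpt (T \<inter> ball z0 r)"
          using T z by (intro interior_limit_point) (simp add: interior_open)
        then have "D \<noteq> {}" unfolding D_def islimpt_def using T z
          by (metis Diff_iff IntI empty_iff open_Int open_ball singletonD)
        then obtain y where "y \<in> D" "p y \<noteq> 0" using polynomials_nonzero_dense[OF p oD] by blast
        then show "\<exists>y\<in>A. y \<in> T \<and> y \<noteq> z" using r(2) by (auto simp: D_def A_def)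
      qed
      have "isCont F z"
        using F(1) z continuous_on_eq_continuous_at[OF open_ball, of z0 r F] unfolding slice_hol_def by blast
      then have "(F \<longlongrightarrow> F z) (at z within A)"
        unfolding isCont_def by (rule tendsto_within_subset) simp
      moreover have ev: "\<forall>\<^sub>F x in at z within A. F x = f x \<and> x \<in> A"
      proof -
        have "\<forall>\<^sub>F x in at z within A. x \<in> ball z0 r \<inter> A"
          using z by (auto simp: eventually_at_topological intro!: exI[of _ "ball z0 r"])
        then show ?thesis by eventually_elim (auto simp: F(2) A_def)
      qed
      ultimately have lim: "(f \<longlongrightarrow> F z) (at z within A)"
        by (rule Lim_transform_eventually[OF _ eventually_mono]) auto
      have nt: "at z within A \<noteq> bot" using isl by (simp add: trivial_limit_within)
      have "h z = F z" unfolding h_def by (rule tendsto_Lim[OF nt lim])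
      moreover have "cmod (F z) \<le> 1"
      proof (rule Lim_norm_ubound[OF nt lim])
        show "\<forall>\<^sub>F x in at z within A. cmod (f x) \<le> 1"
          using ev by eventually_elim (use f in \<open>auto simp: unit_slice_hol_def A_def\<close>)
      qed
      ultimately show ?thesis by simp
    qed
    have "slice_hol h (ball z0 r)"
      using F(1) by (rule slice_hol_cong) (simp add: key)
    then show ?thesis using key F(2) r(1) by (intro exI[of _ r]) auto
  qed
  show ?thesis
  proof (rule that)
    have "slice_hol h U" by (rule slice_hol_local) (use loc in blast)
    then show "h \<in> unit_slice_hol U" unfolding unit_slice_hol_def using loc by blast
    show "h z = f z" if "z \<in> U" "p z \<noteq> 0" for z using loc[OF that(1)] that(2) by (meson centre_in_ball)
  qed
qed

text \<open>
  A locally constant function on the complement of the zero set extends continuously, so it cannot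
  take two values on a connected set.
\<close>

lemma connected_off_zeros:
  fixes p :: "complex ^ 'n::finite \<Rightarrow> complex"
  assumes p: "p \<in> polynomials" "p w \<noteq> 0" and U: "open U" "connected U"
  shows "connected (U \<inter> {z. p z \<noteq> 0})"
proof (rule ccontr)
  define A where "A = U \<inter> {z. p z \<noteq> 0}"
  have openp: "open {z. p z \<noteq> 0}"
    using open_vimage[of "-{0}" p] polynomials_continuous_on[OF p(1)] by (auto simp: vimage_def)
  have oA: "open A" unfolding A_def using U(1) openp by (rule open_Int)
  assume "\<not> connected (U \<inter> {z. p z \<noteq> 0})"
  then obtain S T where ST: "open S" "open T" "A \<subseteq> S \<union> T" "S \<inter> T \<inter> A = {}" "S \<inter> A \<noteq> {}" "T \<inter> A \<noteq> {}"
    unfolding connected_def A_def by blast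
  define f :: "complex ^ 'n \<Rightarrow> complex" where "f z = (if z \<in> S then 0 else 1)" for z
  have "slice_hol f A"
  proof (rule slice_hol_local)
    fix z assume z: "z \<in> A"
    define C where "C = (if z \<in> S then S \<inter> A else T \<inter> A)"
    have "open C" "z \<in> C" using ST z oA by (auto simp: C_def)
    then obtain r where r: "r > 0" "ball z r \<subseteq> C" using open_contains_ball by blast
    have "slice_hol f (ball z r)"
      by (rule slice_hol_cong[OF slice_hol_const[of "f z"]])
         (use r(2) ST(4) in \<open>auto simp: C_def f_def subset_iff split: if_splits\<close>)
    then show "\<exists>r>0. slice_hol f (ball z r)" using r(1) by blast
  qed
  then have "f \<in> unit_slice_hol A" by (auto simp: unit_slice_hol_def f_def)
  then obtain h where h: "h \<in> unit_slice_hol U" "\<And>z. z \<in> U \<Longrightarrow> p z \<noteq> 0 \<Longrightarrow> h z = f z"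
    using unit_slice_hol_extension[OF p U(1)] unfolding A_def by metis
  have conth: "continuous_on U h" using h(1) by (simp add: unit_slice_hol_def slice_hol_def)
  have "h ` U \<subseteq> {0, 1}"
  proof (rule ccontr)
    assume "\<not> h ` U \<subseteq> {0, 1}"
    then have "U \<inter> h -` (- {0,1}) \<noteq> {}" by blast
    moreover have "open (U \<inter> h -` (- {0,1}))"
      using conth U(1) by (intro continuous_open_preimage) auto
    ultimately obtain z where "z \<in> U \<inter> h -` (- {0,1})" "p z \<noteq> 0"
      using polynomials_nonzero_dense[OF p] by blast
    then show False using h(2)[of z] by (auto simp: f_def split: if_splits)
  qed
  moreover have "connected (h ` U)" using conth U(2) by (rule connected_continuous_image)
  ultimately obtain a where a: "h ` U \<subseteq> {a}"
    using connected_finite_iff_sing[of "h ` U"] by (metis finite.emptyI finite_insert finite_subset subset_refl empty_subsetI)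
  obtain x y where "x \<in> S \<inter> A" "y \<in> T \<inter> A" using ST by blast
  then have "h x = 0" "h y = 1" "x \<in> U" "y \<in> U" using h(2) ST(4) by (auto simp: A_def f_def)
  then show False using a by (metis image_subset_iff singletonD zero_neq_one)
qed

text \<open>
  Deleting a thin neighbourhood of the zero set of \<open>p\<close> hardly enlarges the unit ball of bounded
  functions: otherwise a normal family argument would produce a bounded function on the complement of
  the zero set which is far from every function on \<open>U\<close>, although it extends to \<open>U\<close>.
\<close>

lemma unit_slice_hol_near:
  fixes p :: "complex ^ 'n::finite \<Rightarrow> complex"
  assumes p: "p \<in> polynomials" "p w \<noteq> 0" and U: "open U"
    and L: "compact L" "L \<subseteq> U \<inter> {z. p z \<noteq> 0}" and \<delta>: "\<delta> > 0"
  shows "\<exists>e0>0. \<forall>e. 0 < e \<and> e < e0 \<longrightarrow> (\<forall>g\<in>unit_slice_hol (U \<inter> {z. e < cmod (p z)}).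
    \<exists>h\<in>unit_slice_hol U. \<forall>x\<in>L. cmod (g x - h x) < \<delta> \<and> (\<forall>i. cmod (dir_deriv i g x - dir_deriv i h x) < \<delta>))"
proof (rule ccontr)
  define A where "A = U \<inter> {z. p z \<noteq> 0}"
  have openp: "open {z. p z \<noteq> 0}"
    using open_vimage[of "-{0}" p] polynomials_continuous_on[OF p(1)] by (auto simp: vimage_def)
  have oA: "open A" unfolding A_def using U openp by (rule open_Int)
  define good where "good g h \<longleftrightarrow> (\<forall>x\<in>L. cmod (g x - h x) < \<delta> \<and> (\<forall>i. cmod (dir_deriv i g x - dir_deriv i h x) < \<delta>))" for g h
  define V where "V e = U \<inter> {z. e < cmod (p z)}" for e
  assume "\<not> ?thesis"
  then have neg: "\<not> (\<exists>e0>0. \<forall>e. 0 < e \<and> e < e0 \<longrightarrow> (\<forall>g\<in>unit_slice_hol (V e). \<exists>h\<in>unit_slice_hol U. good g h))"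
    by (simp only: good_def V_def not_False_eq_True)
  have "\<forall>k::nat. \<exists>e g. 0 < e \<and> e < 1 / (real k + 1) \<and> g \<in> unit_slice_hol (V e) \<and> (\<forall>h\<in>unit_slice_hol U. \<not> good g h)"
  proof
    fix k :: nat
    have "1 / (real k + 1) > 0" by simp
    then show "\<exists>e g. 0 < e \<and> e < 1 / (real k + 1) \<and> g \<in> unit_slice_hol (V e) \<and> (\<forall>h\<in>unit_slice_hol U. \<not> good g h)"
      using neg by blast
  qed
  from choice[OF this] obtain e where
    "\<forall>k::nat. \<exists>g. 0 < e k \<and> e k < 1 / (real k + 1) \<and> g \<in> unit_slice_hol (V (e k)) \<and> (\<forall>h\<in>unit_slice_hol U. \<not> good g h)" ..
  from choice[OF this] obtain g where
    "\<forall>k::nat. 0 < e k \<and> e k < 1 / (real k + 1) \<and> g k \<in> unit_slice_hol (V (e k)) \<and> (\<forall>h\<in>unit_slice_hol U. \<not> good (g k) h)" ..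
  then have eg: "\<And>k::nat. 0 < e k" "\<And>k. e k < 1 / (real k + 1)"
    "\<And>k. g k \<in> unit_slice_hol (V (e k))" "\<And>k h. h \<in> unit_slice_hol U \<Longrightarrow> \<not> good (g k) h"
    by blast+
  have ev: "\<exists>k0. \<forall>k\<ge>k0. C \<subseteq> V (e k)" if C: "compact C" "C \<subseteq> A" for C
  proof (cases "C = {}")
    case False
    obtain c where c: "c \<in> C" "\<And>x. x \<in> C \<Longrightarrow> cmod (p c) \<le> cmod (p x)"
      using continuous_attains_inf[OF C(1) False, of "\<lambda>x. cmod (p x)"] polynomials_continuous_on[OF p(1)]
      by (auto intro: continuous_on_norm)
    have "cmod (p c) > 0" using c(1) C(2) by (auto simp: A_def)
    then obtain k0 where "inverse (real (Suc k0)) < cmod (p c)"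
      using reals_Archimedean by blast
    then have k0: "1 / (real k0 + 1) < cmod (p c)"
      by (simp add: inverse_eq_divide add.commute)
    have "C \<subseteq> V (e k)" if "k \<ge> k0" for k
    proof
      fix x assume x: "x \<in> C"
      have "1 / (real k + 1) \<le> 1 / (real k0 + 1)" using that by (intro divide_left_mono) auto
      then have "e k < cmod (p x)" using eg(2)[of k] k0 c(2)[OF x] by linarith
      then show "x \<in> V (e k)" using x C(2) by (auto simp: V_def A_def)
    qed
    then show ?thesis by blast
  qed auto
  have V: "\<exists>r>0. \<exists>k0. \<forall>k\<ge>k0. ball z r \<subseteq> V (e k)" if "z \<in> A" for z
  proof -
    from oA[unfolded open_contains_cball, rule_format, OF that]
    obtain r where "r > 0 \<and> cball z r \<subseteq> A" ..
    then have r: "r > 0" "cball z r \<subseteq> A" by simp_all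
    from ev[OF compact_cball r(2)] obtain k0 where k0: "\<forall>k\<ge>k0. cball z r \<subseteq> V (e k)" ..
    have "ball z r \<subseteq> V (e k)" if "k \<ge> k0" for k
      by (rule order_trans[OF ball_subset_cball]) (use k0 that in simp)
    then show ?thesis using r(1) by (intro exI[of _ r] conjI exI[of _ k0]) auto
  qed
  have "\<exists>\<sigma> h. strict_mono (\<sigma> :: nat \<Rightarrow> nat) \<and> h \<in> unit_slice_hol A \<and>
    (\<forall>L. compact L \<longrightarrow> L \<subseteq> A \<longrightarrow> uniform_limit L (\<lambda>k. g (\<sigma> k)) h sequentially)"
    by (rule unit_slice_hol_Montel[OF eg(3) _ oA]) (rule V)
  then obtain \<sigma> h0 where \<sigma>: "strict_mono (\<sigma> :: nat \<Rightarrow> nat)" "h0 \<in> unit_slice_hol A"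
    "\<And>L. compact L \<Longrightarrow> L \<subseteq> A \<Longrightarrow> uniform_limit L (\<lambda>k. g (\<sigma> k)) h0 sequentially"
    by blast
  obtain h where h: "h \<in> unit_slice_hol U" "\<And>z. z \<in> U \<Longrightarrow> p z \<noteq> 0 \<Longrightarrow> h z = h0 z"
    using unit_slice_hol_extension[OF p U] \<sigma>(2) unfolding A_def by metis
  have "L \<subseteq> A" using L(2) by (simp add: A_def)
  then obtain \<rho> where \<rho>: "\<rho> > 0" "(\<Union>x\<in>L. ball x \<rho>) \<subseteq> A"
    using compact_subset_open_imp_ball_epsilon_subset[OF L(1) oA] by metis
  define s where "s = \<rho> / 2"
  define Lp where "Lp = {x + y | x y. x \<in> L \<and> y \<in> cball 0 s}"
  have s: "s > 0" using \<rho>(1) by (simp add: s_def)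
  have Lp: "compact Lp" unfolding Lp_def by (intro compact_sums L compact_cball)
  have LpA: "Lp \<subseteq> A"
  proof
    fix u assume "u \<in> Lp"
    then obtain x y where xy: "u = x + y" "x \<in> L" "y \<in> cball 0 s" by (auto simp: Lp_def)
    then have "u \<in> ball x \<rho>" using \<rho>(1) by (auto simp: s_def dist_norm)
    then show "u \<in> A" using \<rho>(2) xy(2) by blast
  qed
  have bLp: "ball x s \<subseteq> Lp" if "x \<in> L" for x
  proof
    fix y assume "y \<in> ball x s"
    then have "y = x + (y - x)" "y - x \<in> cball 0 s" by (auto simp: dist_norm norm_minus_commute)
    then show "y \<in> Lp" using that unfolding Lp_def by blast
  qed
  \<comment> \<open>balls of radius \<open>s\<close> around points of \<open>L\<close> lie in \<open>Lp\<close>, so that Cauchy's estimate bounds the derivatives by \<open>\<delta> / 2\<close>\<close>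
  define \<delta>' where "\<delta>' = min (\<delta>/2) (\<delta> * s / 4)"
  have \<delta>': "\<delta>' > 0" using \<delta> s by (simp add: \<delta>'_def)
  obtain k1 where k1: "\<And>k. k \<ge> k1 \<Longrightarrow> Lp \<subseteq> V (e k)" using ev[OF Lp LpA] by blast
  obtain k2 where k2: "\<And>k x. k \<ge> k2 \<Longrightarrow> x \<in> Lp \<Longrightarrow> cmod (g (\<sigma> k) x - h0 x) < \<delta>'"
    using uniform_limitD[OF \<sigma>(3)[OF Lp LpA] \<delta>'] unfolding eventually_sequentially dist_norm by blast
  define k where "k = max k1 k2"
  have \<sigma>k: "\<sigma> k \<ge> k1" using strict_mono_imp_increasing[OF \<sigma>(1), of k] by (simp add: k_def)
  have close: "cmod (g (\<sigma> k) x - h x) < \<delta>'" if "x \<in> Lp" for x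
  proof -
    have "x \<in> A" using that LpA by blast
    then have "h x = h0 x" using h(2)[of x] by (simp add: A_def)
    then show ?thesis using k2[of k x] that by (simp add: k_def)
  qed
  have "good (g (\<sigma> k)) h"
    unfolding good_def
  proof (intro ballI conjI allI)
    fix x assume x: "x \<in> L"
    have "x \<in> Lp" using bLp[OF x] s by auto
    then show "cmod (g (\<sigma> k) x - h x) < \<delta>" using close \<delta> by (fastforce simp: \<delta>'_def)
    fix i
    have sg: "slice_hol (g (\<sigma> k)) (ball x s)"
      using eg(3)[of "\<sigma> k"] k1[OF \<sigma>k] bLp[OF x] slice_hol_subset unfolding unit_slice_hol_def by blast
    have sh: "slice_hol h (ball x s)"
      using h(1) bLp[OF x] LpA slice_hol_subset[of h U "ball x s"] unfolding unit_slice_hol_def A_def by blast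
    have "cmod (dir_deriv i (\<lambda>z. g (\<sigma> k) z - h z) x) \<le> 2 * \<delta>' / s"
      using sg sh s close bLp[OF x] by (intro dir_deriv_bound slice_hol_diff) (auto intro!: less_imp_le)
    also have "\<dots> \<le> 2 * (\<delta> * s / 4) / s" using s by (intro divide_right_mono mult_left_mono) (auto simp: \<delta>'_def)
    also have "\<dots> < \<delta>" using s \<delta> by simp
    finally show "cmod (dir_deriv i (g (\<sigma> k)) x - dir_deriv i h x) < \<delta>"
      using dir_deriv_diff[OF sg sh open_ball, of x i] s by simp
  qed
  then show False using eg(4)[OF h(1)] by blast
qed

text \<open>
  As \<open>f x\<close> has the largest possible modulus, the maximum principle on complex lines shows that the set
  on which \<open>f\<close> takes this value is open.
\<close>

lemma unit_slice_hol_max_constant: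
  fixes U :: "(complex ^ 'n::finite) set"
  assumes f: "f \<in> unit_slice_hol U" and U: "open U" "connected U" and x: "x \<in> U" "cmod (f x) = 1"
    and y: "y \<in> U"
  shows "f y = f x"
proof -
  define T where "T = {z \<in> U. f z = f x}"
  have cont: "continuous_on U f" using f by (simp add: unit_slice_hol_def slice_hol_def)
  have "openin (top_of_set U) T"
  proof -
    have "open T"
      unfolding open_contains_ball
    proof
      fix z assume z: "z \<in> T"
      obtain r where r: "r > 0" "ball z r \<subseteq> U" using z U(1) open_contains_ball unfolding T_def by blast
      have "f w = f x" if w: "w \<in> ball z r" for w
      proof (cases "w = z")
        case True then show ?thesis using z by (simp add: T_def)
      next
        case False
        define R where "R = r / dist z w"
        have dp: "dist z w > 0" using False by simp
        have R: "R > 1" using w dp by (simp add: R_def)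
        define \<phi> where "\<phi> \<zeta> = f (z + \<zeta> *s (w - z))" for \<zeta> :: complex
        have inb: "z + \<zeta> *s (w - z) \<in> U" if "\<zeta> \<in> ball 0 R" for \<zeta> :: complex
        proof -
          have "dist z (z + \<zeta> *s (w - z)) = cmod \<zeta> * dist z w"
            using dist_line[of z 0 "w - z" \<zeta>] by (simp add: dist_norm norm_minus_commute)
          also have "\<dots> < r" using that dp by (simp add: R_def field_simps)
          finally show ?thesis using r by auto
        qed
        have "\<phi> holomorphic_on {\<zeta>. z + \<zeta> *s (w - z) \<in> U}"
          using f unfolding \<phi>_def unit_slice_hol_def slice_hol_def by blast
        then have hol: "\<phi> holomorphic_on ball 0 R"
          by (rule holomorphic_on_subset) (use inb in auto)
        have "\<phi> constant_on ball 0 R"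
        proof (rule maximum_modulus_principle[OF hol open_ball connected_ball open_ball order_refl])
          show "0 \<in> ball 0 R" using R by simp
          fix \<zeta> :: complex assume "\<zeta> \<in> ball 0 R"
          then have "cmod (\<phi> \<zeta>) \<le> 1"
            using inb f by (simp only: unit_slice_hol_def \<phi>_def mem_Collect_eq)
          moreover have "\<phi> 0 = f x" using z by (simp add: \<phi>_def T_def)
          ultimately show "cmod (\<phi> \<zeta>) \<le> cmod (\<phi> 0)" using x(2) by simp
        qed
        then have "\<phi> 1 = \<phi> 0" using R unfolding constant_on_def by (metis centre_in_ball dist_0_norm mem_ball norm_one less_trans zero_less_one)
        then show ?thesis using z by (simp add: \<phi>_def T_def)
      qed
      then show "\<exists>e>0. ball z e \<subseteq> T" using r by (intro exI[of _ r]) (auto simp: T_def)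
    qed
    then show ?thesis by (metis Collect_subset T_def open_subset)
  qed
  moreover have "closedin (top_of_set U) T"
  proof -
    have "closedin (top_of_set U) (U \<inter> f -` {f x})"
      using cont by (intro continuous_closedin_preimage) auto
    moreover have "U \<inter> f -` {f x} = T" by (auto simp: T_def)
    ultimately show ?thesis by simp
  qed
  ultimately have "T = U" using U(2) x unfolding connected_clopen T_def by blast
  then show ?thesis using y by (auto simp: T_def)
qed

text \<open>
  A compact subset of a connected open set lies in one Gleason part, uniformly: if \<open>f x\<close> and \<open>f y\<close>
  came arbitrarily close to distance 2, a limit function would attain its maximum modulus at two
  points with opposite values.
\<close>

lemma unit_slice_hol_gleason:
  fixes U :: "(complex ^ 'n::finite) set"
  assumes U: "open U" "connected U" and C: "compact C" "C \<subseteq> U"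
  shows "\<exists>b>0. \<forall>f\<in>unit_slice_hol U. \<forall>x\<in>C. \<forall>y\<in>C. cmod (f x - f y) \<le> 2 - b"
proof (rule ccontr)
  assume neg: "\<not> ?thesis"
  have "\<forall>k::nat. \<exists>f x y. f \<in> unit_slice_hol U \<and> x \<in> C \<and> y \<in> C \<and> cmod (f x - f y) > 2 - 1 / (real k + 1)"
  proof
    fix k :: nat
    have "1 / (real k + 1) > 0" by simp
    then show "\<exists>f x y. f \<in> unit_slice_hol U \<and> x \<in> C \<and> y \<in> C \<and> cmod (f x - f y) > 2 - 1 / (real k + 1)"
      using neg by (meson not_le)
  qed
  from choice[OF this] obtain f where
    "\<forall>k::nat. \<exists>x y. f k \<in> unit_slice_hol U \<and> x \<in> C \<and> y \<in> C \<and> cmod (f k x - f k y) > 2 - 1 / (real k + 1)" ..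
  from choice[OF this] obtain x where
    "\<forall>k::nat. \<exists>y. f k \<in> unit_slice_hol U \<and> x k \<in> C \<and> y \<in> C \<and> cmod (f k (x k) - f k y) > 2 - 1 / (real k + 1)" ..
  from choice[OF this] obtain y where
    "\<forall>k::nat. f k \<in> unit_slice_hol U \<and> x k \<in> C \<and> y k \<in> C \<and> cmod (f k (x k) - f k (y k)) > 2 - 1 / (real k + 1)" ..
  then have fxy: "\<And>k::nat. f k \<in> unit_slice_hol U" "\<And>k. x k \<in> C" "\<And>k. y k \<in> C"
    "\<And>k. cmod (f k (x k) - f k (y k)) > 2 - 1 / (real k + 1)"
    by blast+
  have V: "\<exists>r>0. \<exists>k0::nat. \<forall>k\<ge>k0. ball z r \<subseteq> U" if "z \<in> U" for z
    using U(1) that open_contains_ball by blast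
  have "\<exists>\<sigma> h. strict_mono (\<sigma> :: nat \<Rightarrow> nat) \<and> h \<in> unit_slice_hol U \<and>
    (\<forall>L. compact L \<longrightarrow> L \<subseteq> U \<longrightarrow> uniform_limit L (\<lambda>k. f (\<sigma> k)) h sequentially)"
    by (rule unit_slice_hol_Montel[OF fxy(1) _ U(1)]) (rule V)
  then obtain \<sigma> h where \<sigma>: "strict_mono (\<sigma> :: nat \<Rightarrow> nat)" "h \<in> unit_slice_hol U"
    "\<And>L. compact L \<Longrightarrow> L \<subseteq> U \<Longrightarrow> uniform_limit L (\<lambda>k. f (\<sigma> k)) h sequentially"
    by blast
  have sub: "\<exists>l r. l \<in> C \<and> strict_mono (r :: nat \<Rightarrow> nat) \<and> (\<lambda>k. u (r k)) \<longlonglongrightarrow> l"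
    if u: "\<forall>n. u n \<in> C" for u :: "nat \<Rightarrow> complex ^ 'n"
  proof -
    obtain l r where "l \<in> C" "strict_mono (r :: nat \<Rightarrow> nat)" "(u \<circ> r) \<longlonglongrightarrow> l"
      using C(1)[unfolded compact_def] u by blast
    then show ?thesis unfolding o_def by blast
  qed
  have "\<exists>a \<tau>. a \<in> C \<and> strict_mono (\<tau> :: nat \<Rightarrow> nat) \<and> (\<lambda>k. x (\<sigma> (\<tau> k))) \<longlonglongrightarrow> a"
    by (rule sub) (simp add: fxy)
  then obtain a \<tau> where \<tau>: "a \<in> C" "strict_mono (\<tau> :: nat \<Rightarrow> nat)" "(\<lambda>k. x (\<sigma> (\<tau> k))) \<longlonglongrightarrow> a"
    by (elim exE conjE) (rule that)
  have "\<exists>b \<upsilon>. b \<in> C \<and> strict_mono (\<upsilon> :: nat \<Rightarrow> nat) \<and> (\<lambda>k. y (\<sigma> (\<tau> (\<upsilon> k)))) \<longlonglongrightarrow> b"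
    by (rule sub) (simp add: fxy)
  then obtain b \<upsilon> where \<upsilon>: "b \<in> C" "strict_mono (\<upsilon> :: nat \<Rightarrow> nat)" "(\<lambda>k. y (\<sigma> (\<tau> (\<upsilon> k)))) \<longlonglongrightarrow> b"
    by (elim exE conjE) (rule that)
  define n where "n k = \<sigma> (\<tau> (\<upsilon> k))" for k
  have n_ge: "n k \<ge> k" for k
    unfolding n_def using \<sigma>(1) \<tau>(2) \<upsilon>(2) by (meson le_trans strict_mono_imp_increasing)
  have xa: "(\<lambda>k. x (n k)) \<longlonglongrightarrow> a"
    using LIMSEQ_subseq_LIMSEQ[OF \<tau>(3) \<upsilon>(2)] by (simp add: n_def o_def)
  have yb: "(\<lambda>k. y (n k)) \<longlonglongrightarrow> b" using \<upsilon>(3) by (simp add: n_def)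
  have conth: "continuous_on C h"
    using \<sigma>(2) C(2) continuous_on_subset by (auto simp: unit_slice_hol_def slice_hol_def)
  have ul: "uniform_limit C (\<lambda>k. f (n k)) h sequentially"
    unfolding uniform_limit_sequentially_iff
  proof (intro allI impI)
    fix e :: real assume "e > 0"
    then obtain N where N: "\<And>k x. k \<ge> N \<Longrightarrow> x \<in> C \<Longrightarrow> dist (f (\<sigma> k) x) (h x) < e"
      using uniform_limitD[OF \<sigma>(3)[OF C]] unfolding eventually_sequentially by metis
    have "\<tau> (\<upsilon> k) \<ge> k" for k using \<tau>(2) \<upsilon>(2) by (meson le_trans strict_mono_imp_increasing)
    then show "\<exists>N. \<forall>k\<ge>N. \<forall>x\<in>C. dist (f (n k) x) (h x) < e"
      unfolding n_def using N by (meson le_trans)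
  qed
  have fx: "(\<lambda>k. f (n k) (z k)) \<longlonglongrightarrow> h c" if z: "z \<longlonglongrightarrow> c" "\<And>k. z k \<in> C" "c \<in> C" for z c
  proof -
    have "(\<lambda>k. f (n k) (z k) - h (z k)) \<longlonglongrightarrow> 0"
    proof (rule LIMSEQ_I)
      fix e :: real assume "e > 0"
      then show "\<exists>N. \<forall>k\<ge>N. norm (f (n k) (z k) - h (z k) - 0) < e"
        using uniform_limitD[OF ul, of e] z(2) unfolding eventually_sequentially dist_norm by simp blast
    qed
    moreover have "(\<lambda>k. h (z k)) \<longlonglongrightarrow> h c"
      using conth z by (simp add: continuous_on_sequentially o_def)
    ultimately have "(\<lambda>k. (f (n k) (z k) - h (z k)) + h (z k)) \<longlonglongrightarrow> 0 + h c" by (rule tendsto_add)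
    then show ?thesis by simp
  qed
  have lim1: "(\<lambda>k. cmod (f (n k) (x (n k)) - f (n k) (y (n k)))) \<longlonglongrightarrow> cmod (h a - h b)"
    using fx[OF xa fxy(2) \<tau>(1)] fx[OF yb fxy(3) \<upsilon>(1)] by (intro tendsto_intros)
  have lim2: "(\<lambda>k. 2 - 1 / (real k + 1)) \<longlonglongrightarrow> 2 - 0"
  proof (intro tendsto_intros)
    show "(\<lambda>k. 1 / (real k + 1)) \<longlonglongrightarrow> 0"
      using LIMSEQ_inverse_real_of_nat by (simp add: inverse_eq_divide add.commute)
  qed
  have "cmod (h a - h b) \<ge> 2 - 0"
  proof (rule LIMSEQ_le[OF lim2 lim1], intro exI[of _ 0] allI impI)
    fix k :: nat
    have "1 / (real (n k) + 1) \<le> 1 / (real k + 1)" using n_ge[of k] by (intro divide_left_mono) auto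
    then show "2 - 1 / (real k + 1) \<le> cmod (f (n k) (x (n k)) - f (n k) (y (n k)))"
      using fxy(4)[of "n k"] by linarith
  qed
  moreover have hb: "cmod (h a) \<le> 1" "cmod (h b) \<le> 1"
    using \<sigma>(2) \<tau>(1) \<upsilon>(1) C(2) by (auto simp: unit_slice_hol_def)
  ultimately have "cmod (h a) = 1" and ab: "cmod (h a - h b) \<ge> 2"
    using norm_triangle_ineq4[of "h a" "h b"] by linarith+
  then have "h b = h a" using unit_slice_hol_max_constant[OF \<sigma>(2) U] \<tau>(1) \<upsilon>(1) C(2) by blast
  then show False using ab by simp
qed

section \<open>Transversal systems of real hypersurfaces\<close>

text \<open>
  Independence of an indexed family: equal vectors with different indices are dependent, as is needed
  for the gradients of several functions at one point.
\<close>

definition lin_ind :: "nat set \<Rightarrow> (nat \<Rightarrow> 'a::real_vector) \<Rightarrow> bool" where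
  "lin_ind J v \<longleftrightarrow> (\<forall>c. (\<Sum>i\<in>J. c i *\<^sub>R v i) = 0 \<longrightarrow> (\<forall>i\<in>J. c i = 0))"

lemma lin_ind_subset:
  assumes "lin_ind J v" "I \<subseteq> J" "finite J"
  shows "lin_ind I v"
  unfolding lin_ind_def
proof (intro allI impI ballI)
  fix c i assume c: "(\<Sum>i\<in>I. c i *\<^sub>R v i) = 0" and i: "i \<in> I"
  have "(\<Sum>i\<in>J. (if i \<in> I then c i else 0) *\<^sub>R v i) = (\<Sum>i\<in>I. c i *\<^sub>R v i)"
    by (rule sum.mono_neutral_cong_right) (use assms in auto)
  then have s0: "(\<Sum>i\<in>J. (if i \<in> I then c i else 0) *\<^sub>R v i) = 0" using c by simp
  have "\<forall>i\<in>J. (if i \<in> I then c i else 0) = 0"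
    using assms(1)[unfolded lin_ind_def, THEN spec, THEN mp, OF s0] .
  then have "(if i \<in> I then c i else 0) = 0" using i assms(2) by blast
  then show "c i = 0" using i by simp
qed

lemma span_image_sum:
  assumes "finite J" "x \<in> span (v ` J)"
  shows "\<exists>c. x = (\<Sum>i\<in>J. c i *\<^sub>R v i)"
proof -
  define S where "S = range (\<lambda>c. \<Sum>i\<in>J. c i *\<^sub>R v i)"
  have "subspace S"
    unfolding subspace_def
  proof (intro conjI ballI allI)
    show "0 \<in> S" unfolding S_def by (rule image_eqI[of _ _ "\<lambda>_. 0"]) auto
    fix a b assume "a \<in> S" "b \<in> S"
    then obtain c d where "a = (\<Sum>i\<in>J. c i *\<^sub>R v i)" "b = (\<Sum>i\<in>J. d i *\<^sub>R v i)" by (auto simp: S_def)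
    then have "a + b = (\<Sum>i\<in>J. (c i + d i) *\<^sub>R v i)" by (simp add: scaleR_add_left sum.distrib)
    then show "a + b \<in> S" unfolding S_def by (rule range_eqI[where x = "\<lambda>i. c i + d i"])
  next
    fix k a assume "a \<in> S"
    then obtain c where "a = (\<Sum>i\<in>J. c i *\<^sub>R v i)" by (auto simp: S_def)
    then have "k *\<^sub>R a = (\<Sum>i\<in>J. (k * c i) *\<^sub>R v i)" by (simp add: scaleR_sum_right)
    then show "k *\<^sub>R a \<in> S" unfolding S_def by (rule range_eqI[where x = "\<lambda>i. k * c i"])
  qed
  moreover have "v ` J \<subseteq> S"
  proof
    fix y assume "y \<in> v ` J"
    then obtain j where j: "j \<in> J" "y = v j" by blast
    have "(\<Sum>i\<in>J. (if i = j then 1 else 0) *\<^sub>R v i) = (\<Sum>i\<in>J. if i = j then v i else 0)"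
      by (rule sum.cong) auto
    also have "\<dots> = v j" using assms(1) j(1) by (simp add: sum.delta)
    finally show "y \<in> S" unfolding S_def j(2)
      by (intro range_eqI[where x = "\<lambda>i. if i = j then 1 else 0"]) simp
  qed
  ultimately have "span (v ` J) \<subseteq> S" by (rule span_minimal[rotated])
  then show ?thesis using assms(2) by (auto simp: S_def)
qed

text \<open>
  The dual of a new vector is its component orthogonal to the span of the others, normalised; the
  earlier dual vectors are corrected by a multiple of it.
\<close>

lemma lin_ind_dual:
  fixes v :: "nat \<Rightarrow> 'a::euclidean_space"
  assumes "finite J" "lin_ind J v"
  shows "\<exists>d. \<forall>i\<in>J. \<forall>j\<in>J. d i \<bullet> v j = (if i = j then 1 else 0)"
  using assms
proof (induction J rule: finite_induct)
  case (insert k J)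
  have "lin_ind J v" by (rule lin_ind_subset[OF insert.prems]) (use insert.hyps in auto)
  then obtain d where d: "\<And>i j. i \<in> J \<Longrightarrow> j \<in> J \<Longrightarrow> d i \<bullet> v j = (if i = j then 1 else 0)"
    using insert.IH by blast
  obtain y z where yz: "y \<in> span (v ` J)" "\<And>w. w \<in> span (v ` J) \<Longrightarrow> orthogonal z w" "v k = y + z"
    using orthogonal_subspace_decomp_exists[of "v ` J" "v k"] by metis
  have "z \<noteq> 0"
  proof
    assume "z = 0"
    then have "v k \<in> span (v ` J)" using yz by simp
    then obtain c where c: "v k = (\<Sum>i\<in>J. c i *\<^sub>R v i)" using span_image_sum[OF insert.hyps(1)] by blast
    define e where "e i = (if i = k then -1 else c i)" for i
    have "(\<Sum>i\<in>J. e i *\<^sub>R v i) = (\<Sum>i\<in>J. c i *\<^sub>R v i)"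
      by (rule sum.cong) (use insert.hyps(2) in \<open>auto simp: e_def\<close>)
    then have "(\<Sum>i\<in>insert k J. e i *\<^sub>R v i) = 0"
      using insert.hyps c by (simp add: e_def)
    then have "e k = 0" using insert.prems unfolding lin_ind_def by blast
    then show False by (simp add: e_def)
  qed
  then have zz: "z \<bullet> z \<noteq> 0" by simp
  define e where "e = (1 / (z \<bullet> z)) *\<^sub>R z"
  have ej: "e \<bullet> v j = 0" if "j \<in> J" for j
    using yz(2)[of "v j"] that by (simp add: e_def orthogonal_def span_base)
  have ek: "e \<bullet> v k = 1"
  proof -
    have "z \<bullet> y = 0" using yz(1,2) by (simp add: orthogonal_def)
    then have "z \<bullet> v k = z \<bullet> z" by (simp add: yz(3) inner_add_right)
    then show ?thesis using zz by (simp add: e_def)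
  qed
  define d' where "d' i = (if i = k then e else d i - (d i \<bullet> v k) *\<^sub>R e)" for i
  have "d' i \<bullet> v j = (if i = j then 1 else 0)" if "i \<in> insert k J" "j \<in> insert k J" for i j
    using that insert.hyps(2) d ej ek by (auto simp: d'_def inner_diff_left)
  then show ?case by blast
qed auto

text \<open>
  Linear independence persists nearby: pairing a relation with the dual vectors at the centre
  shows that its largest coefficient is at most half of itself.
\<close>

lemma lin_ind_near:
  fixes v :: "'b::metric_space \<Rightarrow> nat \<Rightarrow> 'a::euclidean_space"
  assumes J: "finite J" "lin_ind J (v a)" and cont: "\<And>i. i \<in> J \<Longrightarrow> isCont (\<lambda>x. v x i) a"
  shows "\<exists>r>0. \<forall>x\<in>ball a r. lin_ind J (v x)"
proof -
  obtain d where d: "\<And>i j. i \<in> J \<Longrightarrow> j \<in> J \<Longrightarrow> d i \<bullet> v a j = (if i = j then 1 else 0)"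
    using lin_ind_dual[OF J] by blast
  define \<delta> where "\<delta> = 1 / (2 * (real (card J) + 1))"
  have \<delta>: "\<delta> > 0" by (simp add: \<delta>_def)
  have "\<forall>\<^sub>F x in at a. \<forall>i\<in>J. \<forall>j\<in>J. \<bar>d j \<bullet> v x i - d j \<bullet> v a i\<bar> < \<delta>"
  proof (intro eventually_ball_finite J(1) ballI)
    fix i j assume ij: "i \<in> J" "j \<in> J"
    have "((\<lambda>x. d j \<bullet> v x i) \<longlongrightarrow> d j \<bullet> v a i) (at a)"
      using cont[OF ij(1)] unfolding isCont_def by (intro tendsto_intros)
    from tendstoD[OF this \<delta>] show "\<forall>\<^sub>F x in at a. \<bar>d j \<bullet> v x i - d j \<bullet> v a i\<bar> < \<delta>"
      by (simp add: dist_real_def)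
  qed
  then obtain r where r: "r > 0"
    "\<And>x i j. x \<noteq> a \<Longrightarrow> dist x a < r \<Longrightarrow> i \<in> J \<Longrightarrow> j \<in> J \<Longrightarrow> \<bar>d j \<bullet> v x i - d j \<bullet> v a i\<bar> < \<delta>"
    unfolding eventually_at by blast
  have "lin_ind J (v x)" if x: "x \<in> ball a r" for x
    unfolding lin_ind_def
  proof (intro allI impI)
    fix c assume c: "(\<Sum>i\<in>J. c i *\<^sub>R v x i) = 0"
    have near: "\<bar>d j \<bullet> v x i - d j \<bullet> v a i\<bar> \<le> \<delta>" if "i \<in> J" "j \<in> J" for i j
      using r(2)[of x i j] x that \<delta> by (cases "x = a") (auto simp: dist_commute intro: less_imp_le)
    show "\<forall>i\<in>J. c i = 0"
    proof (cases "J = {}")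
      case False
      define m where "m = Max ((\<lambda>i. \<bar>c i\<bar>) ` J)"
      have cm: "\<bar>c i\<bar> \<le> m" if "i \<in> J" for i using J(1) that by (simp add: m_def)
      have "m \<in> (\<lambda>i. \<bar>c i\<bar>) ` J" unfolding m_def using J(1) False by (intro Max_in) auto
      then obtain j where j: "j \<in> J" "m = \<bar>c j\<bar>" by blast
      have "0 = d j \<bullet> (\<Sum>i\<in>J. c i *\<^sub>R v x i)" using c by simp
      also have "\<dots> = (\<Sum>i\<in>J. c i * (d j \<bullet> v x i - d j \<bullet> v a i)) + (\<Sum>i\<in>J. c i * (d j \<bullet> v a i))"
        by (simp add: inner_sum_right algebra_simps flip: sum.distrib)
      also have "(\<Sum>i\<in>J. c i * (d j \<bullet> v a i)) = (\<Sum>i\<in>J. if i = j then c i else 0)"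
        by (rule sum.cong) (use d j in auto)
      also have "\<dots> = c j" using J(1) j(1) by (simp add: sum.delta)
      finally have "\<bar>c j\<bar> = \<bar>\<Sum>i\<in>J. c i * (d j \<bullet> v x i - d j \<bullet> v a i)\<bar>" by linarith
      also have "\<dots> \<le> (\<Sum>i\<in>J. \<bar>c i * (d j \<bullet> v x i - d j \<bullet> v a i)\<bar>)" by (rule sum_abs)
      also have "\<dots> \<le> (\<Sum>i\<in>J. m * \<delta>)"
        unfolding abs_mult using cm near j \<delta> by (intro sum_mono mult_mono) auto
      also have "\<dots> = real (card J) * \<delta> * m" by simp
      finally have "m \<le> real (card J) * \<delta> * m" using j(2) by simp
      moreover have "real (card J) * \<delta> \<le> 1 / 2" by (simp add: \<delta>_def field_simps)
      moreover have "m \<ge> 0" using j(2) by simp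
      ultimately have "m \<le> 1/2 * m" by (meson mult_right_mono order_trans)
      then have "m = 0" using \<open>m \<ge> 0\<close> by simp
      then show ?thesis using cm by fastforce
    qed auto
  qed
  then show ?thesis using r(1) by blast
qed

text \<open>
  Since the vectors are independent, some direction has prescribed inner products with them, and
  nearly the same inner products with the nearby systems.
\<close>

lemma lin_ind_direction:
  fixes v :: "'b::metric_space \<Rightarrow> nat \<Rightarrow> 'a::euclidean_space"
  assumes J: "finite J" "lin_ind J (v a)" and cont: "\<And>i. i \<in> J \<Longrightarrow> isCont (\<lambda>x. v x i) a"
  shows "\<exists>M>0. \<exists>r>0. \<forall>b. (\<forall>j\<in>J. \<bar>b j\<bar> \<le> 1) \<longrightarrow>
    (\<exists>\<nu>. norm \<nu> \<le> M \<and> (\<forall>x\<in>ball a r. \<forall>j\<in>J. \<bar>v x j \<bullet> \<nu> - b j\<bar> \<le> 1/4))"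
proof -
  obtain d where d: "\<And>i j. i \<in> J \<Longrightarrow> j \<in> J \<Longrightarrow> d i \<bullet> v a j = (if i = j then 1 else 0)"
    using lin_ind_dual[OF J] by blast
  define M where "M = (\<Sum>i\<in>J. norm (d i)) + 1"
  have M: "M > 0" unfolding M_def by (simp add: add_nonneg_pos sum_nonneg)
  have "\<forall>\<^sub>F x in at a. \<forall>j\<in>J. dist (v x j) (v a j) < 1 / (4 * M)"
    using cont M unfolding isCont_def
    by (intro eventually_ball_finite J(1) ballI) (auto intro!: tendstoD)
  then obtain r where r: "r > 0" "\<And>x j. x \<noteq> a \<Longrightarrow> dist x a < r \<Longrightarrow> j \<in> J \<Longrightarrow> dist (v x j) (v a j) < 1 / (4 * M)"
    unfolding eventually_at by blast
  have "\<exists>\<nu>. norm \<nu> \<le> M \<and> (\<forall>x\<in>ball a r. \<forall>j\<in>J. \<bar>v x j \<bullet> \<nu> - b j\<bar> \<le> 1/4)"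
    if b: "\<forall>j\<in>J. \<bar>b j\<bar> \<le> 1" for b
  proof -
    define \<nu> where "\<nu> = (\<Sum>i\<in>J. b i *\<^sub>R d i)"
    have "norm \<nu> \<le> (\<Sum>i\<in>J. norm (d i))"
      unfolding \<nu>_def
    proof (rule sum_norm_le)
      show "norm (b i *\<^sub>R d i) \<le> norm (d i)" if "i \<in> J" for i
        using b that mult_right_mono[of "\<bar>b i\<bar>" 1 "norm (d i)"] by simp
    qed
    then have nM: "norm \<nu> \<le> M" by (simp add: M_def)
    have pair: "v a j \<bullet> \<nu> = b j" if "j \<in> J" for j
    proof -
      have "v a j \<bullet> \<nu> = (\<Sum>i\<in>J. b i * (d i \<bullet> v a j))" by (simp add: \<nu>_def inner_sum_right inner_commute)
      also have "\<dots> = (\<Sum>i\<in>J. if i = j then b i else 0)" by (rule sum.cong) (use d that in auto)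
      finally show ?thesis using J(1) that by (simp add: sum.delta)
    qed
    have "\<bar>v x j \<bullet> \<nu> - b j\<bar> \<le> 1/4" if x: "x \<in> ball a r" and j: "j \<in> J" for x j
    proof -
      have "dist x a < r" using x by (simp add: dist_commute)
      then have "dist (v x j) (v a j) \<le> 1 / (4 * M)"
        using r(2)[of x j] j M by (cases "x = a") auto
      then have "norm (v x j - v a j) \<le> 1 / (4 * M)" by (simp add: dist_norm)
      then have "norm (v x j - v a j) * norm \<nu> \<le> 1 / (4 * M) * M"
        using nM M by (intro mult_mono) auto
      moreover have "\<bar>(v x j - v a j) \<bullet> \<nu>\<bar> \<le> norm (v x j - v a j) * norm \<nu>" by (rule Cauchy_Schwarz_ineq2)
      ultimately show ?thesis using M pair[OF j] by (simp add: inner_diff_left)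
    qed
    then show ?thesis using nM by blast
  qed
  then show ?thesis using M r(1) by blast
qed

text \<open>
  The gradient must be differentiable, and not only continuous, because it enters a parametrisation
  that has to map null sets to null sets.
\<close>

definition has_grad :: "('a::euclidean_space \<Rightarrow> real) \<Rightarrow> ('a \<Rightarrow> 'a) \<Rightarrow> bool" where
  "has_grad f G \<longleftrightarrow> (\<forall>z. (f has_derivative (\<lambda>h. G z \<bullet> h)) (at z) \<and> G differentiable (at z))"

lemma has_grad_isCont: "has_grad f G \<Longrightarrow> isCont f z"
  unfolding has_grad_def using has_derivative_continuous by blast

lemma has_grad_isCont_grad: "has_grad f G \<Longrightarrow> isCont G z"
  unfolding has_grad_def using differentiable_imp_continuous_within by blast

text \<open>Subtracting the linear part at \<open>a\<close> leaves a function whose gradient is small near \<open>a\<close>.\<close>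

lemma has_grad_strict:
  assumes "has_grad f G" "\<delta> > 0"
  shows "\<exists>r>0. \<forall>x\<in>ball a r. \<forall>y\<in>ball a r. \<bar>f x - f y - G a \<bullet> (x - y)\<bar> \<le> \<delta> * norm (x - y)"
proof -
  obtain r where r: "r > 0" "\<And>x. x \<in> ball a r \<Longrightarrow> norm (G x - G a) \<le> \<delta>"
  proof -
    have "(G \<longlongrightarrow> G a) (at a)" using has_grad_isCont_grad[OF assms(1)] isCont_def by blast
    from tendstoD[OF this assms(2)] obtain r where "r > 0" "\<And>x. x \<noteq> a \<Longrightarrow> dist x a < r \<Longrightarrow> dist (G x) (G a) < \<delta>"
      unfolding eventually_at by blast
    then show ?thesis
      using assms(2) by (intro that[of r]) (metis diff_self dist_commute dist_norm less_eq_real_def mem_ball norm_zero)+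
  qed
  have "norm ((f x - G a \<bullet> x) - (f y - G a \<bullet> y)) \<le> \<delta> * norm (x - y)" if "x \<in> ball a r" "y \<in> ball a r" for x y
  proof (rule differentiable_bound[where S = "ball a r" and f' = "\<lambda>z h. (G z - G a) \<bullet> h"])
    fix z assume z: "z \<in> ball a r"
    have "(f has_derivative (\<lambda>h. G z \<bullet> h)) (at z within ball a r)"
      using assms(1) unfolding has_grad_def by (blast intro: has_derivative_at_withinI)
    then show "((\<lambda>z. f z - G a \<bullet> z) has_derivative (\<lambda>h. (G z - G a) \<bullet> h)) (at z within ball a r)"
      by (auto intro!: derivative_eq_intros simp: inner_diff_left)
    show "onorm (\<lambda>h. (G z - G a) \<bullet> h) \<le> \<delta>"
    proof (rule onorm_le)
      fix h
      have "norm ((G z - G a) \<bullet> h) \<le> norm (G z - G a) * norm h" using Cauchy_Schwarz_ineq2 by simp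
      also have "\<dots> \<le> \<delta> * norm h" using r(2)[OF z] by (rule mult_right_mono) simp
      finally show "norm ((G z - G a) \<bullet> h) \<le> \<delta> * norm h" .
    qed
  qed (use that in auto)
  then show ?thesis using r(1) by (intro exI[of _ r]) (auto simp: inner_diff_right algebra_simps)
qed

text \<open>
  Near a point where the gradients \<open>G i a0\<close> have dual vectors \<open>d i\<close>, the common level set is a
  Lipschitz graph: the map \<open>x \<mapsto> x - \<Sum>i. (G i a0 \<bullet> x) d i\<close> onto the tangent space expands
  distances on it by at least 1/2.
\<close>

lemma level_set_graph:
  assumes I: "finite I" and g: "\<And>i. i \<in> I \<Longrightarrow> has_grad (f i) (G i)"
  shows "\<exists>r>0. \<forall>a\<in>ball a0 r. \<forall>b\<in>ball a0 r. (\<forall>i\<in>I. f i a = f i b) \<longrightarrow>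
    norm (a - b) \<le> 2 * norm ((a - (\<Sum>i\<in>I. (G i a0 \<bullet> a) *\<^sub>R d i)) - (b - (\<Sum>i\<in>I. (G i a0 \<bullet> b) *\<^sub>R d i)))"
proof -
  define D where "D = (\<Sum>i\<in>I. norm (d i)) + 1"
  have D: "D > 0" unfolding D_def by (simp add: add_nonneg_pos sum_nonneg)
  define \<delta> where "\<delta> = 1 / (2 * D)"
  have \<delta>: "\<delta> > 0" using D by (simp add: \<delta>_def)
  have "\<forall>i\<in>I. \<exists>r>0. \<forall>x\<in>ball a0 r. \<forall>y\<in>ball a0 r. \<bar>f i x - f i y - G i a0 \<bullet> (x - y)\<bar> \<le> \<delta> * norm (x - y)"
    using has_grad_strict[OF g \<delta>] by blast
  then obtain R where R: "\<And>i. i \<in> I \<Longrightarrow> R i > 0"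
    "\<And>i x y. i \<in> I \<Longrightarrow> x \<in> ball a0 (R i) \<Longrightarrow> y \<in> ball a0 (R i) \<Longrightarrow>
      \<bar>f i x - f i y - G i a0 \<bullet> (x - y)\<bar> \<le> \<delta> * norm (x - y)"
    by metis
  define r where "r = Min (insert 1 (R ` I))"
  have r: "r > 0" "\<And>i. i \<in> I \<Longrightarrow> r \<le> R i" using I R(1) by (auto simp: r_def)
  have "norm (a - b) \<le> 2 * norm ((a - (\<Sum>i\<in>I. (G i a0 \<bullet> a) *\<^sub>R d i)) - (b - (\<Sum>i\<in>I. (G i a0 \<bullet> b) *\<^sub>R d i)))"
    if ab: "a \<in> ball a0 r" "b \<in> ball a0 r" and eq: "\<forall>i\<in>I. f i a = f i b" for a b
  proof -
    define S where "S = (\<Sum>i\<in>I. (G i a0 \<bullet> (a - b)) *\<^sub>R d i)"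
    have "norm S \<le> (\<Sum>i\<in>I. \<delta> * norm (a - b) * norm (d i))"
      unfolding S_def
    proof (rule sum_norm_le)
      fix i assume i: "i \<in> I"
      have "\<bar>G i a0 \<bullet> (a - b)\<bar> \<le> \<delta> * norm (a - b)"
        using R(2)[OF i, of a b] ab r(2)[OF i] eq i by auto
      then show "norm ((G i a0 \<bullet> (a - b)) *\<^sub>R d i) \<le> \<delta> * norm (a - b) * norm (d i)"
        by (simp add: mult_right_mono)
    qed
    also have "\<dots> = \<delta> * (\<Sum>i\<in>I. norm (d i)) * norm (a - b)" by (simp add: sum_distrib_left mult_ac)
    also have "\<dots> \<le> \<delta> * D * norm (a - b)"
      using \<delta> by (intro mult_right_mono mult_left_mono) (auto simp: D_def)
    also have "\<dots> = norm (a - b) / 2" using D by (simp add: \<delta>_def)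
    finally have "norm S \<le> norm (a - b) / 2" .
    moreover have "norm (a - b) \<le> norm ((a - b) - S) + norm S" using norm_triangle_sub by (metis add.commute)
    moreover have eq: "(a - b) - S = (a - (\<Sum>i\<in>I. (G i a0 \<bullet> a) *\<^sub>R d i)) - (b - (\<Sum>i\<in>I. (G i a0 \<bullet> b) *\<^sub>R d i))"
      by (simp add: S_def inner_diff_right scaleR_diff_left sum_subtractf)
    ultimately show ?thesis unfolding eq[symmetric] by linarith
  qed
  then show ?thesis using r(1) by blast
qed

text \<open>
  Near each of its points the set is a Lipschitz image of a subset of a hyperplane.
\<close>

lemma negligible_level_set:
  fixes f :: "'a::euclidean_space \<Rightarrow> real"
  assumes g: "has_grad f G"
  shows "negligible {z. f z = 0 \<and> G z \<noteq> 0}"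
proof -
  define S where "S = {z. f z = 0 \<and> G z \<noteq> 0}"
  have "\<exists>U. openin (top_of_set S) U \<and> a0 \<in> U \<and> negligible U" if a0: "a0 \<in> S" for a0
  proof -
    define d where "d = (1 / (G a0 \<bullet> G a0)) *\<^sub>R G a0"
    define \<Psi> where "\<Psi> a = a - (G a0 \<bullet> a) *\<^sub>R d" for a
    have "G a0 \<noteq> 0" using a0 by (simp add: S_def)
    then have d: "G a0 \<bullet> d = 1" by (simp add: d_def)
    obtain r where r: "r > 0" "\<And>a b. a \<in> ball a0 r \<Longrightarrow> b \<in> ball a0 r \<Longrightarrow> f a = f b \<Longrightarrow> norm (a - b) \<le> 2 * norm (\<Psi> a - \<Psi> b)"
      using level_set_graph[of "{0::nat}" "\<lambda>_. f" "\<lambda>_. G" a0 "\<lambda>_. d"] g unfolding \<Psi>_def by auto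
    define T where "T = S \<inter> ball a0 r"
    have inj: "inj_on \<Psi> T"
    proof (rule inj_onI)
      fix a b assume ab: "a \<in> T" "b \<in> T" "\<Psi> a = \<Psi> b"
      then have "norm (a - b) \<le> 2 * norm (\<Psi> a - \<Psi> b)" by (intro r(2)) (auto simp: T_def S_def)
      then show "a = b" using ab(3) by simp
    qed
    have "\<Psi> ` T \<subseteq> {x. G a0 \<bullet> x = 0}" using d by (auto simp: \<Psi>_def inner_diff_right)
    then have "negligible (\<Psi> ` T)"
      using negligible_hyperplane[of "G a0" 0] \<open>G a0 \<noteq> 0\<close> negligible_subset by blast
    then have "negligible (inv_into T \<Psi> ` (\<Psi> ` T))"
    proof (rule negligible_locally_Lipschitz_image[rotated])
      fix x assume x: "x \<in> \<Psi> ` T"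
      have "norm (inv_into T \<Psi> y - inv_into T \<Psi> x) \<le> 2 * norm (y - x)" if y: "y \<in> \<Psi> ` T" for y
      proof -
        obtain a b where ab: "a \<in> T" "x = \<Psi> a" "b \<in> T" "y = \<Psi> b" using x y by blast
        then have "norm (b - a) \<le> 2 * norm (\<Psi> b - \<Psi> a)" by (intro r(2)) (auto simp: T_def S_def)
        then show ?thesis using ab inj by simp
      qed
      then show "\<exists>V B. open V \<and> x \<in> V \<and> (\<forall>y\<in>\<Psi> ` T \<inter> V. norm (inv_into T \<Psi> y - inv_into T \<Psi> x) \<le> B * norm (y - x))"
        by (intro exI[of _ UNIV] exI[of _ 2]) auto
    qed simp
    moreover have "inv_into T \<Psi> ` (\<Psi> ` T) = T" using inj by simp
    ultimately have "negligible T" by simp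
    moreover have "openin (top_of_set S) T" unfolding T_def by (simp add: openin_open_Int)
    ultimately show ?thesis using a0 r(1) by (intro exI[of _ T]) (auto simp: T_def)
  qed
  then show ?thesis using locally_negligible_alt[of S] unfolding S_def by blast
qed

text \<open>Coordinatewise conjugation turns the real gradient of \<open>Re L\<close> into the coefficients of \<open>L\<close>.\<close>

definition cnj_vec :: "complex ^ 'n::finite \<Rightarrow> complex ^ 'n" where
  "cnj_vec a = (\<chi> j. cnj (a $ j))"

lemma cnj_vec_nth [simp]: "cnj_vec a $ j = cnj (a $ j)"
  by (simp add: cnj_vec_def)

lemma norm_cnj_vec [simp]: "norm (cnj_vec a) = norm a"
  by (simp add: norm_vec_def)

lemma bounded_linear_cnj_vec: "bounded_linear cnj_vec"
  by (rule bounded_linear_intro[where K = 1]) (simp_all add: vec_eq_iff)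

lemma inner_vec_complex: "x \<bullet> y = Re (\<Sum>j\<in>UNIV. cnj (x $ j) * y $ j)" for x y :: "complex ^ 'n::finite"
  by (simp add: inner_vec_def inner_complex_def)

definition pairing :: "complex ^ 'n::finite \<Rightarrow> complex ^ 'n \<Rightarrow> complex" where
  "pairing l a = (\<Sum>j\<in>UNIV. l $ j * a $ j)"

lemma bounded_bilinear_pairing: "bounded_bilinear pairing"
proof (rule bounded_bilinear.intro)
  show "\<exists>K. \<forall>a b. norm (pairing a b) \<le> norm a * norm b * K"
  proof (intro exI allI)
    fix a b :: "complex ^ 'n"
    have "norm (pairing a b) \<le> (\<Sum>j\<in>(UNIV::'n set). norm a * norm b)"
      unfolding pairing_def
      by (rule sum_norm_le) (simp add: norm_mult mult_mono Finite_Cartesian_Product.norm_nth_le)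
    then show "norm (pairing a b) \<le> norm a * norm b * real CARD('n)" by (simp add: mult_ac)
  qed
qed (simp_all add: pairing_def algebra_simps sum.distrib scaleR_sum_right)

lemma bounded_bilinear_cmult_vec: "bounded_bilinear (\<lambda>c (a :: complex ^ 'n::finite). c *s a)"
proof (rule bounded_bilinear.intro)
  show "\<exists>K. \<forall>c (a :: complex ^ 'n). norm (c *s a) \<le> norm c * norm a * K"
    by (rule exI[of _ 1]) (simp add: norm_cmult_vec)
qed (simp_all add: vec_eq_iff algebra_simps)

lemma bounded_bilinear_differentiable:
  assumes "bounded_bilinear B" "f differentiable (at x)" "g differentiable (at x)"
  shows "(\<lambda>x. B (f x) (g x)) differentiable (at x)"
  using assms(2,3) bounded_bilinear.FDERIV[OF assms(1)] unfolding differentiable_def by blast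

lemma differentiable_local_lipschitz:
  assumes "f differentiable (at x)"
  shows "\<exists>d>0. \<exists>B\<ge>0. \<forall>y. norm (y - x) < d \<longrightarrow> norm (f y - f x) \<le> B * norm (y - x)"
proof -
  obtain f' where f': "bounded_linear f'"
    "\<And>e. e > 0 \<Longrightarrow> \<exists>d>0. \<forall>y. norm (y - x) < d \<longrightarrow> norm (f y - f x - f' (y - x)) \<le> e * norm (y - x)"
    using assms unfolding differentiable_def has_derivative_at_alt by blast
  obtain d where d: "d > 0" "\<And>y. norm (y - x) < d \<Longrightarrow> norm (f y - f x - f' (y - x)) \<le> 1 * norm (y - x)"
    using f'(2)[of 1] by auto
  have "norm (f y - f x) \<le> (onorm f' + 1) * norm (y - x)" if "norm (y - x) < d" for y
  proof -
    have "norm (f y - f x) \<le> norm (f y - f x - f' (y - x)) + norm (f' (y - x))"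
      by (metis diff_add_cancel norm_triangle_ineq)
    also have "\<dots> \<le> 1 * norm (y - x) + onorm f' * norm (y - x)"
      using d(2)[OF that] onorm[OF f'(1), of "y - x"] by linarith
    finally show ?thesis by (simp add: algebra_simps)
  qed
  moreover have "onorm f' + 1 \<ge> 0" using onorm_pos_le[OF f'(1)] by simp
  ultimately show ?thesis using d(1) by blast
qed

lemma negligible_unit_circle_product:
  "negligible {y :: 'a::euclidean_space \<times> complex. cmod (snd y) = 1}"
proof -
  define f where "f y = snd y \<bullet> snd y - 1" for y :: "'a \<times> complex"
  define G :: "'a \<times> complex \<Rightarrow> 'a \<times> complex" where "G y = (0, 2 *\<^sub>R snd y)" for y
  have "has_grad f G"
    unfolding has_grad_def
  proof (intro allI conjI)
    fix z :: "'a \<times> complex"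
    show "(f has_derivative (\<lambda>h. G z \<bullet> h)) (at z)"
      unfolding f_def G_def inner_Pair inner_prod_def
      by (auto intro!: derivative_eq_intros simp: inner_commute)
    have "G = (\<lambda>y. (0, 2 *\<^sub>R snd y))" by (simp add: G_def fun_eq_iff)
    moreover have "bounded_linear (\<lambda>y::'a \<times> complex. (0::'a, 2 *\<^sub>R snd y))"
      by (intro bounded_linear_Pair bounded_linear_zero bounded_linear_const_scaleR bounded_linear_snd)
    ultimately show "G differentiable (at z)"
      by (simp add: bounded_linear_imp_differentiable)
  qed
  then have "negligible {z. f z = 0 \<and> G z \<noteq> 0}" by (rule negligible_level_set)
  moreover have "{y :: 'a \<times> complex. cmod (snd y) = 1} \<subseteq> {z. f z = 0 \<and> G z \<noteq> 0}"
    by (auto simp: f_def G_def dot_square_norm zero_prod_def)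
  ultimately show ?thesis by (rule negligible_subset)
qed

text \<open>
  The parameters \<open>(c, l)\<close> for which the hypersurface \<open>q z + c + pairing l z = 0\<close> is tangent, in the
  real sense, to an intersection of level sets \<open>f i = 0\<close>, \<open>i \<in> I\<close>: at some common point a complex
  multiple of the complex gradient is a combination of the gradients \<open>G i\<close>.
\<close>

definition tangent_params ::
  "nat set \<Rightarrow> (nat \<Rightarrow> complex ^ 'n::finite \<Rightarrow> real) \<Rightarrow> (nat \<Rightarrow> complex ^ 'n \<Rightarrow> complex ^ 'n) \<Rightarrow>
   (complex ^ 'n \<Rightarrow> complex) \<Rightarrow> (complex ^ 'n \<Rightarrow> complex ^ 'n) \<Rightarrow> (complex ^ 'n) set \<Rightarrow> (complex \<times> (complex ^ 'n)) set" where
  "tangent_params I f G q dq D = {(c, l). \<exists>a w lam. a \<in> D \<and> (\<forall>i\<in>I. f i a = 0) \<and> lin_ind I (\<lambda>i. G i a) \<and>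
     cmod w = 1 \<and> dq a + l = w *s cnj_vec (\<Sum>i\<in>I. lam i *\<^sub>R G i a) \<and> q a + c + pairing l a = 0}"

text \<open>
  Points \<open>a\<close> of the level set together with coefficients \<open>lam\<close> make up, locally, a Lipschitz copy of
  a subset of the whole space: the tangential coordinates of \<open>a\<close> and one coordinate for each
  coefficient.  With the unit complex number \<open>w\<close> this is one real dimension less than the space of
  parameters, which are a differentiable function of \<open>a\<close>, \<open>lam\<close> and \<open>w\<close>.
\<close>

lemma negligible_tangent_params_local:
  fixes q :: "complex ^ 'n::finite \<Rightarrow> complex"
  assumes I: "finite I" and g: "\<And>i. i \<in> I \<Longrightarrow> has_grad (f i) (G i)"
    and q: "\<And>z. q differentiable (at z)" and dq: "\<And>z. dq differentiable (at z)"
    and li: "lin_ind I (\<lambda>i. G i a0)"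
  shows "\<exists>r>0. negligible (tangent_params I f G q dq (ball a0 r))"
proof -
  obtain d where d: "\<And>i j. i \<in> I \<Longrightarrow> j \<in> I \<Longrightarrow> d i \<bullet> G j a0 = (if i = j then 1 else 0)"
    using lin_ind_dual[OF I li] by blast
  define \<Psi> where "\<Psi> a = a - (\<Sum>i\<in>I. (G i a0 \<bullet> a) *\<^sub>R d i)" for a
  obtain r where r: "r > 0" "\<And>a b. a \<in> ball a0 r \<Longrightarrow> b \<in> ball a0 r \<Longrightarrow> \<forall>i\<in>I. f i a = f i b \<Longrightarrow> norm (a - b) \<le> 2 * norm (\<Psi> a - \<Psi> b)"
    using level_set_graph[where I = I and f = f and G = G and ?a0.0 = a0 and d = d] I g
    unfolding \<Psi>_def by blast
  define M where "M = {a \<in> ball a0 r. \<forall>i\<in>I. f i a = 0}"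
  have M: "norm (a - b) \<le> 2 * norm (\<Psi> a - \<Psi> b)" if "a \<in> M" "b \<in> M" for a b
    using that by (intro r(2)) (auto simp: M_def)
  have bl\<Psi>: "bounded_linear \<Psi>"
    unfolding \<Psi>_def
    by (intro bounded_linear_sub bounded_linear_ident bounded_linear_sum bounded_linear_scaleR_left[THEN bounded_linear_compose] bounded_linear_inner_right)
  define K where "K = onorm \<Psi>"
  have K: "norm (\<Psi> x - \<Psi> y) \<le> K * norm (x - y)" for x y
    using onorm[OF bl\<Psi>, of "x - y"] by (simp add: K_def bounded_linear.linear[OF bl\<Psi>, THEN linear_diff])
  have K0: "K \<ge> 0" unfolding K_def by (rule onorm_pos_le[OF bl\<Psi>])
  define S where "S = {y :: (complex ^ 'n) \<times> complex. cmod (snd y) = 1 \<and> (\<exists>a\<in>M. \<Psi> (fst y) = \<Psi> a)}"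
  \<comment> \<open>the point of the level set with the same tangential coordinates as \<open>x\<close>\<close>
  define \<alpha> where "\<alpha> x = (SOME a. a \<in> M \<and> \<Psi> x = \<Psi> a)" for x
  have \<alpha>: "\<alpha> (fst y) \<in> M" "\<Psi> (\<alpha> (fst y)) = \<Psi> (fst y)" if y: "y \<in> S" for y
  proof -
    have "\<exists>a. a \<in> M \<and> \<Psi> (fst y) = \<Psi> a" using y by (auto simp: S_def)
    from someI_ex[OF this] show "\<alpha> (fst y) \<in> M" "\<Psi> (\<alpha> (fst y)) = \<Psi> (fst y)" by (auto simp: \<alpha>_def)
  qed
  have \<alpha>lip: "norm (\<alpha> (fst y') - \<alpha> (fst y)) \<le> 2 * K * norm (fst y' - fst y)" if "y \<in> S" "y' \<in> S" for y y'
    using M[OF \<alpha>(1)[OF that(2)] \<alpha>(1)[OF that(1)]] K[of "fst y'" "fst y"] \<alpha>(2) that by simp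
  define L where "L = (\<lambda>(x, w, a). w *s cnj_vec (\<Sum>i\<in>I. (G i a0 \<bullet> x) *\<^sub>R G i a) - dq a)"
  define \<Theta> where "\<Theta> y = (- q (snd (snd y)) - pairing (L y) (snd (snd y)), L y)" for y
  have \<Theta>: "\<Theta> differentiable (at y)" for y
  proof -
    have s2: "(\<lambda>y :: (complex ^ 'n) \<times> complex \<times> (complex ^ 'n). snd (snd y)) differentiable (at y)"
      by (intro bounded_linear_imp_differentiable bounded_linear_compose[OF bounded_linear_snd bounded_linear_snd])
    have s1: "(\<lambda>y :: (complex ^ 'n) \<times> complex \<times> (complex ^ 'n). fst (snd y)) differentiable (at y)"
      by (intro bounded_linear_imp_differentiable bounded_linear_compose[OF bounded_linear_fst bounded_linear_snd])
    have f1: "(\<lambda>y :: (complex ^ 'n) \<times> complex \<times> (complex ^ 'n). fst y) differentiable (at y)"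
      by (intro bounded_linear_imp_differentiable bounded_linear_fst)
    have Gd: "(\<lambda>y :: (complex ^ 'n) \<times> complex \<times> (complex ^ 'n). G i (snd (snd y))) differentiable (at y)" if "i \<in> I" for i
      using differentiable_chain_at[OF s2, of "G i"] g[OF that] by (simp add: has_grad_def o_def)
    have "(\<lambda>y. \<Sum>i\<in>I. (G i a0 \<bullet> fst y) *\<^sub>R G i (snd (snd y))) differentiable (at y)"
      by (intro differentiable_sum I ballI differentiable_scaleR differentiable_inner differentiable_const f1 Gd)
    from differentiable_chain_at[OF this bounded_linear_imp_differentiable[OF bounded_linear_cnj_vec]]
    have "(\<lambda>y. cnj_vec (\<Sum>i\<in>I. (G i a0 \<bullet> fst y) *\<^sub>R G i (snd (snd y)))) differentiable (at y)"
      by (simp add: o_def)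
    then have "(\<lambda>y. fst (snd y) *s cnj_vec (\<Sum>i\<in>I. (G i a0 \<bullet> fst y) *\<^sub>R G i (snd (snd y)))) differentiable (at y)"
      by (rule bounded_bilinear_differentiable[OF bounded_bilinear_cmult_vec s1])
    moreover have "(\<lambda>y. dq (snd (snd y))) differentiable (at y)"
      using differentiable_chain_at[OF s2, of dq] dq by (simp add: o_def)
    ultimately have "(\<lambda>y. fst (snd y) *s cnj_vec (\<Sum>i\<in>I. (G i a0 \<bullet> fst y) *\<^sub>R G i (snd (snd y))) - dq (snd (snd y))) differentiable (at y)"
      by (rule differentiable_diff)
    then have Ld: "L differentiable (at y)" by (simp add: L_def case_prod_unfold)
    have "(\<lambda>y. - q (snd (snd y)) - pairing (L y) (snd (snd y))) differentiable (at y)"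
      using differentiable_chain_at[OF s2, of q] q
      by (intro differentiable_diff differentiable_minus bounded_bilinear_differentiable[OF bounded_bilinear_pairing] Ld s2) (simp add: o_def)
    then obtain D where "((\<lambda>y. - q (snd (snd y)) - pairing (L y) (snd (snd y))) has_derivative D) (at y)"
      unfolding differentiable_def by blast
    moreover obtain D' where "(L has_derivative D') (at y)" using Ld unfolding differentiable_def by blast
    ultimately have "((\<lambda>y. (- q (snd (snd y)) - pairing (L y) (snd (snd y)), L y)) has_derivative (\<lambda>h. (D h, D' h))) (at y)"
      by (rule has_derivative_Pair)
    then show ?thesis unfolding \<Theta>_def differentiable_def by blast
  qed
  define F where "F y = \<Theta> (fst y, snd y, \<alpha> (fst y))" for y
  have "negligible (F ` S)"
  proof (rule negligible_locally_Lipschitz_image)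
    show "negligible S"
      by (rule negligible_subset[OF negligible_unit_circle_product]) (auto simp: S_def)
    fix y assume y: "y \<in> S"
    define Y where "Y y = (fst y, snd y, \<alpha> (fst y))" for y :: "(complex ^ 'n) \<times> complex"
    have FY: "F z = \<Theta> (Y z)" for z by (simp add: F_def Y_def)
    obtain \<delta> B where B: "\<delta> > 0" "B \<ge> 0" "\<And>u. norm (u - Y y) < \<delta> \<Longrightarrow> norm (\<Theta> u - \<Theta> (Y y)) \<le> B * norm (u - Y y)"
      using differentiable_local_lipschitz[OF \<Theta>] by metis
    define C where "C = 2 + 2 * K"
    have C: "C > 0" using K0 by (simp add: C_def)
    have Yl: "norm (Y y' - Y y) \<le> C * norm (y' - y)" if y': "y' \<in> S" for y'
    proof -
      have n1: "norm (fst y' - fst y) \<le> norm (y' - y)" using norm_fst_le[of "fst (y' - y)" "snd (y' - y)"] unfolding prod.collapse by simp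
      have n2: "norm (snd y' - snd y) \<le> norm (y' - y)" using norm_snd_le[of "snd (y' - y)" "fst (y' - y)"] unfolding prod.collapse by simp
      have "norm (Y y' - Y y) \<le> norm (fst y' - fst y) + (norm (snd y' - snd y) + norm (\<alpha> (fst y') - \<alpha> (fst y)))"
        unfolding Y_def by (simp only: diff_Pair) (intro order_trans[OF norm_Pair_le] add_left_mono norm_Pair_le)
      also have "\<dots> \<le> norm (y' - y) + (norm (y' - y) + 2 * K * norm (y' - y))"
        using n1 n2 \<alpha>lip[OF y y'] K0 mult_left_mono[OF n1, of "2 * K"] by linarith
      finally show ?thesis by (simp add: C_def algebra_simps)
    qed
    have "norm (F y' - F y) \<le> (B * C) * norm (y' - y)" if y': "y' \<in> S \<inter> ball y (\<delta> / C)" for y'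
    proof -
      have "norm (y' - y) < \<delta> / C" using y' by (simp add: dist_norm norm_minus_commute)
      then have "C * norm (y' - y) < \<delta>" using C by (simp add: field_simps)
      then have "norm (Y y' - Y y) < \<delta>" using Yl[of y'] y' by simp
      then have "norm (F y' - F y) \<le> B * norm (Y y' - Y y)" unfolding FY by (rule B(3))
      also have "\<dots> \<le> B * (C * norm (y' - y))" using Yl[of y'] y' B(2) by (intro mult_left_mono) auto
      finally show ?thesis by simp
    qed
    then show "\<exists>T B. open T \<and> y \<in> T \<and> (\<forall>y'\<in>S \<inter> T. norm (F y' - F y) \<le> B * norm (y' - y))"
      using B(1) C by (intro exI[of _ "ball y (\<delta> / C)"] exI[of _ "B * C"]) auto
  qed simp
  moreover have "tangent_params I f G q dq (ball a0 r) \<subseteq> F ` S"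
  proof
    fix cl assume "cl \<in> tangent_params I f G q dq (ball a0 r)"
    then obtain c l a w lam where cl: "cl = (c, l)" and a: "a \<in> M" and w: "cmod w = 1"
      and e1: "dq a + l = w *s cnj_vec (\<Sum>i\<in>I. lam i *\<^sub>R G i a)" and e2: "q a + c + pairing l a = 0"
      unfolding tangent_params_def M_def by blast
    \<comment> \<open>the point with the tangential coordinates of \<open>a\<close> whose normal coordinates are the coefficients \<open>lam\<close>\<close>
    define x where "x = a + (\<Sum>i\<in>I. (lam i - G i a0 \<bullet> a) *\<^sub>R d i)"
    have dsum: "G j a0 \<bullet> (\<Sum>i\<in>I. h i *\<^sub>R d i) = h j" if j: "j \<in> I" for j h
    proof -
      have "G j a0 \<bullet> (\<Sum>i\<in>I. h i *\<^sub>R d i) = (\<Sum>i\<in>I. h i * (d i \<bullet> G j a0))" by (simp add: inner_sum_right inner_commute)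
      also have "\<dots> = (\<Sum>i\<in>I. if i = j then h i else 0)" by (rule sum.cong) (use d j in auto)
      finally show ?thesis using I j by (simp add: sum.delta)
    qed
    have gx: "G j a0 \<bullet> x = lam j" if "j \<in> I" for j
      using dsum[OF that] by (simp add: x_def inner_add_right)
    have "\<Psi> x = x - (\<Sum>i\<in>I. lam i *\<^sub>R d i)" unfolding \<Psi>_def using gx by simp
    also have "\<dots> = \<Psi> a" by (simp add: x_def \<Psi>_def scaleR_diff_left sum_subtractf)
    finally have \<Psi>x: "\<Psi> x = \<Psi> a" .
    then have S: "(x, w) \<in> S" using a w by (auto simp: S_def)
    have "norm (\<alpha> x - a) \<le> 2 * norm (\<Psi> (\<alpha> x) - \<Psi> a)" using M[OF \<alpha>(1)[OF S] a] by simp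
    then have \<alpha>x: "\<alpha> x = a" using \<alpha>(2)[OF S] \<Psi>x by simp
    have "(\<Sum>i\<in>I. (G i a0 \<bullet> x) *\<^sub>R G i a) = (\<Sum>i\<in>I. lam i *\<^sub>R G i a)" using gx by simp
    then have Ll: "L (x, w, a) = l" using e1 by (simp add: L_def algebra_simps flip: e1)
    have "c = (q a + c + pairing l a) - q a - pairing l a" by simp
    then have "c = - q a - pairing l a" unfolding e2 by simp
    then have "F (x, w) = (c, l)" by (simp add: F_def \<Theta>_def \<alpha>x Ll)
    then show "cl \<in> F ` S" using S cl by (metis imageI)
  qed
  ultimately show ?thesis using r(1) negligible_subset by blast
qed

text \<open>
  By the Lindelof property countably many of the local sets suffice.
\<close>

lemma negligible_tangent_params:
  fixes q :: "complex ^ 'n::finite \<Rightarrow> complex"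
  assumes I: "finite I" and g: "\<And>i. i \<in> I \<Longrightarrow> has_grad (f i) (G i)"
    and q: "\<And>z. q differentiable (at z)" and dq: "\<And>z. dq differentiable (at z)"
  shows "negligible (tangent_params I f G q dq UNIV)"
proof -
  define M where "M = {a. lin_ind I (\<lambda>i. G i a)}"
  have "\<forall>a\<in>M. \<exists>r>0. negligible (tangent_params I f G q dq (ball a r))"
    using negligible_tangent_params_local[where I = I and f = f and G = G and q = q and dq = dq] I g q dq
    unfolding M_def by blast
  then obtain R where R: "\<And>a. a \<in> M \<Longrightarrow> R a > 0" "\<And>a. a \<in> M \<Longrightarrow> negligible (tangent_params I f G q dq (ball a (R a)))"
    by metis
  obtain \<F> where \<F>: "\<F> \<subseteq> (\<lambda>a. ball a (R a)) ` M" "countable \<F>" "\<Union>\<F> = \<Union>((\<lambda>a. ball a (R a)) ` M)"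
    using Lindelof[of "(\<lambda>a. ball a (R a)) ` M"] by auto
  have "negligible (\<Union>(tangent_params I f G q dq ` \<F>))"
  proof (rule negligible_countable_Union)
    show "countable (tangent_params I f G q dq ` \<F>)" using \<F>(2) by simp
    show "negligible S" if "S \<in> tangent_params I f G q dq ` \<F>" for S
      using that \<F>(1) R(2) by blast
  qed
  moreover have "tangent_params I f G q dq UNIV \<subseteq> \<Union>(tangent_params I f G q dq ` \<F>)"
  proof
    fix cl assume "cl \<in> tangent_params I f G q dq UNIV"
    then obtain c l a w lam where cl: "cl = (c, l)" and a: "\<forall>i\<in>I. f i a = 0" "lin_ind I (\<lambda>i. G i a)" and w: "cmod w = 1"
      "dq a + l = w *s cnj_vec (\<Sum>i\<in>I. lam i *\<^sub>R G i a)" "q a + c + pairing l a = 0"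
      unfolding tangent_params_def by blast
    have "a \<in> \<Union>\<F>" unfolding \<F>(3) using a(2) R(1)[of a] by (auto simp: M_def)
    then obtain D where "D \<in> \<F>" "a \<in> D" by blast
    then show "cl \<in> \<Union>(tangent_params I f G q dq ` \<F>)"
      using cl a w unfolding tangent_params_def by blast
  qed
  ultimately show ?thesis by (rule negligible_subset)
qed

section \<open>Transversal domains\<close>

lemma derivative_growth:
  fixes f :: "'a::real_normed_vector \<Rightarrow> real"
  assumes f: "\<And>z. (f has_derivative D z) (at z)" and t: "0 < t"
    and D: "\<And>s. 0 \<le> s \<Longrightarrow> s \<le> t \<Longrightarrow> D (x + s *\<^sub>R \<nu>) \<nu> \<ge> k"
  shows "f (x + t *\<^sub>R \<nu>) \<ge> f x + k * t"
proof -
  have der: "((\<lambda>s. f (x + s *\<^sub>R \<nu>)) has_real_derivative D (x + s *\<^sub>R \<nu>) \<nu>) (at s)" for s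
  proof -
    have "((\<lambda>s. x + s *\<^sub>R \<nu>) has_derivative (\<lambda>h. h *\<^sub>R \<nu>)) (at s)"
      by (auto intro!: derivative_eq_intros)
    from diff_chain_at[OF this f]
    have "((\<lambda>s. f (x + s *\<^sub>R \<nu>)) has_derivative (\<lambda>h. D (x + s *\<^sub>R \<nu>) (h *\<^sub>R \<nu>))) (at s)"
      by (simp add: o_def)
    moreover have "D (x + s *\<^sub>R \<nu>) (h *\<^sub>R \<nu>) = D (x + s *\<^sub>R \<nu>) \<nu> * h" for h
      using has_derivative_bounded_linear[OF f[of "x + s *\<^sub>R \<nu>"]]
      by (simp add: bounded_linear.linear linear_cmul)
    ultimately show ?thesis by (simp add: has_field_derivative_def)
  qed
  obtain s where s: "0 < s" "s < t" "f (x + t *\<^sub>R \<nu>) - f (x + 0 *\<^sub>R \<nu>) = (t - 0) * D (x + s *\<^sub>R \<nu>) \<nu>"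
    using MVT2[OF t, of "\<lambda>s. f (x + s *\<^sub>R \<nu>)" "\<lambda>s. D (x + s *\<^sub>R \<nu>) \<nu>"] der by blast
  have "k * t \<le> D (x + s *\<^sub>R \<nu>) \<nu> * t" using D[of s] s t by (intro mult_right_mono) auto
  then show ?thesis using s(3) by (simp add: mult.commute)
qed

text \<open>
  Finitely many closed balls cover \<open>L\<close>, and paths join their centres to one base point.
\<close>

lemma compact_subset_compact_connected:
  fixes W :: "'a::euclidean_space set"
  assumes W: "open W" "connected W" and L: "compact L" "L \<subseteq> W"
  shows "\<exists>L'. compact L' \<and> connected L' \<and> L \<subseteq> L' \<and> L' \<subseteq> W"
proof (cases "L = {}")
  case False
  then obtain x0 where x0: "x0 \<in> L" by blast
  have pc: "path_connected W" using W connected_open_path_connected by blast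
  have "\<forall>x\<in>L. \<exists>r>0. cball x r \<subseteq> W" using W(1) L(2) unfolding open_contains_cball by blast
  then obtain r where r: "\<And>x. x \<in> L \<Longrightarrow> r x > 0" "\<And>x. x \<in> L \<Longrightarrow> cball x (r x) \<subseteq> W" by metis
  have "\<forall>x\<in>L. \<exists>g. path g \<and> path_image g \<subseteq> W \<and> pathstart g = x0 \<and> pathfinish g = x"
    using pc x0 L(2) unfolding path_connected_def by blast
  then obtain g where g: "\<And>x. x \<in> L \<Longrightarrow> path (g x) \<and> path_image (g x) \<subseteq> W \<and> pathstart (g x) = x0 \<and> pathfinish (g x) = x"
    by metis
  obtain F where F: "F \<subseteq> L" "finite F" "L \<subseteq> (\<Union>x\<in>F. ball x (r x))"
    by (rule compact_finite_ball_cover[OF L(1) r(1)])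
  define N where "N x = cball x (r x) \<union> path_image (g x)" for x
  have N: "compact (N x)" "connected (N x)" "N x \<subseteq> W" "x0 \<in> N x" if x: "x \<in> F" for x
  proof -
    have gx: "path (g x)" "path_image (g x) \<subseteq> W" "pathstart (g x) = x0" "pathfinish (g x) = x" using g x F(1) by blast+
    show "compact (N x)" unfolding N_def using gx(1) by (intro compact_Un compact_cball compact_path_image)
    show "connected (N x)" unfolding N_def
    proof (rule connected_Un)
      have "x \<in> cball x (r x) \<inter> path_image (g x)"
        using gx(4) r(1)[of x] x F(1) pathfinish_in_path_image[of "g x"] by auto
      then show "cball x (r x) \<inter> path_image (g x) \<noteq> {}" by blast
    qed (use gx(1) in \<open>auto intro: connected_path_image\<close>)
    show "N x \<subseteq> W" unfolding N_def using gx(2) r(2)[of x] x F(1) by blast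
    show "x0 \<in> N x" unfolding N_def using gx(3) pathstart_in_path_image[of "g x"] by auto
  qed
  define L' where "L' = (\<Union>x\<in>F. N x)"
  have "compact L'" unfolding L'_def using F(2) N(1) by (intro compact_UN) auto
  moreover have "connected L'" unfolding L'_def
  proof (rule connected_Union)
    have "x0 \<in> \<Inter>(N ` F)" using N(4) by blast
    then show "\<Inter>(N ` F) \<noteq> {}" by blast
  qed (use N(2) in auto)
  moreover have "L \<subseteq> L'"
  proof
    fix y assume "y \<in> L"
    then obtain x where "x \<in> F" "y \<in> ball x (r x)" using F(3) by blast
    then show "y \<in> L'" unfolding L'_def N_def by (auto intro!: bexI[of _ x])
  qed
  moreover have "L' \<subseteq> W" unfolding L'_def using N(3) by blast
  ultimately show ?thesis by blast
qed auto

text \<open>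
  Domains given by finitely many inequalities \<open>f i > 0\<close> whose boundary hypersurfaces meet
  transversally, as for a manifold with corners.
\<close>

locale transversal_system =
  fixes m :: nat and f :: "nat \<Rightarrow> complex ^ 'n::finite \<Rightarrow> real"
    and G :: "nat \<Rightarrow> complex ^ 'n \<Rightarrow> complex ^ 'n" and U K :: "(complex ^ 'n) set"
  assumes grad: "\<And>i. i < m \<Longrightarrow> has_grad (f i) (G i)"
    and U_def: "U = {z. \<forall>i<m. 0 < f i z}"
    and K_def: "K = {z. \<forall>i<m. 0 \<le> f i z}"
    and compact_K: "compact K"
    and indep: "\<And>a. a \<in> K \<Longrightarrow> lin_ind {i. i < m \<and> f i a = 0} (\<lambda>i. G i a)"
begin

definition act :: "complex ^ 'n \<Rightarrow> nat set" where
  "act a = {i. i < m \<and> f i a = 0}"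

lemma finite_act: "finite (act a)"
  by (simp add: act_def)

lemma U_subset_K: "U \<subseteq> K"
  unfolding U_def K_def by (auto intro: less_imp_le)

lemma open_U: "open U"
proof -
  have "U = (\<Inter>i\<in>{..<m}. f i -` {0<..})" unfolding U_def by auto
  moreover have "open (f i -` {0<..})" if "i < m" for i
    using has_grad_isCont[OF grad[OF that]] by (intro open_vimage) (auto intro: continuous_at_imp_continuous_on)
  ultimately show ?thesis by (auto intro!: open_INT)
qed

text \<open>
  By independence there is a direction with inner product 1 with all active gradients, along which all
  active inequalities become strict, while its inner products with further vectors are still free.
  The constants are uniform in the prescribed values \<open>b\<close>, because in the application to a polynomial
  these depend on the argument of its value at the moving point \<open>x\<close>.
\<close>

lemma inward_direction:
  assumes a: "a \<in> K" and J: "finite J" "act a \<subseteq> J" "lin_ind J (v a)"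
    and v: "\<And>i x. i \<in> act a \<Longrightarrow> v x i = G i x" and cont: "\<And>i. i \<in> J \<Longrightarrow> isCont (\<lambda>x. v x i) a"
  shows "\<exists>M>0. \<exists>s>0. \<exists>s'>0. s' * (1 + M) \<le> s \<and> (\<forall>x\<in>K \<inter> ball a s. act x \<subseteq> act a) \<and>
    (\<forall>b. (\<forall>j\<in>J. \<bar>b j\<bar> \<le> 1) \<and> (\<forall>i\<in>act a. b i = 1) \<longrightarrow>
      (\<exists>\<nu>. norm \<nu> \<le> M \<and> (\<forall>x\<in>ball a s. \<forall>j\<in>J. \<bar>v x j \<bullet> \<nu> - b j\<bar> \<le> 1/4) \<and>
        (\<forall>x\<in>K \<inter> ball a s'. \<forall>t. 0 \<le> t \<and> t \<le> s' \<longrightarrow> x + t *\<^sub>R \<nu> \<in> ball a s \<and> (0 < t \<longrightarrow> x + t *\<^sub>R \<nu> \<in> U))))"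
proof -
  obtain M r where M: "M > 0" "r > 0"
    and dir: "\<And>b. (\<forall>j\<in>J. \<bar>b j\<bar> \<le> 1) \<Longrightarrow> \<exists>\<nu>. norm \<nu> \<le> M \<and> (\<forall>x\<in>ball a r. \<forall>j\<in>J. \<bar>v x j \<bullet> \<nu> - b j\<bar> \<le> 1/4)"
    using lin_ind_direction[of J v a, OF J(1,3) cont] by blast
  have "\<exists>r>0. \<forall>x\<in>ball a r. 0 < f i x" if "i < m" "i \<notin> act a" for i
  proof -
    have "f i a > 0" using a that by (auto simp: K_def act_def less_le)
    moreover have "(f i \<longlongrightarrow> f i a) (at a)" using has_grad_isCont[OF grad[OF that(1)]] by (simp add: isCont_def)
    ultimately have "\<forall>\<^sub>F x in at a. f i x > 0" by (simp add: order_tendstoD)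
    then obtain r where "r > 0" "\<And>x. x \<noteq> a \<Longrightarrow> dist x a < r \<Longrightarrow> f i x > 0" unfolding eventually_at by blast
    then show ?thesis using \<open>f i a > 0\<close> by (metis dist_commute mem_ball)
  qed
  then have "\<forall>i\<in>{..<m} - act a. \<exists>r>0. \<forall>x\<in>ball a r. 0 < f i x" by blast
  then obtain R where R: "\<And>i. i < m \<Longrightarrow> i \<notin> act a \<Longrightarrow> R i > 0"
    "\<And>i x. i < m \<Longrightarrow> i \<notin> act a \<Longrightarrow> x \<in> ball a (R i) \<Longrightarrow> 0 < f i x"
    by (metis DiffI lessThan_iff)
  define s where "s = Min (insert r (R ` ({..<m} - act a)))"
  have s: "s > 0" "s \<le> r" "\<And>i. i < m \<Longrightarrow> i \<notin> act a \<Longrightarrow> s \<le> R i"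
    using M(2) R(1) by (auto simp: s_def)
  have inact: "0 < f i x" if "i < m" "i \<notin> act a" "x \<in> ball a s" for i x
    using R(2)[OF that(1,2), of x] s(3)[OF that(1,2)] that(3) by auto
  define s' where "s' = s / (1 + M)"
  have s': "s' > 0" "s' * (1 + M) \<le> s" using s(1) M(1) by (auto simp: s'_def)
  have act_sub: "\<forall>x\<in>K \<inter> ball a s. act x \<subseteq> act a"
  proof (intro ballI subsetI)
    fix x i assume "x \<in> K \<inter> ball a s" "i \<in> act x"
    then show "i \<in> act a" using inact[of i x] by (force simp: act_def)
  qed
  have "\<exists>\<nu>. norm \<nu> \<le> M \<and> (\<forall>x\<in>ball a s. \<forall>j\<in>J. \<bar>v x j \<bullet> \<nu> - b j\<bar> \<le> 1/4) \<and>
        (\<forall>x\<in>K \<inter> ball a s'. \<forall>t. 0 \<le> t \<and> t \<le> s' \<longrightarrow> x + t *\<^sub>R \<nu> \<in> ball a s \<and> (0 < t \<longrightarrow> x + t *\<^sub>R \<nu> \<in> U))"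
    if b: "\<forall>j\<in>J. \<bar>b j\<bar> \<le> 1" "\<forall>i\<in>act a. b i = 1" for b
  proof -
    obtain \<nu> where \<nu>: "norm \<nu> \<le> M" "\<And>x j. x \<in> ball a r \<Longrightarrow> j \<in> J \<Longrightarrow> \<bar>v x j \<bullet> \<nu> - b j\<bar> \<le> 1/4"
      using dir[OF b(1)] by blast
    have inb: "x + t *\<^sub>R \<nu> \<in> ball a s" if x: "x \<in> ball a s'" and t: "0 \<le> t" "t \<le> s'" for x t
    proof -
      have "dist x (x + t *\<^sub>R \<nu>) = t * norm \<nu>" using t by (simp add: dist_norm)
      also have "\<dots> \<le> s' * M" using t \<nu>(1) s'(1) by (intro mult_mono) auto
      finally have "dist a (x + t *\<^sub>R \<nu>) < s' + s' * M"
        using x dist_triangle[of a "x + t *\<^sub>R \<nu>" x] by simp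
      then show ?thesis using s'(2) by (simp add: algebra_simps)
    qed
    have "x + t *\<^sub>R \<nu> \<in> U" if x: "x \<in> K \<inter> ball a s'" and t: "0 < t" "t \<le> s'" for x t
      unfolding U_def
    proof (intro CollectI allI impI)
      fix i assume i: "i < m"
      show "0 < f i (x + t *\<^sub>R \<nu>)"
      proof (cases "i \<in> act a")
        case False
        then show ?thesis using inact[OF i] inb[of x t] x t by auto
      next
        case True
        have "f i (x + t *\<^sub>R \<nu>) \<ge> f i x + 3/4 * t"
        proof (rule derivative_growth[where D = "\<lambda>z h. G i z \<bullet> h"])
          show "(f i has_derivative (\<lambda>h. G i z \<bullet> h)) (at z)" for z
            using grad[OF i] by (simp add: has_grad_def)
          fix \<tau> assume \<tau>: "0 \<le> \<tau>" "\<tau> \<le> t"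
          have "x + \<tau> *\<^sub>R \<nu> \<in> ball a r" using inb[of x \<tau>] x t \<tau> s(2) by auto
          then have "\<bar>v (x + \<tau> *\<^sub>R \<nu>) i \<bullet> \<nu> - b i\<bar> \<le> 1/4" using \<nu>(2) True J(2) by blast
          then have "b i - 1/4 \<le> v (x + \<tau> *\<^sub>R \<nu>) i \<bullet> \<nu>" by linarith
          then show "3/4 \<le> G i (x + \<tau> *\<^sub>R \<nu>) \<bullet> \<nu>" using v[OF True] b(2) True by simp
        qed (rule t)
        moreover have "f i x \<ge> 0" using x i by (auto simp: K_def)
        ultimately show ?thesis using t by linarith
      qed
    qed
    then show ?thesis using \<nu> inb s(2) by (intro exI[of _ \<nu>]) auto
  qed
  then show ?thesis using M(1) s(1) s' act_sub by (intro exI[of _ M] conjI exI[of _ s] exI[of _ s']) auto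
qed

lemma inward_direction_simple:
  assumes a: "a \<in> K"
  shows "\<exists>s>0. \<exists>\<nu>. \<forall>x\<in>K \<inter> ball a s. \<forall>t. 0 < t \<and> t \<le> s \<longrightarrow> x + t *\<^sub>R \<nu> \<in> U"
proof -
  have li: "lin_ind (act a) (\<lambda>i. G i a)" using indep[OF a] by (simp add: act_def)
  have cont: "isCont (\<lambda>x. G i x) a" if "i \<in> act a" for i
    using has_grad_isCont_grad[OF grad, of i a] that by (simp add: act_def)
  have "\<exists>M>0. \<exists>s>0. \<exists>s'>0. s' * (1 + M) \<le> s \<and> (\<forall>x\<in>K \<inter> ball a s. act x \<subseteq> act a) \<and>
    (\<forall>b. (\<forall>j\<in>act a. \<bar>b j\<bar> \<le> 1) \<and> (\<forall>i\<in>act a. b i = 1) \<longrightarrow>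
      (\<exists>\<nu>. norm \<nu> \<le> M \<and> (\<forall>x\<in>ball a s. \<forall>j\<in>act a. \<bar>G j x \<bullet> \<nu> - b j\<bar> \<le> 1/4) \<and>
        (\<forall>x\<in>K \<inter> ball a s'. \<forall>t. 0 \<le> t \<and> t \<le> s' \<longrightarrow> x + t *\<^sub>R \<nu> \<in> ball a s \<and> (0 < t \<longrightarrow> x + t *\<^sub>R \<nu> \<in> U))))"
    by (rule inward_direction[of a "act a" "\<lambda>x i. G i x", OF a finite_act order_refl li refl]) (rule cont)
  then obtain M s s' where *: "s' > 0"
    "\<forall>b. (\<forall>j\<in>act a. \<bar>b j\<bar> \<le> 1) \<and> (\<forall>i\<in>act a. b i = 1) \<longrightarrow>
      (\<exists>\<nu>. norm \<nu> \<le> M \<and> (\<forall>x\<in>ball a s. \<forall>j\<in>act a. \<bar>G j x \<bullet> \<nu> - b j\<bar> \<le> 1/4) \<and>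
        (\<forall>x\<in>K \<inter> ball a s'. \<forall>t. 0 \<le> t \<and> t \<le> s' \<longrightarrow> x + t *\<^sub>R \<nu> \<in> ball a s \<and> (0 < t \<longrightarrow> x + t *\<^sub>R \<nu> \<in> U)))"
    by (elim exE conjE) (rule that, assumption+)
  obtain \<nu> where "\<forall>x\<in>K \<inter> ball a s'. \<forall>t. 0 \<le> t \<and> t \<le> s' \<longrightarrow> x + t *\<^sub>R \<nu> \<in> ball a s \<and> (0 < t \<longrightarrow> x + t *\<^sub>R \<nu> \<in> U)"
    using *(2)[rule_format, of "\<lambda>_. 1"] by auto
  then show ?thesis using *(1) by (intro exI[of _ s'] conjI exI[of _ \<nu>]) auto
qed

lemma K_subset_closure: "K \<subseteq> closure U"
proof
  fix a assume a: "a \<in> K"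
  obtain s \<nu> where s: "s > 0" "\<And>x t. x \<in> K \<inter> ball a s \<Longrightarrow> 0 < t \<Longrightarrow> t \<le> s \<Longrightarrow> x + t *\<^sub>R \<nu> \<in> U"
    using inward_direction_simple[OF a] by blast
  show "a \<in> closure U"
    unfolding closure_approachable
  proof (intro allI impI)
    fix e :: real assume e: "e > 0"
    define N where "N = norm \<nu> + 1"
    have N: "N > 0" "norm \<nu> \<le> N" by (auto simp: N_def add_nonneg_pos)
    define t where "t = min s (e / (2 * N))"
    have t: "t > 0" "t \<le> s" using s(1) e N by (auto simp: t_def)
    have "t * norm \<nu> \<le> e / (2 * N) * N"
      using t(1) N by (intro mult_mono) (auto simp: t_def)
    also have "\<dots> < e" using e N(1) by simp
    finally have "dist (a + t *\<^sub>R \<nu>) a < e" using t(1) by (simp add: dist_norm)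
    then show "\<exists>y\<in>U. dist y a < e" using s(2)[of a t] a t s(1) by auto
  qed
qed

lemma indep_nonzero:
  assumes "a \<in> K" "i \<in> act a"
  shows "G i a \<noteq> 0"
proof
  assume G0: "G i a = 0"
  have "lin_ind {i} (\<lambda>i. G i a)"
    by (rule lin_ind_subset[OF indep[OF assms(1)]]) (use assms(2) in \<open>auto simp: act_def\<close>)
  then have "(\<Sum>j\<in>{i}. (1::real) *\<^sub>R G j a) = 0 \<longrightarrow> (\<forall>j\<in>{i}. (1::real) = 0)"
    unfolding lin_ind_def by (rule spec[where x = "\<lambda>_. 1"])
  then show False using G0 by simp
qed

lemma negligible_boundary: "negligible (K - U)"
proof -
  have "negligible (\<Union>i\<in>{..<m}. {z. f i z = 0 \<and> G i z \<noteq> 0})"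
    using negligible_level_set[OF grad] by (intro negligible_Union) auto
  moreover have "K - U \<subseteq> (\<Union>i\<in>{..<m}. {z. f i z = 0 \<and> G i z \<noteq> 0})"
  proof
    fix z assume z: "z \<in> K - U"
    then obtain i where "i < m" "f i z = 0" unfolding K_def U_def by force
    then show "z \<in> (\<Union>i\<in>{..<m}. {z. f i z = 0 \<and> G i z \<noteq> 0})"
      using indep_nonzero[of z i] z by (auto simp: act_def)
  qed
  ultimately show ?thesis by (rule negligible_subset)
qed

end

lemma transversal_system_ball:
  assumes "r > 0"
  shows "transversal_system 1 (\<lambda>_ z. r\<^sup>2 - z \<bullet> z) (\<lambda>_ z. (-2) *\<^sub>R z) (ball 0 r) (cball 0 (r::real) :: (complex ^ 'n::finite) set)"
proof
  show "has_grad (\<lambda>z. r\<^sup>2 - z \<bullet> z) (\<lambda>z. (-2) *\<^sub>R (z :: complex ^ 'n))"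
    unfolding has_grad_def
    by (auto intro!: derivative_eq_intros bounded_linear_imp_differentiable bounded_linear_const_scaleR bounded_linear_ident simp: inner_commute)
  have *: "z \<bullet> z = (norm z)\<^sup>2" for z :: "complex ^ 'n" by (simp add: dot_square_norm)
  show "ball 0 r = {z :: complex ^ 'n. \<forall>i<(1::nat). 0 < r\<^sup>2 - z \<bullet> z}"
    using assms unfolding * by (auto simp: power_strict_mono dest: power_less_imp_less_base)
  show "cball 0 r = {z :: complex ^ 'n. \<forall>i<(1::nat). 0 \<le> r\<^sup>2 - z \<bullet> z}"
    using assms unfolding * by (auto simp: power_mono dest: power_le_imp_le_base)
  show "compact (cball (0 :: complex ^ 'n) r)" by simp
  fix a :: "complex ^ 'n"
  show "lin_ind {i. i < (1::nat) \<and> r\<^sup>2 - a \<bullet> a = 0} (\<lambda>i. (- 2) *\<^sub>R a)"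
  proof (cases "r\<^sup>2 - a \<bullet> a = 0")
    case True
    then have "a \<noteq> 0" using assms by auto
    moreover have "{i. i < (1::nat) \<and> r\<^sup>2 - a \<bullet> a = 0} = {0}" using True by auto
    ultimately show ?thesis by (simp add: lin_ind_def)
  qed (simp add: lin_ind_def)
qed

lemma polynomials_gradient:
  fixes p :: "complex ^ 'n::finite \<Rightarrow> complex"
  assumes "p \<in> polynomials"
  shows "\<exists>dp. (\<forall>z. (p has_derivative pairing (dp z)) (at z)) \<and> (\<forall>z. dp differentiable (at z))"
proof -
  obtain P where P: "\<And>j. P j \<in> polynomials" "\<And>z. (p has_derivative (\<lambda>h. \<Sum>j\<in>UNIV. P j z * h $ j)) (at z)"
    using polynomials_has_gradient[OF assms] by blast
  define dp where "dp z = (\<Sum>j\<in>UNIV. P j z *s axis j 1)" for z :: "complex ^ 'n"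
  have dpj: "dp z $ k = P k z" for z k
  proof -
    have "dp z $ k = (\<Sum>j\<in>UNIV. if j = k then P j z else 0)"
      unfolding dp_def sum_component by (rule sum.cong) (auto simp: axis_def)
    then show ?thesis by simp
  qed
  have "pairing (dp z) = (\<lambda>h. \<Sum>j\<in>UNIV. P j z * h $ j)" for z
    by (simp add: fun_eq_iff pairing_def dpj)
  moreover have "dp differentiable (at z)" for z
    unfolding dp_def
    by (intro differentiable_sum finite ballI bounded_bilinear_differentiable[OF bounded_bilinear_cmult_vec]
        polynomials_differentiable P(1) differentiable_const)
  ultimately show ?thesis using P(2) by metis
qed

lemma inner_cnj_vec: "cnj_vec l \<bullet> h = Re (pairing l h)"
  by (simp add: inner_vec_complex pairing_def)

lemma inner_cnj_vec_i: "cnj_vec ((- \<i>) *s l) \<bullet> h = Im (pairing l h)"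
  by (simp add: inner_vec_complex pairing_def flip: sum_negf)

text \<open>
  The real gradients of \<open>Re p\<close> and \<open>Im p\<close>, for a function \<open>p\<close> with complex gradient \<open>dp\<close>, are appended
  to the family \<open>G\<close> with the indices \<open>m\<close> and \<open>Suc m\<close>.
\<close>

definition grad_sys :: "nat \<Rightarrow> (nat \<Rightarrow> complex ^ 'n::finite \<Rightarrow> complex ^ 'n) \<Rightarrow> (complex ^ 'n \<Rightarrow> complex ^ 'n) \<Rightarrow>
    complex ^ 'n \<Rightarrow> nat \<Rightarrow> complex ^ 'n" where
  "grad_sys m G dp x i = (if i < m then G i x else if i = m then cnj_vec (dp x) else cnj_vec ((- \<i>) *s dp x))"

lemma differentiable_cnj_vec: "g differentiable (at z) \<Longrightarrow> (\<lambda>z. cnj_vec (g z)) differentiable (at z)"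
  using differentiable_chain_at[OF _ bounded_linear_imp_differentiable[OF bounded_linear_cnj_vec], of g z]
  by (simp add: o_def)

lemma has_grad_Re:
  assumes "\<And>z. (p has_derivative pairing (dp z)) (at z)" "\<And>z. dp differentiable (at z)"
  shows "has_grad (\<lambda>z. Re (p z)) (\<lambda>z. cnj_vec (dp z))"
  unfolding has_grad_def inner_cnj_vec
  using assms by (auto intro: differentiable_cnj_vec bounded_linear.has_derivative[OF bounded_linear_Re])

lemma has_grad_Im:
  assumes "\<And>z. (p has_derivative pairing (dp z)) (at z)" "\<And>z. dp differentiable (at z)"
  shows "has_grad (\<lambda>z. Im (p z)) (\<lambda>z. cnj_vec ((- \<i>) *s dp z))"
  unfolding has_grad_def inner_cnj_vec_i
  by (intro allI conjI bounded_linear.has_derivative[OF bounded_linear_Im assms(1)] differentiable_cnj_vec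
      bounded_bilinear_differentiable[OF bounded_bilinear_cmult_vec] differentiable_const assms(2))

lemma has_grad_norm_square:
  assumes p: "\<And>z. (p has_derivative pairing (dp z)) (at z)" "\<And>z. dp differentiable (at z)"
  shows "has_grad (\<lambda>z. (cmod (p z))\<^sup>2 - e) (\<lambda>z. (2 * Re (p z)) *\<^sub>R cnj_vec (dp z) + (2 * Im (p z)) *\<^sub>R cnj_vec ((- \<i>) *s dp z))"
proof -
  note re = has_grad_Re[of p dp, OF p] and im = has_grad_Im[of p dp, OF p]
  have re': "((\<lambda>z. Re (p z)) has_derivative (\<lambda>h. cnj_vec (dp z) \<bullet> h)) (at z)"
    and im': "((\<lambda>z. Im (p z)) has_derivative (\<lambda>h. cnj_vec ((- \<i>) *s dp z) \<bullet> h)) (at z)" for z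
    using re im by (auto simp: has_grad_def)
  have dre: "(\<lambda>z. Re (p z)) differentiable (at z)" and dim: "(\<lambda>z. Im (p z)) differentiable (at z)" for z
    using re' im' unfolding differentiable_def by blast+
  have sq: "(\<lambda>z. (cmod (p z))\<^sup>2 - e) = (\<lambda>z. Re (p z) * Re (p z) + Im (p z) * Im (p z) - e)"
    by (simp add: cmod_power2 flip: power2_eq_square)
  show ?thesis
    unfolding has_grad_def
  proof (intro allI conjI)
    fix z
    show "((\<lambda>z. (cmod (p z))\<^sup>2 - e) has_derivative
        (\<lambda>h. ((2 * Re (p z)) *\<^sub>R cnj_vec (dp z) + (2 * Im (p z)) *\<^sub>R cnj_vec ((- \<i>) *s dp z)) \<bullet> h)) (at z)"
      unfolding sq by (rule has_derivative_eq_rhs, (rule derivative_intros re' im')+) (simp add: fun_eq_iff inner_add_left)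
    show "(\<lambda>z. (2 * Re (p z)) *\<^sub>R cnj_vec (dp z) + (2 * Im (p z)) *\<^sub>R cnj_vec ((- \<i>) *s dp z)) differentiable (at z)"
      using re im unfolding has_grad_def
      by (intro differentiable_add differentiable_scaleR differentiable_mult differentiable_const dre dim) auto
  qed
qed

context transversal_system
begin

text \<open>
  In real terms: at each of its points the zero set of \<open>p\<close> is smooth of codimension two and transversal
  to the face of \<open>K\<close> that contains the point.
\<close>

definition transversal_to :: "(complex ^ 'n \<Rightarrow> complex) \<Rightarrow> (complex ^ 'n \<Rightarrow> complex ^ 'n) \<Rightarrow> bool" where
  "transversal_to p dp \<longleftrightarrow> (\<forall>a\<in>K. p a = 0 \<longrightarrow> lin_ind (act a \<union> {m, Suc m}) (grad_sys m G dp a))"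

text \<open>
  Almost every affine perturbation of a polynomial is transversal: a linear relation among the
  gradients at a zero puts the perturbation into one of the finitely many negligible sets of tangent
  parameters.
\<close>

lemma transversal_perturbation:
  assumes q: "\<And>z. (q has_derivative pairing (dq z)) (at z)" "\<And>z. dq differentiable (at z)" and \<tau>: "\<tau> > 0"
  shows "\<exists>c l. cmod c < \<tau> \<and> norm l < \<tau> \<and> transversal_to (\<lambda>z. q z + c + pairing l z) (\<lambda>z. dq z + l)"
proof -
  define B where "B = (\<Union>I\<in>Pow {..<m}. tangent_params I f G q dq UNIV)"
  have qd: "q differentiable (at z)" for z using q(1) unfolding differentiable_def by blast
  have "negligible B"
    unfolding B_def
  proof (rule negligible_Union)
    fix T assume "T \<in> (\<lambda>I. tangent_params I f G q dq UNIV) ` Pow {..<m}"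
    then obtain I where I: "I \<subseteq> {..<m}" "T = tangent_params I f G q dq UNIV" by blast
    show "negligible T" unfolding I(2)
      by (rule negligible_tangent_params) (use I(1) grad qd q(2) finite_subset[OF I(1) finite_lessThan] in auto)
  qed auto
  moreover have "\<not> negligible (ball (0 :: complex \<times> (complex ^ 'n)) \<tau>)"
    using \<tau> open_not_negligible[of "ball (0 :: complex \<times> (complex ^ 'n)) \<tau>"] by auto
  ultimately obtain c l where cl: "(c, l) \<in> ball 0 \<tau>" "(c, l) \<notin> B"
    using negligible_subset by (metis subsetI surj_pair)
  have n: "cmod c < \<tau>" "norm l < \<tau>"
    using cl(1) norm_fst_le[of c l] norm_snd_le[of l c] by auto
  have "lin_ind (act a \<union> {m, Suc m}) (grad_sys m G (\<lambda>z. dq z + l) a)"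
    if a: "a \<in> K" "q a + c + pairing l a = 0" for a
  proof (rule ccontr)
    define v where "v = grad_sys m G (\<lambda>z. dq z + l) a"
    assume "\<not> lin_ind (act a \<union> {m, Suc m}) (grad_sys m G (\<lambda>z. dq z + l) a)"
    then obtain e k where e: "(\<Sum>i\<in>act a \<union> {m, Suc m}. e i *\<^sub>R v i) = 0" "k \<in> act a \<union> {m, Suc m}" "e k \<noteq> 0"
      unfolding lin_ind_def v_def by blast
    define S where "S = (\<Sum>i\<in>act a. e i *\<^sub>R G i a)"
    define g where "g = dq a + l"
    have act_m: "\<And>i. i \<in> act a \<Longrightarrow> i < m" by (simp add: act_def)
    have "(\<Sum>i\<in>act a \<union> {m, Suc m}. e i *\<^sub>R v i) = (\<Sum>i\<in>act a. e i *\<^sub>R v i) + (e m *\<^sub>R v m + e (Suc m) *\<^sub>R v (Suc m))"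
      using finite_act by (subst sum.union_disjoint) (auto simp: act_def)
    moreover have "(\<Sum>i\<in>act a. e i *\<^sub>R v i) = S"
      unfolding S_def by (rule sum.cong) (use act_m in \<open>auto simp: v_def grad_sys_def\<close>)
    ultimately have rel: "S + (e m *\<^sub>R cnj_vec g + e (Suc m) *\<^sub>R cnj_vec ((- \<i>) *s g)) = 0"
      using e(1) by (simp add: v_def grad_sys_def g_def)
    define W where "W = Complex (e m) (e (Suc m))"
    have W: "e m *\<^sub>R cnj_vec g + e (Suc m) *\<^sub>R cnj_vec ((- \<i>) *s g) = W *s cnj_vec g"
      by (simp add: vec_eq_iff W_def complex_eq_iff)
    have W0: "W \<noteq> 0"
    proof
      assume W0: "W = 0"
      then have "S = 0" using rel W by simp
      then have "\<forall>i\<in>act a. e i = 0" using indep[OF a(1)] unfolding lin_ind_def S_def act_def by blast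
      then show False using e(2,3) W0 by (auto simp: W_def complex_eq_iff)
    qed
    have Wg: "W *s cnj_vec g = - S" using rel W by (simp add: eq_neg_iff_add_eq_0 add.commute)
    have "cnj W *s g = cnj_vec (W *s cnj_vec g)" by (simp add: vec_eq_iff)
    then have "cnj W *s g = cnj_vec (- S)" using Wg by simp
    then have gj: "cnj W * g $ j = cnj ((- S) $ j)" for j by (simp add: vec_eq_iff)
    \<comment> \<open>dividing the relation by \<open>cmod W\<close> leaves a unimodular factor\<close>
    define w where "w = of_real (cmod W) / cnj W"
    define lam where "lam i = - e i / cmod W" for i
    have Sl: "(\<Sum>i\<in>act a. lam i *\<^sub>R G i a) = (1 / cmod W) *\<^sub>R (- S)"
      unfolding S_def lam_def by (simp add: scaleR_sum_right sum_negf)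
    have "g = w *s cnj_vec (\<Sum>i\<in>act a. lam i *\<^sub>R G i a)"
      unfolding vec_eq_iff
    proof
      fix j
      have "g $ j = cnj ((- S) $ j) / cnj W" using gj[of j] W0 by (simp add: field_simps)
      then show "g $ j = (w *s cnj_vec (\<Sum>i\<in>act a. lam i *\<^sub>R G i a)) $ j"
        unfolding Sl vector_smult_component cnj_vec_nth vector_scaleR_component
        using W0 by (simp add: w_def scaleR_conv_of_real)
    qed
    moreover have "cmod w = 1" using W0 by (simp add: w_def norm_divide)
    moreover have "\<forall>i\<in>act a. f i a = 0" by (simp add: act_def)
    moreover have "lin_ind (act a) (\<lambda>i. G i a)" using indep[OF a(1)] by (simp add: act_def)
    ultimately have "(c, l) \<in> tangent_params (act a) f G q dq UNIV"
      using a(2) unfolding tangent_params_def g_def by blast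
    moreover have "act a \<in> Pow {..<m}" using act_m by auto
    ultimately show False using cl(2) unfolding B_def by blast
  qed
  then show ?thesis using n unfolding transversal_to_def by blast
qed

lemma transversal_to_nonzero:
  assumes T: "transversal_to p dp" and a: "a \<in> K" "p a = 0"
  shows "cnj_vec (dp a) \<noteq> 0"
proof
  assume z: "cnj_vec (dp a) = 0"
  have "lin_ind {m} (grad_sys m G dp a)"
    by (rule lin_ind_subset[of "act a \<union> {m, Suc m}"]) (use T a finite_act in \<open>auto simp: transversal_to_def\<close>)
  then have "(\<Sum>j\<in>{m}. (1::real) *\<^sub>R grad_sys m G dp a j) = 0 \<longrightarrow> (\<forall>j\<in>{m}. (1::real) = 0)"
    unfolding lin_ind_def by (rule spec[where x = "\<lambda>_. 1"])
  then show False using z by (simp add: grad_sys_def)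
qed

lemma negligible_transversal_zeros:
  assumes p: "\<And>z. (p has_derivative pairing (dp z)) (at z)" "\<And>z. dp differentiable (at z)"
    and T: "transversal_to p dp"
  shows "negligible (K \<inter> {z. p z = 0})"
  by (rule negligible_subset[OF negligible_level_set[OF has_grad_Re[of p dp, OF p]]])
     (use transversal_to_nonzero[OF T] in auto)

text \<open>
  Near a zero of \<open>p\<close> one can move inside \<open>U\<close> so that \<open>cmod (p x)\<close> grows at a definite rate.  In
  particular \<open>cmod p\<close> has no small non-zero local maxima on \<open>K\<close>, which is what prevents the set
  \<open>cmod (p z) > e\<close> from having components near the boundary of \<open>U\<close>.
\<close>

lemma growth_near_zeros:
  assumes p: "\<And>z. (p has_derivative pairing (dp z)) (at z)" "\<And>z. dp differentiable (at z)"
    and T: "transversal_to p dp" and a: "a \<in> K" "p a = 0"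
  shows "\<exists>r>0. (\<forall>x\<in>K \<inter> ball a r. lin_ind (act x \<union> {m, Suc m}) (grad_sys m G dp x)) \<and>
    (\<forall>x\<in>K \<inter> ball a r. p x \<noteq> 0 \<longrightarrow> (\<exists>\<nu>. \<forall>t. 0 < t \<and> t \<le> r \<longrightarrow> x + t *\<^sub>R \<nu> \<in> U \<and> cmod (p (x + t *\<^sub>R \<nu>)) \<ge> cmod (p x) + t / 2))"
proof -
  define v where "v = grad_sys m G dp"
  define J where "J = act a \<union> {m, Suc m}"
  have J: "finite J" "act a \<subseteq> J" "lin_ind J (v a)"
    using T a finite_act by (auto simp: J_def v_def transversal_to_def)
  have vact: "v x i = G i x" if "i \<in> act a" for i x using that by (simp add: v_def grad_sys_def act_def)
  have cont: "isCont (\<lambda>x. v x i) a" if i: "i \<in> J" for i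
  proof -
    consider "i \<in> act a" | "i = m" | "i = Suc m" using i by (auto simp: J_def)
    then show ?thesis
    proof cases
      case 1
      then show ?thesis using has_grad_isCont_grad[OF grad, of i a] vact[OF 1] by (simp add: act_def)
    next
      case 2
      then show ?thesis using has_grad_isCont_grad[OF has_grad_Re[of p dp, OF p], of a] by (simp add: v_def grad_sys_def)
    next
      case 3
      then show ?thesis using has_grad_isCont_grad[OF has_grad_Im[of p dp, OF p], of a] by (simp add: v_def grad_sys_def)
    qed
  qed
  have near: "\<exists>r>0. \<forall>x\<in>ball a r. lin_ind J (v x)" by (rule lin_ind_near[where v = v and a = a, OF J(1,3)]) (rule cont)
  then obtain r0 where r0: "r0 > 0" "\<And>x. x \<in> ball a r0 \<Longrightarrow> lin_ind J (v x)" by blast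
  have "\<exists>M>0. \<exists>s>0. \<exists>s'>0. s' * (1 + M) \<le> s \<and> (\<forall>x\<in>K \<inter> ball a s. act x \<subseteq> act a) \<and>
    (\<forall>b. (\<forall>j\<in>J. \<bar>b j\<bar> \<le> 1) \<and> (\<forall>i\<in>act a. b i = 1) \<longrightarrow>
      (\<exists>\<nu>. norm \<nu> \<le> M \<and> (\<forall>x\<in>ball a s. \<forall>j\<in>J. \<bar>v x j \<bullet> \<nu> - b j\<bar> \<le> 1/4) \<and>
        (\<forall>x\<in>K \<inter> ball a s'. \<forall>t. 0 \<le> t \<and> t \<le> s' \<longrightarrow> x + t *\<^sub>R \<nu> \<in> ball a s \<and> (0 < t \<longrightarrow> x + t *\<^sub>R \<nu> \<in> U))))"
    by (rule inward_direction[OF a(1) J vact]) (simp, rule cont)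
  then obtain M s s' where s: "M > 0" "s > 0" "s' > 0" "s' * (1 + M) \<le> s" "\<forall>x\<in>K \<inter> ball a s. act x \<subseteq> act a"
    and dir: "\<forall>b. (\<forall>j\<in>J. \<bar>b j\<bar> \<le> 1) \<and> (\<forall>i\<in>act a. b i = 1) \<longrightarrow>
      (\<exists>\<nu>. norm \<nu> \<le> M \<and> (\<forall>x\<in>ball a s. \<forall>j\<in>J. \<bar>v x j \<bullet> \<nu> - b j\<bar> \<le> 1/4) \<and>
        (\<forall>x\<in>K \<inter> ball a s'. \<forall>t. 0 \<le> t \<and> t \<le> s' \<longrightarrow> x + t *\<^sub>R \<nu> \<in> ball a s \<and> (0 < t \<longrightarrow> x + t *\<^sub>R \<nu> \<in> U)))"
    by (elim exE conjE) (rule that, assumption+)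
  define r where "r = min (min r0 s) s'"
  have r: "r > 0" "r \<le> r0" "r \<le> s" "r \<le> s'" using r0(1) s by (auto simp: r_def)
  have "lin_ind (act x \<union> {m, Suc m}) (v x)" if x: "x \<in> K \<inter> ball a r" for x
  proof (rule lin_ind_subset[OF r0(2) _ J(1)])
    show "x \<in> ball a r0" using x r by auto
    show "act x \<union> {m, Suc m} \<subseteq> J" using s(5) x r(3) by (force simp: J_def)
  qed
  moreover have "\<exists>\<nu>. \<forall>t. 0 < t \<and> t \<le> r \<longrightarrow> x + t *\<^sub>R \<nu> \<in> U \<and> cmod (p (x + t *\<^sub>R \<nu>)) \<ge> cmod (p x) + t / 2"
    if x: "x \<in> K \<inter> ball a r" "p x \<noteq> 0" for x
  proof -
    \<comment> \<open>\<open>u\<close> turns \<open>p x\<close> to the positive axis, and \<open>b\<close> is chosen so that \<open>Re (u * p)\<close> grows at least at the rate 1/2\<close>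
    define u where "u = cnj (p x) / of_real (cmod (p x))"
    have u1: "cmod u = 1" using x(2) by (simp add: u_def norm_divide)
    have upx: "u * p x = of_real (cmod (p x))"
      using x(2) by (simp add: u_def complex_norm_square[symmetric] power2_eq_square mult.commute[of "cnj _"])
    define b where "b i = (if i < m then 1 else if i = m then Re u else - Im u)" for i
    have "(\<forall>j\<in>J. \<bar>b j\<bar> \<le> 1) \<and> (\<forall>i\<in>act a. b i = 1)"
      using abs_Re_le_cmod[of u] abs_Im_le_cmod[of u] u1 by (auto simp: b_def act_def)
    then obtain \<nu> where \<nu>: "\<forall>y\<in>ball a s. \<forall>j\<in>J. \<bar>v y j \<bullet> \<nu> - b j\<bar> \<le> 1/4"
      "\<forall>x\<in>K \<inter> ball a s'. \<forall>t. 0 \<le> t \<and> t \<le> s' \<longrightarrow> x + t *\<^sub>R \<nu> \<in> ball a s \<and> (0 < t \<longrightarrow> x + t *\<^sub>R \<nu> \<in> U)"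
      using dir by blast
    have grow: "cmod (p (x + t *\<^sub>R \<nu>)) \<ge> cmod (p x) + t / 2" if t: "0 < t" "t \<le> r" for t
    proof -
      have "Re (u * p (x + t *\<^sub>R \<nu>)) \<ge> Re (u * p x) + 1/2 * t"
      proof (rule derivative_growth[where D = "\<lambda>z h. Re (u * pairing (dp z) h)"])
        show "((\<lambda>z. Re (u * p z)) has_derivative (\<lambda>h. Re (u * pairing (dp z) h))) (at z)" for z
          by (intro bounded_linear.has_derivative[OF bounded_linear_Re] has_derivative_mult_right p)
        fix \<tau> assume \<tau>: "0 \<le> \<tau>" "\<tau> \<le> t"
        define y where "y = x + \<tau> *\<^sub>R \<nu>"
        have "x \<in> K \<inter> ball a s'" "\<tau> \<le> s'" using x r(4) \<tau> t by auto
        then have "y \<in> ball a s" using \<nu>(2) \<tau>(1) unfolding y_def by blast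
        then have "\<bar>v y m \<bullet> \<nu> - b m\<bar> \<le> 1/4" "\<bar>v y (Suc m) \<bullet> \<nu> - b (Suc m)\<bar> \<le> 1/4"
          using \<nu>(1) by (auto simp: J_def)
        moreover have vb: "v y m = cnj_vec (dp y)" "v y (Suc m) = cnj_vec ((- \<i>) *s dp y)"
          "b m = Re u" "b (Suc m) = - Im u"
          unfolding v_def grad_sys_def b_def by simp_all
        ultimately have A: "\<bar>Re (pairing (dp y) \<nu>) - Re u\<bar> \<le> 1/4" "\<bar>Im (pairing (dp y) \<nu>) + Im u\<bar> \<le> 1/4"
          unfolding vb unfolding inner_cnj_vec_i unfolding inner_cnj_vec by simp_all
        define A1 where "A1 = Re (pairing (dp y) \<nu>) - Re u"
        define A2 where "A2 = Im (pairing (dp y) \<nu>) + Im u"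
        have u2: "(Re u)\<^sup>2 + (Im u)\<^sup>2 = 1" using u1 cmod_power2[of u] by simp
        have "Re (u * pairing (dp y) \<nu>) = (Re u)\<^sup>2 + (Im u)\<^sup>2 + Re u * A1 - Im u * A2"
          by (simp add: A1_def A2_def algebra_simps power2_eq_square)
        moreover have "\<bar>Re u * A1\<bar> \<le> 1 * (1/4)" unfolding abs_mult
          using A(1) abs_Re_le_cmod[of u] u1 by (intro mult_mono) (auto simp: A1_def)
        moreover have "\<bar>Im u * A2\<bar> \<le> 1 * (1/4)" unfolding abs_mult
          using A(2) abs_Im_le_cmod[of u] u1 by (intro mult_mono) (auto simp: A2_def)
        ultimately show "1/2 \<le> Re (u * pairing (dp (x + \<tau> *\<^sub>R \<nu>)) \<nu>)"
          unfolding y_def[symmetric] using u2 by linarith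
      qed (rule t)
      moreover have "Re (u * p (x + t *\<^sub>R \<nu>)) \<le> cmod (p (x + t *\<^sub>R \<nu>))"
        using complex_Re_le_cmod[of "u * p (x + t *\<^sub>R \<nu>)"] by (simp add: norm_mult u1)
      ultimately show ?thesis using upx by simp
    qed
    have "x + t *\<^sub>R \<nu> \<in> U" if "0 < t" "t \<le> r" for t using \<nu>(2) x(1) r(4) that by auto
    then show ?thesis using grow by blast
  qed
  ultimately show ?thesis using r(1) unfolding v_def by blast
qed

text \<open>
  The zero set in \<open>K\<close> is compact, so that finitely many of the local statements suffice.
\<close>

lemma growth_uniform:
  assumes p: "\<And>z. (p has_derivative pairing (dp z)) (at z)" "\<And>z. dp differentiable (at z)"
    and T: "transversal_to p dp"
  shows "\<exists>\<eta>>0. \<exists>r>0. \<forall>x\<in>K. cmod (p x) < \<eta> \<longrightarrow> lin_ind (act x \<union> {m, Suc m}) (grad_sys m G dp x) \<and>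
    (p x \<noteq> 0 \<longrightarrow> (\<exists>\<nu>. \<forall>t. 0 < t \<and> t \<le> r \<longrightarrow> x + t *\<^sub>R \<nu> \<in> U \<and> cmod (p (x + t *\<^sub>R \<nu>)) \<ge> cmod (p x) + t / 2))"
proof -
  have contp: "continuous_on A p" for A
    using p(1) by (meson continuous_at_imp_continuous_on has_derivative_continuous)
  define Z where "Z = K \<inter> p -` {0}"
  have "closed Z" unfolding Z_def
    using compact_K contp by (intro continuous_closed_preimage compact_imp_closed) auto
  then have Z: "compact Z" using compact_K unfolding Z_def by (metis Int_lower1 bounded_subset compact_eq_bounded_closed)
  define good where "good a r \<longleftrightarrow> (\<forall>x\<in>K \<inter> ball a r. lin_ind (act x \<union> {m, Suc m}) (grad_sys m G dp x)) \<and>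
    (\<forall>x\<in>K \<inter> ball a r. p x \<noteq> 0 \<longrightarrow> (\<exists>\<nu>. \<forall>t. 0 < t \<and> t \<le> r \<longrightarrow> x + t *\<^sub>R \<nu> \<in> U \<and> cmod (p (x + t *\<^sub>R \<nu>)) \<ge> cmod (p x) + t / 2))" for a r
  have "\<forall>a\<in>Z. \<exists>r>0. good a r"
  proof
    fix a assume "a \<in> Z"
    then have "a \<in> K" "p a = 0" by (auto simp: Z_def)
    then show "\<exists>r>0. good a r" unfolding good_def by (rule growth_near_zeros[OF p T])
  qed
  then obtain R where R: "\<And>a. a \<in> Z \<Longrightarrow> R a > 0" "\<And>a. a \<in> Z \<Longrightarrow> good a (R a)" by metis
  obtain F where F: "F \<subseteq> Z" "finite F" "Z \<subseteq> (\<Union>a\<in>F. ball a (R a))"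
    by (rule compact_finite_ball_cover[OF Z R(1)])
  define W where "W = (\<Union>a\<in>F. ball a (R a))"
  have "compact (K - W)" using compact_K by (intro compact_diff) (auto simp: W_def)
  have "\<exists>\<eta>>0. \<forall>x\<in>K - W. \<eta> \<le> cmod (p x)"
  proof (cases "K - W = {}")
    case False
    obtain c where c: "c \<in> K - W" "\<And>x. x \<in> K - W \<Longrightarrow> cmod (p c) \<le> cmod (p x)"
      using continuous_attains_inf[OF \<open>compact (K - W)\<close> False, of "\<lambda>x. cmod (p x)"] contp
      by (auto intro: continuous_on_norm)
    have "p c \<noteq> 0" using c(1) F(3) by (auto simp: W_def Z_def)
    then show ?thesis using c(2) by (intro exI[of _ "cmod (p c)"]) auto
  qed (auto intro: exI[of _ 1])
  then obtain \<eta> where \<eta>: "\<eta> > 0" "\<And>x. x \<in> K - W \<Longrightarrow> \<eta> \<le> cmod (p x)" by blast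
  define r where "r = Min (insert 1 (R ` F))"
  have r: "r > 0" "\<And>a. a \<in> F \<Longrightarrow> r \<le> R a" using F R(1) by (auto simp: r_def)
  have "lin_ind (act x \<union> {m, Suc m}) (grad_sys m G dp x) \<and>
    (p x \<noteq> 0 \<longrightarrow> (\<exists>\<nu>. \<forall>t. 0 < t \<and> t \<le> r \<longrightarrow> x + t *\<^sub>R \<nu> \<in> U \<and> cmod (p (x + t *\<^sub>R \<nu>)) \<ge> cmod (p x) + t / 2))"
    if x: "x \<in> K" "cmod (p x) < \<eta>" for x
  proof -
    have "x \<in> W" using \<eta>(2)[of x] x by force
    then obtain a where a: "a \<in> F" "x \<in> ball a (R a)" by (auto simp: W_def)
    have g: "good a (R a)" using R(2) a(1) F(1) by blast
    have "\<exists>\<nu>. \<forall>t. 0 < t \<and> t \<le> r \<longrightarrow> x + t *\<^sub>R \<nu> \<in> U \<and> cmod (p (x + t *\<^sub>R \<nu>)) \<ge> cmod (p x) + t / 2" if "p x \<noteq> 0"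
    proof -
      obtain \<nu> where "\<forall>t. 0 < t \<and> t \<le> R a \<longrightarrow> x + t *\<^sub>R \<nu> \<in> U \<and> cmod (p (x + t *\<^sub>R \<nu>)) \<ge> cmod (p x) + t / 2"
        using g x a(2) \<open>p x \<noteq> 0\<close> unfolding good_def by blast
      then show ?thesis using r(2)[OF a(1)] by (intro exI[of _ \<nu>]) auto
    qed
    then show ?thesis using g x(1) a(2) unfolding good_def by blast
  qed
  then show ?thesis using \<eta>(1) r(1) by blast
qed

end

text \<open>
  The number of inequalities grows with every tube that is removed; afterwards it only matters that
  there is a transversal system.
\<close>

definition tame :: "(complex ^ 'n::finite) set \<Rightarrow> (complex ^ 'n) set \<Rightarrow> bool" where
  "tame U K \<longleftrightarrow> connected U \<and> U \<noteq> {} \<and> (\<exists>m f G. transversal_system m f G U K)"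

lemma tame_facts:
  assumes "tame U K"
  shows "open U" "connected U" "U \<noteq> {}" "compact K" "U \<subseteq> K" "K \<subseteq> closure U" "negligible (K - U)"
proof -
  obtain m f G where "transversal_system m f G U K" using assms unfolding tame_def by blast
  then interpret transversal_system m f G U K .
  show "open U" "connected U" "U \<noteq> {}" "compact K" "U \<subseteq> K" "K \<subseteq> closure U" "negligible (K - U)"
    using assms open_U compact_K U_subset_K K_subset_closure negligible_boundary unfolding tame_def by blast+
qed

lemma tame_ball:
  assumes "r > 0"
  shows "tame (ball 0 r) (cball 0 r :: (complex ^ 'n::finite) set)"
  unfolding tame_def using transversal_system_ball[OF assms] assms by auto

context transversal_system
begin

text \<open>Thin tubes keep the system transversal: near the zeros of \<open>p\<close> the gradient of
  \<open>(cmod p)\<^sup>2\<close> is a non-trivial combination of the gradients of \<open>Re p\<close> and \<open>Im p\<close>.\<close>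

lemma transversal_system_remove_tube:
  assumes p: "\<And>z. (p has_derivative pairing (dp z)) (at z)" "\<And>z. dp differentiable (at z)"
    and e: "0 < e" "e < \<eta>"
    and li: "\<And>x. x \<in> K \<Longrightarrow> cmod (p x) < \<eta> \<Longrightarrow> lin_ind (act x \<union> {m, Suc m}) (grad_sys m G dp x)"
  shows "\<exists>m f G. transversal_system m f G (U \<inter> {z. e < cmod (p z)}) (K \<inter> {z. e \<le> cmod (p z)})"
proof (intro exI)
  define f' where "f' i = (if i < m then f i else (\<lambda>z. (cmod (p z))\<^sup>2 - e\<^sup>2))" for i
  define G' where "G' i = (if i < m then G i else (\<lambda>z. (2 * Re (p z)) *\<^sub>R cnj_vec (dp z) + (2 * Im (p z)) *\<^sub>R cnj_vec ((- \<i>) *s dp z)))" for i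
  have contp: "continuous_on A p" for A
    using p(1) by (meson continuous_at_imp_continuous_on has_derivative_continuous)
  show "transversal_system (Suc m) f' G' (U \<inter> {z. e < cmod (p z)}) (K \<inter> {z. e \<le> cmod (p z)})"
  proof
    show "has_grad (f' i) (G' i)" if "i < Suc m" for i
      using grad[of i] has_grad_norm_square[of p dp, OF p] that by (auto simp: f'_def G'_def)
    have lt: "e < cmod w \<longleftrightarrow> 0 < (cmod w)\<^sup>2 - e\<^sup>2" for w
      using e(1) by (auto simp: power_strict_mono dest: power_less_imp_less_base)
    have le: "e \<le> cmod w \<longleftrightarrow> 0 \<le> (cmod w)\<^sup>2 - e\<^sup>2" for w
      using e(1) by (auto simp: power_mono dest: power_le_imp_le_base)
    show "U \<inter> {z. e < cmod (p z)} = {z. \<forall>i<Suc m. 0 < f' i z}"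
      unfolding U_def lt by (auto simp: f'_def less_Suc_eq)
    show "K \<inter> {z. e \<le> cmod (p z)} = {z. \<forall>i<Suc m. 0 \<le> f' i z}"
      unfolding K_def le by (auto simp: f'_def less_Suc_eq)
    have "closed (p -` {w. e \<le> cmod w})"
      by (intro closed_vimage contp closed_Collect_le continuous_intros)
    then show "compact (K \<inter> {z. e \<le> cmod (p z)})"
      using compact_K by (simp add: compact_Int_closed vimage_def)
    fix a assume a: "a \<in> K \<inter> {z. e \<le> cmod (p z)}"
    have sub: "{i. i < Suc m \<and> f' i a = 0} \<subseteq> act a \<union> {m}" by (auto simp: f'_def act_def less_Suc_eq)
    show "lin_ind {i. i < Suc m \<and> f' i a = 0} (\<lambda>i. G' i a)"
    proof (cases "cmod (p a) = e")
      case False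
      then have sub: "{i. i < Suc m \<and> f' i a = 0} = act a"
        using e(1) by (auto simp: f'_def act_def less_Suc_eq power2_eq_iff_nonneg)
      have "lin_ind (act a) (\<lambda>i. G i a)" using indep a by (auto simp: act_def)
      moreover have "(\<Sum>i\<in>act a. c i *\<^sub>R G' i a) = (\<Sum>i\<in>act a. c i *\<^sub>R G i a)" for c
        by (rule sum.cong) (auto simp: G'_def act_def)
      ultimately show ?thesis unfolding sub lin_ind_def by simp
    next
      case True
      have "lin_ind (act a \<union> {m}) (\<lambda>i. G' i a)"
        unfolding lin_ind_def
      proof (intro allI impI)
        fix c assume c: "(\<Sum>i\<in>act a \<union> {m}. c i *\<^sub>R G' i a) = 0"
        define v where "v = grad_sys m G dp a"
        have L: "lin_ind (act a \<union> {m, Suc m}) v" unfolding v_def using li[of a] a True e(2) by auto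
        define d where "d i = (if i < m then c i else if i = m then 2 * Re (p a) * c m else 2 * Im (p a) * c m)" for i
        have m: "m \<notin> act a" "Suc m \<notin> act a" by (auto simp: act_def)
        have s: "(\<Sum>i\<in>act a. d i *\<^sub>R v i) = (\<Sum>i\<in>act a. c i *\<^sub>R G' i a)"
          by (rule sum.cong) (auto simp: act_def d_def v_def grad_sys_def G'_def)
        have "(\<Sum>i\<in>act a \<union> {m, Suc m}. d i *\<^sub>R v i) = (\<Sum>i\<in>act a. d i *\<^sub>R v i) + (d m *\<^sub>R v m + d (Suc m) *\<^sub>R v (Suc m))"
          using m finite_act by (subst sum.union_disjoint) auto
        also have "\<dots> = (\<Sum>i\<in>act a. c i *\<^sub>R G' i a) + c m *\<^sub>R G' m a"
          unfolding s by (simp add: d_def v_def grad_sys_def G'_def scaleR_add_right mult.commute)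
        also have "\<dots> = (\<Sum>i\<in>act a \<union> {m}. c i *\<^sub>R G' i a)"
          using m finite_act by (subst sum.union_disjoint) auto
        finally have s0: "(\<Sum>i\<in>act a \<union> {m, Suc m}. d i *\<^sub>R v i) = 0" using c by simp
        have d0: "\<forall>i\<in>act a \<union> {m, Suc m}. d i = 0"
          using L[unfolded lin_ind_def, THEN spec, THEN mp, OF s0] .
        then have "c i = 0" if "i \<in> act a" for i using that by (auto simp: d_def act_def)
        moreover have "p a \<noteq> 0" using True e(1) by auto
        then have "c m = 0" using d0 by (auto simp: d_def complex_eq_iff)
        ultimately show "\<forall>i\<in>act a \<union> {m}. c i = 0" by blast
      qed
      then show ?thesis by (rule lin_ind_subset[OF _ sub]) (simp add: finite_act)
    qed
  qed
qed

text \<open>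
  The part of \<open>U\<close> where \<open>cmod p\<close> is not small can be moved along inward segments into a compact subset
  of \<open>U\<close> off the zeros; this lies in a compact connected subset of the connected set of points of \<open>U\<close>
  with \<open>p z \<noteq> 0\<close>.  Every other point climbs to such a point along segments on which \<open>cmod p\<close> grows.
\<close>

lemma connected_remove_tube:
  assumes conU: "connected U" "U \<noteq> {}" and pp: "p \<in> polynomials" "p w \<noteq> 0"
    and \<eta>: "\<eta> > 0" "r > 0"
    and grow: "\<And>x. x \<in> K \<Longrightarrow> cmod (p x) < \<eta> \<Longrightarrow> p x \<noteq> 0 \<Longrightarrow>
      \<exists>\<nu>. \<forall>t. 0 < t \<and> t \<le> r \<longrightarrow> x + t *\<^sub>R \<nu> \<in> U \<and> cmod (p (x + t *\<^sub>R \<nu>)) \<ge> cmod (p x) + t / 2"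
  shows "\<exists>e0>0. \<forall>e. 0 < e \<and> e < e0 \<longrightarrow> connected (U \<inter> {z. e < cmod (p z)}) \<and> U \<inter> {z. e < cmod (p z)} \<noteq> {}"
proof -
  have contp: "continuous_on A p" for A by (rule polynomials_continuous_on[OF pp(1)])
  have contn: "continuous_on A (\<lambda>z. cmod (p z))" for A by (intro continuous_on_norm contp)
  define A where "A = U \<inter> {z. p z \<noteq> 0}"
  have oA: "open A"
  proof -
    have "open (p -` (- {0}))" by (intro open_vimage contp) auto
    then show ?thesis unfolding A_def using open_U by (auto simp: vimage_def)
  qed
  have cA: "connected A" unfolding A_def by (rule connected_off_zeros[OF pp open_U conU(1)])
  obtain x0 where x0: "x0 \<in> A"
    using polynomials_nonzero_dense[OF pp open_U conU(2)] by (auto simp: A_def)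
  define K1 where "K1 = K \<inter> {z. \<eta> \<le> cmod (p z)}"
  have "closed (p -` {w. \<eta> \<le> cmod w})"
    by (intro closed_vimage contp closed_Collect_le continuous_intros)
  then have K1: "compact K1" unfolding K1_def using compact_K by (simp add: compact_Int_closed vimage_def)
  have "\<exists>s>0. \<exists>\<nu>. (\<forall>x\<in>K \<inter> ball a s. \<forall>t. 0 < t \<and> t \<le> s \<longrightarrow> x + t *\<^sub>R \<nu> \<in> U) \<and>
      (\<forall>x\<in>ball a s. \<forall>t. 0 \<le> t \<and> t \<le> s \<longrightarrow> \<eta> / 2 < cmod (p (x + t *\<^sub>R \<nu>)))" if a: "a \<in> K1" for a
  proof -
    obtain s0 \<nu> where s0: "s0 > 0" "\<forall>x\<in>K \<inter> ball a s0. \<forall>t. 0 < t \<and> t \<le> s0 \<longrightarrow> x + t *\<^sub>R \<nu> \<in> U"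
      using inward_direction_simple[of a] a by (auto simp: K1_def)
    have "open ((\<lambda>z. cmod (p z)) -` {\<eta>/2<..})" by (intro open_vimage contn) auto
    moreover have "a \<in> (\<lambda>z. cmod (p z)) -` {\<eta>/2<..}" using a \<eta>(1) by (auto simp: K1_def)
    ultimately obtain \<rho> where \<rho>: "\<rho> > 0" "ball a \<rho> \<subseteq> (\<lambda>z. cmod (p z)) -` {\<eta>/2<..}"
      using open_contains_ball by blast
    define N where "N = norm \<nu> + 1"
    have N: "N > 0" "norm \<nu> \<le> N" by (auto simp: N_def add_nonneg_pos)
    define s where "s = min s0 (\<rho> / (1 + N))"
    have s: "s > 0" "s \<le> s0" "s * (1 + N) \<le> \<rho>"
    proof -
      show "s > 0" "s \<le> s0" using s0(1) \<rho>(1) N by (auto simp: s_def)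
      have "s * (1 + N) \<le> \<rho> / (1 + N) * (1 + N)" using N by (intro mult_right_mono) (auto simp: s_def)
      then show "s * (1 + N) \<le> \<rho>" using N by simp
    qed
    have "\<eta> / 2 < cmod (p (x + t *\<^sub>R \<nu>))" if x: "x \<in> ball a s" and t: "0 \<le> t" "t \<le> s" for x t
    proof -
      have "dist x (x + t *\<^sub>R \<nu>) = t * norm \<nu>" using t by (simp add: dist_norm)
      also have "\<dots> \<le> s * N" using t s(1) N by (intro mult_mono) auto
      finally have "dist a (x + t *\<^sub>R \<nu>) < s + s * N" using x dist_triangle[of a "x + t *\<^sub>R \<nu>" x] by simp
      then have "x + t *\<^sub>R \<nu> \<in> ball a \<rho>" using s(3) by (simp add: algebra_simps)
      then show ?thesis using \<rho>(2) by auto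
    qed
    then show ?thesis using s s0 by (intro exI[of _ s] conjI exI[of _ \<nu>]) auto
  qed
  then have "\<forall>a\<in>K1. \<exists>s \<nu>. s > 0 \<and> (\<forall>x\<in>K \<inter> ball a s. \<forall>t. 0 < t \<and> t \<le> s \<longrightarrow> x + t *\<^sub>R \<nu> \<in> U) \<and>
      (\<forall>x\<in>ball a s. \<forall>t. 0 \<le> t \<and> t \<le> s \<longrightarrow> \<eta> / 2 < cmod (p (x + t *\<^sub>R \<nu>)))" by blast
  from bchoice[OF this] obtain s where "\<forall>a\<in>K1. \<exists>\<nu>. s a > 0 \<and> (\<forall>x\<in>K \<inter> ball a (s a). \<forall>t. 0 < t \<and> t \<le> s a \<longrightarrow> x + t *\<^sub>R \<nu> \<in> U) \<and>
      (\<forall>x\<in>ball a (s a). \<forall>t. 0 \<le> t \<and> t \<le> s a \<longrightarrow> \<eta> / 2 < cmod (p (x + t *\<^sub>R \<nu>)))" ..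
  from bchoice[OF this] obtain \<nu> where s\<nu>: "\<forall>a\<in>K1. s a > 0 \<and> (\<forall>x\<in>K \<inter> ball a (s a). \<forall>t. 0 < t \<and> t \<le> s a \<longrightarrow> x + t *\<^sub>R \<nu> a \<in> U) \<and>
      (\<forall>x\<in>ball a (s a). \<forall>t. 0 \<le> t \<and> t \<le> s a \<longrightarrow> \<eta> / 2 < cmod (p (x + t *\<^sub>R \<nu> a)))" ..
  have s2: "\<And>a. a \<in> K1 \<Longrightarrow> s a / 2 > 0" using s\<nu> by simp
  obtain F where F: "F \<subseteq> K1" "finite F" "K1 \<subseteq> (\<Union>a\<in>F. ball a (s a / 2))"
    by (rule compact_finite_ball_cover[OF K1 s2])
  \<comment> \<open>the end points of the inward segments that start where \<open>cmod p\<close> is at least \<open>\<eta>\<close>\<close>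
  define L where "L = insert x0 (\<Union>a\<in>F. (\<lambda>x. x + s a *\<^sub>R \<nu> a) ` (K \<inter> cball a (s a / 2)))"
  have cL: "compact L"
    unfolding L_def
    by (intro compact_insert compact_UN F(2) compact_continuous_image continuous_intros compact_Int_closed compact_K ballI) auto
  have LA: "L \<subseteq> A"
  proof
    fix y assume "y \<in> L"
    then consider "y = x0" | a x where "a \<in> F" "x \<in> K \<inter> cball a (s a / 2)" "y = x + s a *\<^sub>R \<nu> a"
      unfolding L_def by blast
    then show "y \<in> A"
    proof cases
      case 2
      have a: "a \<in> K1" using 2(1) F(1) by blast
      have sa: "s a > 0" using s\<nu> a by blast
      have x: "x \<in> K \<inter> ball a (s a)" using 2(2) sa by auto
      have "y \<in> U" "\<eta> / 2 < cmod (p y)" using s\<nu> a x sa 2(3) by auto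
      then show ?thesis using \<eta>(1) by (auto simp: A_def)
    qed (use x0 in simp)
  qed
  obtain L' where L': "compact L'" "connected L'" "L \<subseteq> L'" "L' \<subseteq> A"
    using compact_subset_compact_connected[OF oA cA cL LA] by blast
  have x0L: "x0 \<in> L'" using L'(3) by (auto simp: L_def)
  obtain c where c: "c \<in> L'" "\<And>x. x \<in> L' \<Longrightarrow> cmod (p c) \<le> cmod (p x)"
    using continuous_attains_inf[OF L'(1) _ contn] x0L by blast
  have c0: "cmod (p c) > 0" using c(1) L'(4) by (auto simp: A_def)
  define e0 where "e0 = min (\<eta>/2) (cmod (p c))"
  have "connected (U \<inter> {z. e < cmod (p z)}) \<and> U \<inter> {z. e < cmod (p z)} \<noteq> {}" if e: "0 < e" "e < e0" for e
  proof -
    define W where "W = U \<inter> {z. e < cmod (p z)}"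
    have L'W: "L' \<subseteq> W" using L'(4) c(2) e(2) by (force simp: W_def A_def e0_def)
    have high: "connected_component W x x0" if x: "x \<in> W" "cmod (p x) \<ge> \<eta>" for x
    proof -
      have xK: "x \<in> K" using x(1) U_subset_K by (auto simp: W_def)
      have "x \<in> K1" using x xK by (auto simp: K1_def)
      then obtain a where a: "a \<in> F" "x \<in> ball a (s a / 2)" using F(3) by blast
      have aK: "a \<in> K1" using a(1) F(1) by blast
      have sa: "s a > 0" using s\<nu> aK by blast
      have xb: "x \<in> ball a (s a)" using a(2) sa by auto
      define y where "y = x + s a *\<^sub>R \<nu> a"
      have "x \<in> K \<inter> cball a (s a / 2)" using a(2) xK by auto
      then have "y \<in> L" unfolding L_def y_def using a(1) by blast
      then have yL: "y \<in> L'" using L'(3) by blast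
      have seg: "closed_segment x y \<subseteq> W"
      proof
        fix u assume "u \<in> closed_segment x y"
        then obtain k where k: "0 \<le> k" "k \<le> 1" "u = (1 - k) *\<^sub>R x + k *\<^sub>R y" by (auto simp: closed_segment_def)
        have u: "u = x + (k * s a) *\<^sub>R \<nu> a" by (simp add: k(3) y_def algebra_simps)
        have ks: "0 \<le> k * s a" "k * s a \<le> s a" using k sa by (auto simp: mult_left_le_one_le)
        have "\<eta> / 2 < cmod (p u)" unfolding u using s\<nu> aK xb ks by blast
        moreover have "u \<in> U"
        proof (cases "k = 0")
          case True then show ?thesis using u x(1) by (simp add: W_def)
        next
          case False
          then have "0 < k * s a" using k(1) sa by simp
          then show ?thesis unfolding u using s\<nu> aK xb xK ks(2) by blast
        qed
        ultimately show "u \<in> W" using e(2) by (auto simp: W_def e0_def)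
      qed
      have "connected_component W x y"
        unfolding connected_component_def using seg by (intro exI[of _ "closed_segment x y"]) auto
      moreover have "connected_component W y x0"
        unfolding connected_component_def using L'(2) L'W yL x0L by blast
      ultimately show ?thesis by (rule connected_component_trans)
    qed
    \<comment> \<open>each segment raises \<open>cmod p\<close> by \<open>r / 2\<close>, so finitely many lead to a point where it is at least \<open>\<eta>\<close>\<close>
    have climb: "x \<in> W \<Longrightarrow> cmod (p x) \<ge> \<eta> - real k * (r / 2) \<Longrightarrow> connected_component W x x0" for k x
    proof (induction k arbitrary: x)
      case 0
      then show ?case using high by simp
    next
      case (Suc k)
      show ?case
      proof (cases "cmod (p x) \<ge> \<eta>")
        case True then show ?thesis using high Suc.prems(1) by blast
      next
        case False
        have xK: "x \<in> K" "p x \<noteq> 0" using Suc.prems(1) U_subset_K e(1) by (auto simp: W_def)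
        then obtain \<mu> where \<mu>: "\<forall>t. 0 < t \<and> t \<le> r \<longrightarrow> x + t *\<^sub>R \<mu> \<in> U \<and> cmod (p (x + t *\<^sub>R \<mu>)) \<ge> cmod (p x) + t / 2"
          using grow[of x] False by auto
        define y where "y = x + r *\<^sub>R \<mu>"
        have seg: "closed_segment x y \<subseteq> W"
        proof
          fix u assume "u \<in> closed_segment x y"
          then obtain k where k: "0 \<le> k" "k \<le> 1" "u = (1 - k) *\<^sub>R x + k *\<^sub>R y" by (auto simp: closed_segment_def)
          have u: "u = x + (k * r) *\<^sub>R \<mu>" by (simp add: k(3) y_def algebra_simps)
          show "u \<in> W"
          proof (cases "k = 0")
            case True then show ?thesis using u Suc.prems(1) by simp
          next
            case False
            then have kr: "0 < k * r" "k * r \<le> r" using k \<eta>(2) by (auto simp: mult_left_le_one_le)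
            then have "u \<in> U" "cmod (p u) \<ge> cmod (p x) + k * r / 2" unfolding u using \<mu> by auto
            moreover have "cmod (p x) > e" using Suc.prems(1) by (simp add: W_def)
            ultimately show ?thesis using kr by (auto simp: W_def)
          qed
        qed
        have "connected_component W x y"
          unfolding connected_component_def using seg by (intro exI[of _ "closed_segment x y"]) auto
        moreover have "connected_component W y x0"
        proof (rule Suc.IH)
          show "y \<in> W" using seg by auto
          have "cmod (p y) \<ge> cmod (p x) + r / 2" unfolding y_def using \<mu> \<eta>(2) by auto
          moreover have "real (Suc k) * (r / 2) = real k * (r / 2) + r / 2" by (simp add: distrib_right add_divide_distrib)
          ultimately show "\<eta> - real k * (r / 2) \<le> cmod (p y)" using Suc.prems(2) by linarith
        qed
        ultimately show ?thesis by (rule connected_component_trans)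
      qed
    qed
    have all: "connected_component W x x0" if "x \<in> W" for x
    proof -
      obtain k :: nat where "\<eta> / (r / 2) \<le> real k" using real_arch_simple by blast
      then have "\<eta> \<le> real k * (r / 2)" using \<eta>(2) by (simp add: field_simps)
      then show ?thesis using climb[OF that, of k] by (smt (verit) norm_ge_zero)
    qed
    have "connected W"
      unfolding connected_iff_connected_component
      using all connected_component_sym connected_component_trans by metis
    moreover have "W \<noteq> {}" using L'W x0L by blast
    ultimately show ?thesis unfolding W_def by blast
  qed
  moreover have "e0 > 0" using \<eta>(1) c0 by (simp add: e0_def)
  ultimately show ?thesis by blast
qed

end

text \<open>
  Almost every small affine perturbation is transversal, and for a transversal polynomial thin tubes
  preserve the transversality of the system as well as the connectedness of the domain.
\<close>

lemma tame_step:
  fixes U K :: "(complex ^ 'n::finite) set"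
  assumes "tame U K" and q: "q \<in> polynomials" and \<tau>: "\<tau> > 0"
  obtains p e0 where "p \<in> polynomials" "\<And>z. z \<in> cball 0 1 \<Longrightarrow> cmod (q z - p z) < \<tau>"
    "\<exists>w. p w \<noteq> 0" "negligible (K \<inter> {z. p z = 0})" "e0 > 0"
    "\<And>e. 0 < e \<Longrightarrow> e < e0 \<Longrightarrow> tame (U \<inter> {z. e < cmod (p z)}) (K \<inter> {z. e \<le> cmod (p z)})"
proof -
  obtain m f G where "transversal_system m f G U K" using assms(1) unfolding tame_def by blast
  then interpret transversal_system m f G U K .
  have conU: "connected U" "U \<noteq> {}" using assms(1) by (auto simp: tame_def)
  obtain dq where dq: "\<And>z. (q has_derivative pairing (dq z)) (at z)" "\<And>z. dq differentiable (at z)"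
    using polynomials_gradient[OF q] by blast
  define N where "N = 1 + real CARD('n)"
  have N: "N > 0" by (simp add: N_def)
  define \<tau>' where "\<tau>' = \<tau> / (2 * N)"
  have \<tau>': "\<tau>' > 0" using \<tau> N by (simp add: \<tau>'_def)
  obtain c l where cl: "cmod c < \<tau>'" "norm l < \<tau>'" and T: "transversal_to (\<lambda>z. q z + c + pairing l z) (\<lambda>z. dq z + l)"
    using transversal_perturbation[OF dq \<tau>'] by blast
  define p where "p z = q z + c + pairing l z" for z
  define dp where "dp z = dq z + l" for z
  have p: "p \<in> polynomials"
    unfolding p_def pairing_def
    by (intro polynomials_add q polynomials_const polynomials_sum polynomials_mult polynomials_coord finite)
  have dp: "\<And>z. (p has_derivative pairing (dp z)) (at z)" "\<And>z. dp differentiable (at z)"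
  proof -
    have "bounded_linear (pairing l)" by (rule bounded_bilinear.bounded_linear_right[OF bounded_bilinear_pairing])
    then have "(pairing l has_derivative pairing l) (at z)" for z by (rule bounded_linear_imp_has_derivative)
    then have "(p has_derivative (\<lambda>h. pairing (dq z) h + 0 + pairing l h)) (at z)" for z
      unfolding p_def by (intro has_derivative_add dq has_derivative_const)
    moreover have "pairing (dp z) = (\<lambda>h. pairing (dq z) h + 0 + pairing l h)" for z
      by (simp add: fun_eq_iff dp_def bounded_bilinear.add_left[OF bounded_bilinear_pairing])
    ultimately show "(p has_derivative pairing (dp z)) (at z)" for z by simp
    show "dp differentiable (at z)" for z unfolding dp_def by (intro differentiable_add dq differentiable_const)
  qed
  have T': "transversal_to p dp" using T unfolding p_def dp_def .
  have close: "cmod (q z - p z) < \<tau>" if z: "z \<in> cball 0 1" for z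
  proof -
    have "cmod (pairing l z) \<le> (\<Sum>j\<in>(UNIV::'n set). norm l * 1)"
      unfolding pairing_def
    proof (rule sum_norm_le)
      fix j
      have "norm (z $ j) \<le> 1" using Finite_Cartesian_Product.norm_nth_le[of z j] z by simp
      then show "norm (l $ j * z $ j) \<le> norm l * 1"
        unfolding norm_mult by (intro mult_mono Finite_Cartesian_Product.norm_nth_le) auto
    qed
    then have "cmod (pairing l z) \<le> real CARD('n) * norm l" by simp
    also have "\<dots> \<le> real CARD('n) * \<tau>'" using cl(2) by (intro mult_left_mono) auto
    finally have "cmod (c + pairing l z) < \<tau>' + real CARD('n) * \<tau>'"
      using norm_triangle_ineq[of c "pairing l z"] cl(1) by linarith
    also have "\<dots> = N * \<tau>'" by (simp add: N_def algebra_simps)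
    also have "\<dots> = \<tau> / 2" using N by (simp add: \<tau>'_def)
    finally have "cmod (- (c + pairing l z)) < \<tau>" using \<tau> by (simp only: norm_minus_cancel)
    moreover have "q z - p z = - (c + pairing l z)" by (simp add: p_def)
    ultimately show ?thesis by simp
  qed
  have nz: "\<exists>w. p w \<noteq> 0"
  proof (rule ccontr)
    assume n: "\<not> ?thesis"
    obtain a where a: "a \<in> K" using conU(2) U_subset_K by blast
    have "p = (\<lambda>z. 0)" using n by auto
    then have "(p has_derivative (\<lambda>h. 0)) (at a)" by simp
    then have "pairing (dp a) = (\<lambda>h. 0)" using dp(1) has_derivative_unique by blast
    then have "cnj_vec (dp a) \<bullet> cnj_vec (dp a) = 0" by (simp add: inner_cnj_vec)
    then show False using transversal_to_nonzero[OF T' a] n by simp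
  qed
  obtain \<eta> r where \<eta>: "\<eta> > 0" "r > 0" and gr: "\<forall>x\<in>K. cmod (p x) < \<eta> \<longrightarrow> lin_ind (act x \<union> {m, Suc m}) (grad_sys m G dp x) \<and>
    (p x \<noteq> 0 \<longrightarrow> (\<exists>\<nu>. \<forall>t. 0 < t \<and> t \<le> r \<longrightarrow> x + t *\<^sub>R \<nu> \<in> U \<and> cmod (p (x + t *\<^sub>R \<nu>)) \<ge> cmod (p x) + t / 2))"
    using growth_uniform[OF dp T'] by blast
  obtain w where w: "p w \<noteq> 0" using nz by blast
  obtain e1 where e1: "e1 > 0" "\<forall>e. 0 < e \<and> e < e1 \<longrightarrow> connected (U \<inter> {z. e < cmod (p z)}) \<and> U \<inter> {z. e < cmod (p z)} \<noteq> {}"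
    using connected_remove_tube[OF conU p w \<eta>] gr by blast
  show ?thesis
  proof (rule that[of p "min e1 \<eta>"])
    show "negligible (K \<inter> {z. p z = 0})" by (rule negligible_transversal_zeros[OF dp T'])
    fix e assume e: "0 < e" "e < min e1 \<eta>"
    show "tame (U \<inter> {z. e < cmod (p z)}) (K \<inter> {z. e \<le> cmod (p z)})"
      unfolding tame_def using e1(2) e gr transversal_system_remove_tube[OF dp, of e \<eta>] by auto
  qed (use p close nz e1(1) \<eta> in auto)
qed

section \<open>Carving out tubes\<close>

lemma emeasure_lebesgue_bounded_finite:
  fixes A :: "'a::euclidean_space set"
  assumes "bounded A"
  shows "emeasure lebesgue A < \<infinity>"
proof -
  obtain r where "\<forall>x\<in>A. norm x \<le> r" using assms unfolding bounded_iff by blast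
  then have "A \<subseteq> cball 0 r" by auto
  then have "emeasure lebesgue A \<le> emeasure lebesgue (cball (0::'a) r)"
    by (rule emeasure_mono) (rule fmeasurableD[OF lmeasurable_cball])
  also have "\<dots> < \<infinity>" using fmeasurableD2[OF lmeasurable_cball[of "0::'a" r]] by (simp add: top.not_eq_extremum)
  finally show ?thesis .
qed

lemma emeasure_decseq_small:
  fixes A :: "nat \<Rightarrow> 'a::euclidean_space set"
  assumes A: "\<And>n. A n \<in> sets lebesgue" "decseq A" "bounded (A 0)" and null: "emeasure lebesgue (\<Inter>n. A n) = 0"
    and e: "e > 0"
  shows "\<exists>n. emeasure lebesgue (A n) < e"
proof -
  have "emeasure lebesgue (A n) \<noteq> \<infinity>" for n
  proof -
    have "A n \<subseteq> A 0" using A(2) by (auto simp: decseq_def)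
    then show ?thesis using emeasure_lebesgue_bounded_finite[OF bounded_subset[OF A(3)]] by (metis less_irrefl)
  qed
  then have "(\<lambda>n. emeasure lebesgue (A n)) \<longlonglongrightarrow> emeasure lebesgue (\<Inter>n. A n)"
    using A(1,2) by (intro Lim_emeasure_decseq) auto
  then have "(\<lambda>n. emeasure lebesgue (A n)) \<longlonglongrightarrow> 0" using null by simp
  then have "\<forall>\<^sub>F n in sequentially. emeasure lebesgue (A n) < e" using e by (rule order_tendstoD)
  then show ?thesis unfolding eventually_sequentially by blast
qed

lemma open_compact_exhaustion:
  fixes U :: "'a::euclidean_space set"
  assumes U: "open U" "bounded U" and L: "compact L" "L \<subseteq> U" and e: "e > 0"
  shows "\<exists>C. compact C \<and> L \<subseteq> C \<and> C \<subseteq> U \<and> emeasure lebesgue (U - C) < e"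
proof -
  obtain C where C: "\<And>n. compact (C n)" "\<And>n. C n \<subseteq> U" "\<And>n. C n \<subseteq> interior (C (Suc n))" "\<Union>(range C) = U"
    using open_Union_compact_subsets[OF U(1)] by metis
  have mono: "incseq C" by (rule incseq_SucI) (use C(3) interior_subset in blast)
  define D where "D n = U - (C n \<union> L)" for n
  have "\<exists>n. emeasure lebesgue (D n) < e"
  proof (rule emeasure_decseq_small)
    show "D n \<in> sets lebesgue" for n
      unfolding D_def using U(1) C(1)[of n] L(1) by (intro sets.Diff sets.Un sets_completionI_sets) (auto simp: compact_imp_closed)
    show "decseq D" using mono unfolding D_def decseq_def incseq_def by blast
    show "bounded (D 0)" by (rule bounded_subset[OF U(2)]) (auto simp: D_def)
    have "(\<Inter>n. D n) = {}" using C(4) unfolding D_def by blast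
    then show "emeasure lebesgue (\<Inter>n. D n) = 0" by simp
  qed (rule e)
  then obtain n where "emeasure lebesgue (D n) < e" by blast
  then show ?thesis
    using C(1,2) L by (intro exI[of _ "C n \<union> L"]) (auto simp: D_def intro!: compact_Un)
qed

definition gleason_bound :: "(complex ^ 'n::finite) set \<Rightarrow> (complex ^ 'n) set \<Rightarrow> real \<Rightarrow> bool" where
  "gleason_bound U C b \<longleftrightarrow> (\<forall>f\<in>unit_slice_hol U. \<forall>x\<in>C. \<forall>y\<in>C. cmod (f x - f y) \<le> 2 - b)"

definition unit_near :: "(complex ^ 'n::finite) set \<Rightarrow> (complex ^ 'n) set \<Rightarrow> (complex ^ 'n) set \<Rightarrow> real \<Rightarrow> bool" where
  "unit_near U U' L \<delta> \<longleftrightarrow> (\<forall>g\<in>unit_slice_hol U'. \<exists>h\<in>unit_slice_hol U. \<forall>x\<in>L.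
     cmod (g x - h x) < \<delta> \<and> (\<forall>i. cmod (dir_deriv i g x - dir_deriv i h x) < \<delta>))"

text \<open>
  Two tubes are used: the wide one, of size \<open>\<eta>\<close>, is small in measure, and the estimates pass to the
  new domain only outside it; the removed one, of size \<open>e\<close>, is much thinner, depending on \<open>\<eta>\<close> and \<open>\<delta>\<close>.
\<close>

lemma carving_step:
  fixes U K :: "(complex ^ 'n::finite) set"
  assumes UK: "tame U K" and C: "compact C" "C \<subseteq> U" and q: "q \<in> polynomials"
    and pos: "\<tau> > 0" "\<delta> > 0" "\<mu> > (0::ennreal)" "\<mu>' > (0::ennreal)"
  shows "\<exists>U' K' C' b p e \<eta>. tame U' K' \<and> U' \<subseteq> U \<and> compact C' \<and> C' \<subseteq> U' \<and> 0 < b \<and> gleason_bound U' C' b \<and>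
    p \<in> polynomials \<and> (\<forall>z\<in>cball 0 1. cmod (q z - p z) < \<tau>) \<and> 0 < e \<and> e < \<eta> \<and> K' = K \<inter> {z. e \<le> cmod (p z)} \<and>
    emeasure lebesgue (K \<inter> {z. cmod (p z) < \<eta>}) < \<mu> \<and> C \<inter> {z. \<eta> \<le> cmod (p z)} \<subseteq> C' \<and>
    emeasure lebesgue (U' - C') < \<mu>' \<and> unit_near U U' (C \<inter> {z. \<eta> \<le> cmod (p z)}) \<delta>"
proof (rule tame_step[OF UK q pos(1)])
  note tf = tame_facts[OF UK]
  fix p :: "complex ^ 'n \<Rightarrow> complex" and e0 :: real
  assume p: "p \<in> polynomials" "\<And>z. z \<in> cball 0 1 \<Longrightarrow> cmod (q z - p z) < \<tau>" "\<exists>w. p w \<noteq> 0"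
    "negligible (K \<inter> {z. p z = 0})" "e0 > 0"
    "\<And>e. 0 < e \<Longrightarrow> e < e0 \<Longrightarrow> tame (U \<inter> {z. e < cmod (p z)}) (K \<inter> {z. e \<le> cmod (p z)})"
  have contn: "continuous_on A (\<lambda>z. cmod (p z))" for A by (rule continuous_on_norm[OF polynomials_continuous_on[OF p(1)]])
  have closed_ge: "closed {z. t \<le> cmod (p z)}" for t by (intro closed_Collect_le continuous_on_const contn)
  have open_lt: "open {z. cmod (p z) < t}" for t by (intro open_Collect_less continuous_on_const contn)
  define A where "A n = K \<inter> {z. cmod (p z) < 1 / (real n + 1)}" for n
  have "\<exists>n. emeasure lebesgue (A n) < \<mu>"
  proof (rule emeasure_decseq_small)
    show "A n \<in> sets lebesgue" for n
      unfolding A_def using tf(4) open_lt by (intro sets.Int sets_completionI_sets) (auto simp: compact_imp_closed)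
    show "decseq A"
      unfolding decseq_def A_def
    proof (intro allI impI subsetI)
      fix m n x assume mn: "m \<le> n" "x \<in> K \<inter> {z. cmod (p z) < 1 / (real n + 1)}"
      have "1 / (real n + 1) \<le> 1 / (real m + 1)" using mn(1) by (intro divide_left_mono) auto
      then show "x \<in> K \<inter> {z. cmod (p z) < 1 / (real m + 1)}" using mn(2) by auto
    qed
    show "bounded (A 0)" by (rule bounded_subset[OF compact_imp_bounded[OF tf(4)]]) (auto simp: A_def)
    have "(\<Inter>n. A n) \<subseteq> K \<inter> {z. p z = 0}"
    proof
      fix x assume x: "x \<in> (\<Inter>n. A n)"
      have "cmod (p x) \<le> 0"
      proof (rule ccontr)
        assume "\<not> ?thesis"
        then have "cmod (p x) > 0" by linarith
        then obtain n where "inverse (real (Suc n)) < cmod (p x)" using reals_Archimedean by blast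
        moreover have "cmod (p x) < 1 / (real n + 1)" using x by (auto simp: A_def)
        ultimately show False by (simp add: inverse_eq_divide add.commute)
      qed
      then show "x \<in> K \<inter> {z. p z = 0}" using x by (auto simp: A_def)
    qed
    then have "negligible (\<Inter>n. A n)" using p(4) negligible_subset by blast
    then show "emeasure lebesgue (\<Inter>n. A n) = 0" by (auto simp: negligible_iff_null_sets)
  qed (rule pos)
  then obtain n where n: "emeasure lebesgue (A n) < \<mu>" by blast
  define \<eta> where "\<eta> = 1 / (real n + 1)"
  have \<eta>: "\<eta> > 0" by (simp add: \<eta>_def)
  define L where "L = C \<inter> {z. \<eta> \<le> cmod (p z)}"
  have L: "compact L" unfolding L_def by (intro compact_Int_closed C closed_ge)
  have LU: "L \<subseteq> U \<inter> {z. p z \<noteq> 0}" using C(2) \<eta> by (auto simp: L_def)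
  obtain w where w: "p w \<noteq> 0" using p(3) by blast
  obtain e1 where e1: "e1 > 0" "\<forall>e. 0 < e \<and> e < e1 \<longrightarrow> (\<forall>g\<in>unit_slice_hol (U \<inter> {z. e < cmod (p z)}).
    \<exists>h\<in>unit_slice_hol U. \<forall>x\<in>L. cmod (g x - h x) < \<delta> \<and> (\<forall>i. cmod (dir_deriv i g x - dir_deriv i h x) < \<delta>))"
    using unit_slice_hol_near[OF p(1) w tf(1) L LU pos(2)] by blast
  define e where "e = min \<eta> (min e0 e1) / 2"
  have e: "0 < e" "e < \<eta>" "e < e0" "e < e1" using \<eta> p(5) e1(1) by (auto simp: e_def)
  define U' where "U' = U \<inter> {z. e < cmod (p z)}"
  define K' where "K' = K \<inter> {z. e \<le> cmod (p z)}"
  have t': "tame U' K'" unfolding U'_def K'_def using p(6) e by blast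
  note tf' = tame_facts[OF t']
  have LU': "L \<subseteq> U'" using LU e(2) by (auto simp: U'_def L_def)
  have bU': "bounded U'" using bounded_subset[OF compact_imp_bounded[OF tf'(4)] tf'(5)] .
  obtain C' where C': "compact C'" "L \<subseteq> C'" "C' \<subseteq> U'" "emeasure lebesgue (U' - C') < \<mu>'"
    using open_compact_exhaustion[OF tf'(1) bU' L LU' pos(4)] by blast
  obtain b where b: "b > 0" "gleason_bound U' C' b"
    using unit_slice_hol_gleason[OF tf'(1,2) C'(1,3)] unfolding gleason_bound_def by blast
  have near: "unit_near U U' L \<delta>" unfolding unit_near_def U'_def using e1(2) e by blast
  show ?thesis
    by (rule exI[of _ U'], rule exI[of _ K'], rule exI[of _ C'], rule exI[of _ b], rule exI[of _ p],
        rule exI[of _ e], rule exI[of _ \<eta>])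
      (use t' C' b p(1,2) e(1,2) n near in \<open>auto simp: U'_def K'_def L_def A_def \<eta>_def\<close>)
qed

lemma gleason_bound_mono: "gleason_bound U C b \<Longrightarrow> b' \<le> b \<Longrightarrow> gleason_bound U C b'"
  unfolding gleason_bound_def by (meson diff_left_mono order_trans)

text \<open>
  At stage \<open>n\<close> the compact set \<open>C n\<close> exhausts the domain \<open>U n\<close> up to measure \<open>(1/2) ^ n\<close>, and \<open>b n\<close> is
  the gap of the Gleason estimate on \<open>C n\<close>.  The error \<open>b n * (1/2) ^ (n + 3)\<close> allowed in the next
  step is so small that all steps together use up at most half of any of the gaps.
\<close>

locale carving =
  fixes U K C :: "nat \<Rightarrow> (complex ^ 'n::finite) set" and b e \<eta> :: "nat \<Rightarrow> real"
    and p q :: "nat \<Rightarrow> complex ^ 'n \<Rightarrow> complex" and r \<epsilon> :: real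
  assumes start: "K 0 = cball 0 r" "0 < r" "r < 1" "0 < \<epsilon>"
    and tame: "tame (U n) (K n)"
    and UU: "U (Suc n) \<subseteq> U n"
    and C: "compact (C n)" "C n \<subseteq> U n" "emeasure lebesgue (U n - C n) \<le> ennreal ((1/2) ^ n)"
    and b: "0 < b n" "b n \<le> 1" "b (Suc n) \<le> b n" "gleason_bound (U n) (C n) (b n)"
    and p: "p n \<in> polynomials" "z \<in> cball 0 1 \<Longrightarrow> cmod (q n z - p n z) < 1 / (real n + 1)"
    and e: "0 < e n" "e n < \<eta> n"
    and KK: "K (Suc n) = K n \<inter> {z. e n \<le> cmod (p n z)}"
    and small: "emeasure lebesgue (K n \<inter> {z. cmod (p n z) < \<eta> n}) \<le> ennreal (\<epsilon> * (1/2) ^ (n + 2))"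
    and CC: "C n \<inter> {z. \<eta> n \<le> cmod (p n z)} \<subseteq> C (Suc n)"
    and near: "unit_near (U n) (U (Suc n)) (C n \<inter> {z. \<eta> n \<le> cmod (p n z)}) (b n * (1/2) ^ (n + 3))"

lemma carving_exists:
  fixes q :: "nat \<Rightarrow> complex ^ 'n::finite \<Rightarrow> complex"
  assumes q: "\<And>n. q n \<in> polynomials" and r: "0 < r" "r < 1" and \<epsilon>: "0 < \<epsilon>"
  shows "\<exists>U K C b e \<eta> p. carving U K C b e \<eta> p q r \<epsilon>"
proof -
  define P where "P n x = (case x of (U, K, C, b) \<Rightarrow> (n = 0 \<longrightarrow> K = cball 0 r) \<and> tame U K \<and> compact C \<and> C \<subseteq> U \<and>
      emeasure lebesgue (U - C) \<le> ennreal ((1/2) ^ n) \<and> 0 < b \<and> b \<le> 1 \<and> gleason_bound U C b)"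
    for n and x :: "(complex ^ 'n) set \<times> (complex ^ 'n) set \<times> (complex ^ 'n) set \<times> real"
  define R where "R n U K C b U' K' C' b' p e \<eta> \<longleftrightarrow> U' \<subseteq> U \<and> b' \<le> b \<and>
      p \<in> polynomials \<and> (\<forall>z\<in>cball 0 1. cmod (q n z - p z) < 1 / (real n + 1)) \<and> 0 < e \<and> e < \<eta> \<and>
      K' = K \<inter> {z. e \<le> cmod (p z)} \<and>
      emeasure lebesgue (K \<inter> {z. cmod (p z) < \<eta>}) \<le> ennreal (\<epsilon> * (1/2) ^ (n + 2)) \<and>
      C \<inter> {z. \<eta> \<le> cmod (p z)} \<subseteq> C' \<and> unit_near U U' (C \<inter> {z. \<eta> \<le> cmod (p z)}) (b * (1/2) ^ (n + 3))"
    for n and U K C :: "(complex ^ 'n) set" and b :: real and U' K' C' :: "(complex ^ 'n) set" and b' :: real and p e \<eta>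
  define Q where "Q n x y = (case x of (U, K, C, b) \<Rightarrow> case y of (U', K', C', b') \<Rightarrow>
      \<exists>p e \<eta>. R n U K C b U' K' C' b' p e \<eta>)" for n x y
  have "\<exists>s. \<forall>n. P n (s n) \<and> Q n (s n) (s (Suc n))"
  proof (rule dependent_nat_choice)
    have t0: "tame (ball 0 r) (cball 0 r :: (complex ^ 'n) set)" using r(1) by (rule tame_ball)
    obtain C0 :: "(complex ^ 'n) set" where C0: "compact C0" "{} \<subseteq> C0" "C0 \<subseteq> ball 0 r" "emeasure lebesgue (ball 0 r - C0) < (1 :: ennreal)"
      using open_compact_exhaustion[of "ball (0 :: complex ^ 'n) r" "{}" 1] by auto
    obtain b0 where b0: "b0 > 0" "gleason_bound (ball 0 r) C0 b0"
      using unit_slice_hol_gleason[OF tame_facts(1,2)[OF t0] C0(1,3)] unfolding gleason_bound_def by blast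
    have "P 0 (ball 0 r, cball 0 r, C0, min b0 1)"
      unfolding P_def using t0 C0 b0 gleason_bound_mono[OF b0(2), of "min b0 1"] by (auto intro: less_imp_le)
    then show "\<exists>x. P 0 x" by blast
  next
    fix x n assume Px: "P n x"
    obtain U K C b where x: "x = (U, K, C, b)" by (cases x)
    have s: "tame U K" "compact C" "C \<subseteq> U" "0 < b" "b \<le> 1" using Px by (auto simp: P_def x)
    have "\<exists>U' K' C' b' p e \<eta>. tame U' K' \<and> U' \<subseteq> U \<and> compact C' \<and> C' \<subseteq> U' \<and> 0 < b' \<and> gleason_bound U' C' b' \<and>
      p \<in> polynomials \<and> (\<forall>z\<in>cball 0 1. cmod (q n z - p z) < 1 / (real n + 1)) \<and> 0 < e \<and> e < \<eta> \<and> K' = K \<inter> {z. e \<le> cmod (p z)} \<and>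
      emeasure lebesgue (K \<inter> {z. cmod (p z) < \<eta>}) < ennreal (\<epsilon> * (1/2) ^ (n + 2)) \<and> C \<inter> {z. \<eta> \<le> cmod (p z)} \<subseteq> C' \<and>
      emeasure lebesgue (U' - C') < ennreal ((1/2) ^ Suc n) \<and> unit_near U U' (C \<inter> {z. \<eta> \<le> cmod (p z)}) (b * (1/2) ^ (n + 3))"
      by (rule carving_step[OF s(1-3) q]) (use \<epsilon> s(4) in auto)
    then obtain U' K' C' b' p e \<eta> where st: "tame U' K'" "U' \<subseteq> U" "compact C'" "C' \<subseteq> U'" "0 < b'" "gleason_bound U' C' b'"
      "p \<in> polynomials" "\<forall>z\<in>cball 0 1. cmod (q n z - p z) < 1 / (real n + 1)" "0 < e" "e < \<eta>" "K' = K \<inter> {z. e \<le> cmod (p z)}"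
      "emeasure lebesgue (K \<inter> {z. cmod (p z) < \<eta>}) < ennreal (\<epsilon> * (1/2) ^ (n + 2))" "C \<inter> {z. \<eta> \<le> cmod (p z)} \<subseteq> C'"
      "emeasure lebesgue (U' - C') < ennreal ((1/2) ^ Suc n)" "unit_near U U' (C \<inter> {z. \<eta> \<le> cmod (p z)}) (b * (1/2) ^ (n + 3))"
      by (elim exE conjE) (rule that, assumption+)
    have "P (Suc n) (U', K', C', min b b')"
      unfolding P_def using st(1-6,14) s(4,5) gleason_bound_mono[OF st(6), of "min b b'"] by (auto intro: less_imp_le)
    moreover have "R n U K C b U' K' C' (min b b') p e \<eta>"
      unfolding R_def using st by (auto intro: less_imp_le)
    then have "Q n x (U', K', C', min b b')" unfolding Q_def x by auto
    ultimately show "\<exists>y. P (Suc n) y \<and> Q n x y" by blast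
  qed
  then obtain s where s: "\<And>n. P n (s n)" "\<And>n. Q n (s n) (s (Suc n))" by blast
  define U where "U n = fst (s n)" for n
  define K where "K n = fst (snd (s n))" for n
  define C where "C n = fst (snd (snd (s n)))" for n
  define b where "b n = snd (snd (snd (s n)))" for n
  have sn: "s n = (U n, K n, C n, b n)" for n by (simp add: U_def K_def C_def b_def)
  have Pn: "(n = 0 \<longrightarrow> K n = cball 0 r) \<and> tame (U n) (K n) \<and> compact (C n) \<and> C n \<subseteq> U n \<and>
      emeasure lebesgue (U n - C n) \<le> ennreal ((1/2) ^ n) \<and> 0 < b n \<and> b n \<le> 1 \<and> gleason_bound (U n) (C n) (b n)" for n
    using s(1)[of n] unfolding P_def sn by simp
  have Qn: "\<forall>n. \<exists>p e \<eta>. R n (U n) (K n) (C n) (b n) (U (Suc n)) (K (Suc n)) (C (Suc n)) (b (Suc n)) p e \<eta>"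
    using s(2) unfolding Q_def sn by simp
  from choice[OF Qn] obtain p where "\<forall>n. \<exists>e \<eta>. R n (U n) (K n) (C n) (b n) (U (Suc n)) (K (Suc n)) (C (Suc n)) (b (Suc n)) (p n) e \<eta>" ..
  from choice[OF this] obtain e where "\<forall>n. \<exists>\<eta>. R n (U n) (K n) (C n) (b n) (U (Suc n)) (K (Suc n)) (C (Suc n)) (b (Suc n)) (p n) (e n) \<eta>" ..
  from choice[OF this] obtain \<eta> where "\<forall>n. R n (U n) (K n) (C n) (b n) (U (Suc n)) (K (Suc n)) (C (Suc n)) (b (Suc n)) (p n) (e n) (\<eta> n)" ..
  then have Rn: "R n (U n) (K n) (C n) (b n) (U (Suc n)) (K (Suc n)) (C (Suc n)) (b (Suc n)) (p n) (e n) (\<eta> n)" for n ..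
  have "carving U K C b e \<eta> p q r \<epsilon>"
    by unfold_locales (use Pn Rn[unfolded R_def] r \<epsilon> in blast)+
  then show ?thesis by blast
qed

context carving
begin

definition X :: "(complex ^ 'n) set" where "X = (\<Inter>n. K n)"

text \<open>
  The points of \<open>C m\<close> to which the estimates of stage \<open>m\<close> continue to apply, since they are outside the
  wide tubes of all later stages.
\<close>

definition good_part :: "nat \<Rightarrow> (complex ^ 'n) set" where
  "good_part m = {x \<in> C m. \<forall>j\<ge>m. \<eta> j \<le> cmod (p j x)}"

definition P :: "(complex ^ 'n) set" where "P = (\<Union>m. good_part m)"

lemma compact_K: "compact (K n)"
  using tame_facts(4)[OF tame] .

lemma U_subset_K: "U n \<subseteq> K n"
  using tame_facts(5)[OF tame] .

lemma K_decreasing: "m \<le> n \<Longrightarrow> K n \<subseteq> K m"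
  by (rule lift_Suc_antimono_le) (use KK in auto)

lemma b_decreasing: "m \<le> n \<Longrightarrow> b n \<le> b m"
  by (rule lift_Suc_antimono_le) (use b(3) in auto)

lemma compact_X: "compact X"
proof -
  have "closed X" unfolding X_def using compact_K by (intro closed_INT) (auto intro: compact_imp_closed)
  moreover have "bounded X" by (rule bounded_subset[OF compact_imp_bounded[OF compact_K[of 0]]]) (auto simp: X_def)
  ultimately show ?thesis by (simp add: compact_eq_bounded_closed)
qed

text \<open>Each \<open>K n\<close> lies between the connected set \<open>U n\<close> and its closure.\<close>

lemma connected_X: "connected X"
  unfolding X_def
proof (rule connected_nest)
  show "connected (K n)" for n
    using connected_intermediate_closure[OF tame_facts(2)[OF tame] U_subset_K tame_facts(6)[OF tame]] .
qed (use compact_K K_decreasing in auto)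

lemma X_subset_cball: "X \<subseteq> cball 0 r"
  using start(1) by (auto simp: X_def)

lemma X_subset_ball: "X \<subseteq> ball 0 1"
  using X_subset_cball start(3) by auto

lemma p_nonzero: "x \<in> X \<Longrightarrow> e n \<le> cmod (p n x)"
proof -
  assume "x \<in> X"
  then have "x \<in> K (Suc n)" by (auto simp: X_def)
  then show ?thesis using KK by auto
qed

text \<open>
  A point outside the ball is separated by a linear form, and a point inside one of the tubes by the
  polynomial defining the tube.
\<close>

lemma rationally_convex_X: "rationally_convex X"
  unfolding rationally_convex_def
proof (rule equalityI)
  show "X \<subseteq> rational_hull X" unfolding rational_hull_def by auto
  show "rational_hull X \<subseteq> X"
  proof
    fix z assume z: "z \<in> rational_hull X"
    have K0: "z \<in> K 0"
    proof (rule ccontr)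
      assume "z \<notin> K 0"
      then have nz: "norm z > r" using start(1) by simp
      have "(\<lambda>w. \<Sum>j\<in>UNIV. cnj (z $ j) * w $ j) \<in> polynomials"
        by (intro polynomials_sum polynomials_mult polynomials_const polynomials_coord finite)
      then obtain x where x: "x \<in> X" "(\<Sum>j\<in>UNIV. cnj (z $ j) * z $ j) = (\<Sum>j\<in>UNIV. cnj (z $ j) * x $ j)"
        using z unfolding rational_hull_def by auto
      then have "z \<bullet> z = z \<bullet> x" unfolding inner_vec_complex by simp
      also have "\<dots> \<le> norm z * norm x" by (rule norm_cauchy_schwarz)
      finally have "norm z * norm z \<le> norm z * norm x" by (simp add: dot_square_norm power2_eq_square)
      moreover have "norm z > 0" using nz start(2) by linarith
      ultimately have "norm z \<le> norm x" by simp
      then show False using nz X_subset_cball x(1) by auto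
    qed
    have "z \<in> K n" for n
    proof (induction n)
      case (Suc n)
      have "e n \<le> cmod (p n z)"
      proof -
        obtain x where "x \<in> X" "p n z = p n x" using z p(1)[of n] unfolding rational_hull_def by auto
        then show ?thesis using p_nonzero[of x n] by simp
      qed
      then show ?case using Suc KK by simp
    qed (rule K0)
    then show "z \<in> X" by (simp add: X_def)
  qed
qed

text \<open>
  Hence a function on a neighbourhood of \<open>X\<close> is subject to the estimates of all sufficiently late stages.
\<close>

lemma neighbourhood_contains_stage:
  assumes "open W" "X \<subseteq> W"
  shows "\<exists>n0. \<forall>n\<ge>n0. K n \<subseteq> W"
proof -
  have "\<exists>n. K n - W = {}"
  proof (rule ccontr)
    assume "\<not> ?thesis"
    then have ne: "\<And>n. K n - W \<noteq> {}" by blast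
    have "\<Inter>(range (\<lambda>n. K n - W)) \<noteq> {}"
    proof (rule compact_nest)
      show "K n - W \<subseteq> K m - W" if "m \<le> n" for m n using K_decreasing[OF that] by blast
    qed (use ne compact_K assms(1) in \<open>auto intro!: compact_diff\<close>)
    then show False using assms(2) by (auto simp: X_def)
  qed
  then show ?thesis using K_decreasing by blast
qed

lemma good_part_stage:
  assumes "x \<in> good_part m" "m \<le> n"
  shows "x \<in> C n"
  using assms(2)
proof (induction n rule: dec_induct)
  case base
  show ?case using assms(1) by (simp add: good_part_def)
next
  case (step n)
  have "\<eta> n \<le> cmod (p n x)" using assms(1) step.hyps(1) by (simp add: good_part_def)
  then show ?case using step.IH CC[of n] by blast
qed

lemma good_part_mono: "m \<le> n \<Longrightarrow> good_part m \<subseteq> good_part n"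
  using good_part_stage unfolding good_part_def by auto

lemma good_part_subset: "good_part m \<subseteq> X"
proof
  fix x assume x: "x \<in> good_part m"
  have "x \<in> K n" for n
  proof -
    have "x \<in> C (max m n)" using good_part_stage[OF x] by simp
    then have "x \<in> K (max m n)" using C(2) U_subset_K by blast
    then show ?thesis using K_decreasing[of n "max m n"] by auto
  qed
  then show "x \<in> X" by (simp add: X_def)
qed

lemma P_subset_X: "P \<subseteq> X"
  unfolding P_def using good_part_subset by blast

lemma closed_good_part: "closed (good_part m)"
proof -
  have "good_part m = C m \<inter> (\<Inter>j\<in>{m..}. {x. \<eta> j \<le> cmod (p j x)})"
    by (auto simp: good_part_def)
  moreover have "closed {x. \<eta> j \<le> cmod (p j x)}" for j
    by (intro closed_Collect_le continuous_on_const continuous_on_norm polynomials_continuous_on p(1))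
  then have "closed (\<Inter>j\<in>{m..}. {x. \<eta> j \<le> cmod (p j x)})" by (intro closed_INT ballI)
  moreover have "closed (C m)" using C(1) by (rule compact_imp_closed)
  ultimately show ?thesis by (simp only: closed_Int)
qed

lemma P_sets: "P \<in> sets lebesgue"
  unfolding P_def using closed_good_part by (intro sets.countable_UN) (auto intro!: sets_completionI_sets)

text \<open>The Borel--Cantelli lemma: a point of \<open>X\<close> outside \<open>P\<close> lies in infinitely many small exceptional sets.\<close>

lemma null_complement_P: "X - P \<in> null_sets lebesgue"
proof -
  define A where "A n = (K n - U n) \<union> (U n - C n) \<union> (K n \<inter> {z. cmod (p n z) < \<eta> n})" for n
  have open_lt: "open {z. cmod (p n z) < t}" for n t
    by (intro open_Collect_less continuous_on_const continuous_on_norm polynomials_continuous_on p(1))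
  have s1: "K n - U n \<in> sets lebesgue" "U n - C n \<in> sets lebesgue" "K n \<inter> {z. cmod (p n z) < \<eta> n} \<in> sets lebesgue" for n
    using fmeasurableD[OF lmeasurable_compact[OF compact_K[of n]]] fmeasurableD[OF lmeasurable_compact[OF C(1)[of n]]]
      tame_facts(1)[OF tame, of n] open_lt[of n "\<eta> n"]
    by (simp_all add: sets.Diff sets.Int sets_completionI_sets)
  have A: "A n \<in> sets lebesgue" for n unfolding A_def using s1 by (intro sets.Un)
  define \<beta> where "\<beta> n = (1 + \<epsilon>) * (1/2) ^ n" for n :: nat
  have \<beta>0: "\<beta> n \<ge> 0" for n using start(4) by (simp add: \<beta>_def)
  have Ab: "emeasure lebesgue (A n) \<le> ennreal (\<beta> n)" for n
  proof -
    have "emeasure lebesgue (A n) \<le> emeasure lebesgue (K n - U n) + emeasure lebesgue (U n - C n) + emeasure lebesgue (K n \<inter> {z. cmod (p n z) < \<eta> n})"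
      unfolding A_def using s1
      by (intro order_trans[OF emeasure_subadditive] add_right_mono emeasure_subadditive sets.Un)
    also have "emeasure lebesgue (K n - U n) = 0"
      using tame_facts(7)[OF tame, of n] by (auto simp: negligible_iff_null_sets)
    also have "0 + emeasure lebesgue (U n - C n) + emeasure lebesgue (K n \<inter> {z. cmod (p n z) < \<eta> n})
        \<le> ennreal ((1/2) ^ n) + ennreal (\<epsilon> * (1/2) ^ (n + 2))"
      using C(3) small by (simp add: add_mono)
    also have "\<dots> = ennreal ((1/2) ^ n + \<epsilon> * (1/2) ^ (n + 2))" using start(4) by (simp add: ennreal_plus)
    also have "\<dots> \<le> ennreal (\<beta> n)"
      using start(4) by (intro ennreal_leI) (simp add: \<beta>_def algebra_simps)
    finally show ?thesis .
  qed
  have fin: "emeasure lebesgue (A n) < \<infinity>" for n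
    by (rule le_less_trans[OF Ab]) simp
  have mb: "measure lebesgue (A n) \<le> \<beta> n" for n
    using Ab[of n] \<beta>0[of n] by (simp add: measure_def enn2real_leI)
  have "summable \<beta>" unfolding \<beta>_def by (intro summable_mult summable_geometric) simp
  then have "summable (\<lambda>n. measure lebesgue (A n))"
    by (rule summable_comparison_test'[where N = 0]) (simp add: mb)
  then have "limsup A \<in> null_sets lebesgue" using A fin by (intro borel_cantelli_limsup1) auto
  moreover have "X - P \<subseteq> limsup A"
  proof
    fix x assume x: "x \<in> X - P"
    have "\<exists>j\<ge>m. x \<in> A j" for m
    proof -
      have xK: "x \<in> K n" for n using x by (auto simp: X_def)
      have "x \<notin> good_part m" using x by (auto simp: P_def)
      then consider "x \<notin> C m" | j where "j \<ge> m" "cmod (p j x) < \<eta> j" unfolding good_part_def by force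
      then show ?thesis
      proof cases
        case 1
        then have "x \<in> A m" using xK[of m] by (auto simp: A_def)
        then show ?thesis by blast
      next
        case 2
        then have "x \<in> A j" using xK[of j] by (auto simp: A_def)
        then show ?thesis using 2(1) by blast
      qed
    qed
    then show "x \<in> limsup A" by (auto simp: limsup_INF_SUP)
  qed
  moreover have "X - P \<in> sets lebesgue"
    using fmeasurableD[OF lmeasurable_compact[OF compact_X]] P_sets by (rule sets.Diff)
  ultimately show ?thesis using null_sets_subset by blast
qed

lemma emeasure_removed: "emeasure lebesgue (cball 0 r - X) \<le> ennreal (\<epsilon> / 2)"
proof -
  have open_lt: "open {z. cmod (p n z) < t}" for n t
    by (intro open_Collect_less continuous_on_const continuous_on_norm polynomials_continuous_on p(1))
  define B where "B n = K n \<inter> {z. cmod (p n z) < \<eta> n}" for n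
  have B: "B n \<in> sets lebesgue" for n
    unfolding B_def using fmeasurableD[OF lmeasurable_compact[OF compact_K[of n]]] open_lt[of n "\<eta> n"]
    by (simp add: sets.Int sets_completionI_sets)
  have "cball 0 r - X \<subseteq> (\<Union>n. B n)"
  proof
    fix x assume x: "x \<in> cball 0 r - X"
    show "x \<in> (\<Union>n. B n)"
    proof (rule ccontr)
      assume n: "x \<notin> (\<Union>n. B n)"
      have "x \<in> K n" for n
      proof (induction n)
        case 0 then show ?case using x start(1) by simp
      next
        case (Suc n)
        then have "\<not> cmod (p n x) < \<eta> n" using n by (auto simp: B_def)
        then have "e n \<le> cmod (p n x)" using e(2)[of n] by linarith
        then show ?case using Suc KK by simp
      qed
      then show False using x by (simp add: X_def)
    qed
  qed
  then have "emeasure lebesgue (cball 0 r - X) \<le> emeasure lebesgue (\<Union>n. B n)"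
    using B by (intro emeasure_mono) auto
  also have "\<dots> \<le> (\<Sum>n. emeasure lebesgue (B n))" using B by (intro emeasure_subadditive_countably) auto
  also have "\<dots> \<le> (\<Sum>n. ennreal (\<epsilon> * (1/2) ^ (n + 2)))"
    using small by (intro suminf_le) (auto simp: B_def)
  also have "\<dots> = ennreal (\<Sum>n. \<epsilon> * (1/2) ^ (n + 2))"
    using start(4) by (intro suminf_ennreal2) (auto intro!: summable_mult summable_ignore_initial_segment summable_geometric)
  also have "(\<Sum>n. \<epsilon> * (1/2) ^ (n + 2)) = \<epsilon> / 4 * (\<Sum>n. (1/2) ^ n)"
  proof -
    have "(\<Sum>n. \<epsilon> * (1/2) ^ (n + 2)) = (\<Sum>n. \<epsilon> / 4 * (1/2) ^ n)" by (simp add: power_add)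
    also have "\<dots> = \<epsilon> / 4 * (\<Sum>n. (1/2) ^ n)" by (rule suminf_mult) (simp add: summable_geometric)
    finally show ?thesis .
  qed
  also have "(\<Sum>n. (1/2) ^ n) = (2 :: real)" using suminf_geometric[of "1/2 :: real"] by simp
  finally show ?thesis by simp
qed

text \<open>
  The Gleason estimate on \<open>C m\<close> at stage \<open>m\<close> survives, with half of the gap, at all later stages, because
  a function at a later stage is approximated by one at the preceding stage.  The numbers are chosen
  so that the loss \<open>2 * b m * (1/2) ^ (n + 3)\<close> in step \<open>n\<close> is the decrease of the stated gap.
\<close>

lemma gleason_stage:
  assumes "x \<in> good_part m" "y \<in> good_part m" "m \<le> n" "g \<in> unit_slice_hol (U n)"
  shows "cmod (g x - g y) \<le> 2 - b m * (1/2 + (1/2) ^ Suc n)"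
  using assms(3,4)
proof (induction n arbitrary: g rule: dec_induct)
  case base
  have "cmod (g x - g y) \<le> 2 - b m"
    using b(4)[of m] base good_part_stage[OF assms(1)] good_part_stage[OF assms(2)] unfolding gleason_bound_def by blast
  moreover have "b m * (1/2 + (1/2) ^ Suc m) \<le> b m * 1"
    using b(1)[of m] power_le_one[of "1/2 :: real" m] by (intro mult_left_mono) auto
  ultimately show ?case by simp
next
  case (step n)
  define D where "D = C n \<inter> {z. \<eta> n \<le> cmod (p n z)}"
  have xy: "x \<in> D" "y \<in> D"
    using good_part_stage[OF assms(1) step.hyps(1)] good_part_stage[OF assms(2) step.hyps(1)] assms(1,2) step.hyps(1)
    by (simp_all add: D_def good_part_def)
  obtain h where h: "h \<in> unit_slice_hol (U n)" "\<And>z. z \<in> D \<Longrightarrow> cmod (g z - h z) < b n * (1/2) ^ (n + 3)"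
    using near[of n] step.prems unfolding unit_near_def D_def by blast
  have "b n * (1/2) ^ (n + 3) \<le> b m * (1/2) ^ (n + 3)" using b_decreasing[OF step.hyps(1)] by (intro mult_right_mono) auto
  then have gh: "cmod (g x - h x) \<le> b m * (1/2) ^ (n + 3)" "cmod (g y - h y) \<le> b m * (1/2) ^ (n + 3)"
    using h(2) xy by (meson less_le_trans less_imp_le order_less_le_trans)+
  have "cmod (((g x - h x) + (h x - h y)) - (g y - h y)) \<le> cmod (g x - h x) + cmod (h x - h y) + cmod (g y - h y)"
    by (intro order_trans[OF norm_triangle_ineq4] add_right_mono norm_triangle_ineq)
  then have "cmod (g x - g y) \<le> cmod (g x - h x) + cmod (h x - h y) + cmod (g y - h y)" by simp
  also have "\<dots> \<le> 2 - b m * (1/2 + (1/2) ^ Suc n) + 2 * (b m * (1/2) ^ (n + 3))"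
    using gh step.IH[OF h(1)] by linarith
  also have "\<dots> = 2 - b m * (1/2 + (1/2) ^ Suc (Suc n))" by (simp add: algebra_simps power_add power3_eq_cube)
  finally show ?case .
qed

lemma gleason_P:
  assumes "x \<in> P" "y \<in> P"
  shows "\<exists>c<2. \<forall>W f. open W \<and> X \<subseteq> W \<and> f \<in> unit_slice_hol W \<longrightarrow> cmod (f x - f y) \<le> c"
proof -
  obtain m1 m2 where m12: "x \<in> good_part m1" "y \<in> good_part m2" using assms by (auto simp: P_def)
  define m where "m = max m1 m2"
  have xy: "x \<in> good_part m" "y \<in> good_part m"
    using good_part_mono[of m1 m] good_part_mono[of m2 m] m12 by (auto simp: m_def)
  have "cmod (f x - f y) \<le> 2 - b m / 2" if W: "open W" "X \<subseteq> W" "f \<in> unit_slice_hol W" for W f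
  proof -
    obtain n0 where n0: "\<And>n. n \<ge> n0 \<Longrightarrow> K n \<subseteq> W" using neighbourhood_contains_stage[OF W(1,2)] by blast
    define n where "n = max m n0"
    have "f \<in> unit_slice_hol (U n)"
      by (rule unit_slice_hol_subset[OF W(3)]) (use n0[of n] U_subset_K[of n] in \<open>auto simp: n_def\<close>)
    then have "cmod (f x - f y) \<le> 2 - b m * (1/2 + (1/2) ^ Suc n)"
      by (intro gleason_stage[OF xy]) (auto simp: n_def)
    also have "\<dots> \<le> 2 - b m * (1/2)" using b(1)[of m] by (simp add: distrib_left)
    finally show ?thesis by simp
  qed
  then show ?thesis using b(1)[of m] by (intro exI[of _ "2 - b m / 2"]) auto
qed

text \<open>
  Cauchy's estimate bounds the derivatives at one stage, and the errors of all later steps add up to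
  at most 1.
\<close>

lemma dir_deriv_P:
  assumes "x \<in> P"
  shows "\<exists>M. \<forall>W f i. open W \<and> X \<subseteq> W \<and> f \<in> unit_slice_hol W \<longrightarrow> cmod (dir_deriv i f x) \<le> M"
proof -
  obtain m where m: "x \<in> good_part m" using assms by (auto simp: P_def)
  have "x \<in> U m" using good_part_stage[OF m order_refl] C(2) by blast
  then obtain s where s: "s > 0" "ball x s \<subseteq> U m" using tame_facts(1)[OF tame] open_contains_ball by blast
  define M where "M = 2 / s"
  have stage: "cmod (dir_deriv i g x) \<le> M + 1 - (1/2) ^ n" if "m \<le> n" "g \<in> unit_slice_hol (U n)" for n g i
    using that
  proof (induction n arbitrary: g rule: dec_induct)
    case base
    have "g \<in> unit_slice_hol (ball x s)" using unit_slice_hol_subset[OF base s(2)] .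
    then have "cmod (dir_deriv i g x) \<le> 2 * 1 / s"
      using s(1) by (intro dir_deriv_bound) (auto simp: unit_slice_hol_def)
    moreover have "(1/2 :: real) ^ m \<le> 1" by (simp add: power_le_one)
    ultimately show ?case unfolding M_def by linarith
  next
    case (step n)
    define D where "D = C n \<inter> {z. \<eta> n \<le> cmod (p n z)}"
    have xD: "x \<in> D" using m step.hyps(1) good_part_stage[OF m step.hyps(1)] by (simp add: D_def good_part_def)
    obtain h where h: "h \<in> unit_slice_hol (U n)" "\<And>z. z \<in> D \<Longrightarrow> cmod (dir_deriv i g z - dir_deriv i h z) < b n * (1/2) ^ (n + 3)"
      using near[of n] step.prems unfolding unit_near_def D_def by blast
    have "b n * (1/2) ^ (n + 3) \<le> 1 * (1/2) ^ (n + 1)"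
      using b(1,2)[of n] by (intro mult_mono power_decreasing) auto
    then have "cmod (dir_deriv i g x - dir_deriv i h x) \<le> (1/2) ^ (n + 1)" using h(2)[OF xD] by simp
    then have "cmod (dir_deriv i g x) \<le> M + 1 - (1/2) ^ n + (1/2) ^ (n + 1)"
      using step.IH[OF h(1)] norm_triangle_ineq2[of "dir_deriv i g x" "dir_deriv i h x"] by linarith
    then show ?case by simp
  qed
  have "cmod (dir_deriv i f x) \<le> M + 1" if W: "open W" "X \<subseteq> W" "f \<in> unit_slice_hol W" for W f i
  proof -
    obtain n0 where n0: "\<And>n. n \<ge> n0 \<Longrightarrow> K n \<subseteq> W" using neighbourhood_contains_stage[OF W(1,2)] by blast
    define n where "n = max m n0"
    have "f \<in> unit_slice_hol (U n)"
      by (rule unit_slice_hol_subset[OF W(3)]) (use n0[of n] U_subset_K[of n] in \<open>auto simp: n_def\<close>)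
    then have "cmod (dir_deriv i f x) \<le> M + 1 - (1/2) ^ n" by (intro stage) (auto simp: n_def)
    also have "\<dots> \<le> M + 1" by simp
    finally show ?thesis .
  qed
  then show ?thesis by blast
qed

end

section \<open>The algebra of rational functions\<close>

lemma holomorphic_vec_on_subset: "holomorphic_vec_on f U \<Longrightarrow> V \<subseteq> U \<Longrightarrow> holomorphic_vec_on f V"
  unfolding holomorphic_vec_on_def by blast

lemma holomorphic_vec_on_imp_slice_hol:
  fixes f :: "complex ^ 'n::finite \<Rightarrow> complex"
  assumes f: "holomorphic_vec_on f U"
  shows "slice_hol f U"
  unfolding slice_hol_def
proof (intro conjI allI)
  show "continuous_on U f"
  proof (rule continuous_at_imp_continuous_on, rule ballI)
    fix z assume "z \<in> U"
    then obtain D where "(f has_derivative D) (at z)" using f unfolding holomorphic_vec_on_def by blast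
    then show "isCont f z" by (rule has_derivative_continuous)
  qed
  fix z v
  show "(\<lambda>\<zeta>. f (z + \<zeta> *s v)) holomorphic_on {\<zeta>. z + \<zeta> *s v \<in> U}"
    unfolding holomorphic_on_def
  proof
    fix \<zeta> assume "\<zeta> \<in> {\<zeta>. z + \<zeta> *s v \<in> U}"
    then obtain D where D: "(f has_derivative D) (at (z + \<zeta> *s v))" "\<And>c v. D (c *s v) = c * D v"
      using f unfolding holomorphic_vec_on_def by blast
    have "((\<lambda>\<zeta>. z + \<zeta> *s v) has_derivative (\<lambda>h. h *s v)) (at \<zeta>)"
    proof -
      have "bounded_linear (\<lambda>h. h *s v)" by (rule bounded_bilinear.bounded_linear_left[OF bounded_bilinear_cmult_vec])
      then have "((\<lambda>\<zeta>. \<zeta> *s v) has_derivative (\<lambda>h. h *s v)) (at \<zeta>)" by (rule bounded_linear_imp_has_derivative)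
      from has_derivative_add[OF has_derivative_const this, of z] show ?thesis by simp
    qed
    from diff_chain_at[OF this D(1)] have "((\<lambda>\<zeta>. f (z + \<zeta> *s v)) has_derivative (\<lambda>h. D (h *s v))) (at \<zeta>)"
      by (simp add: o_def)
    moreover have "(\<lambda>h. D (h *s v)) = (*) (D v)" by (simp add: fun_eq_iff D(2) mult.commute)
    ultimately have "((\<lambda>\<zeta>. f (z + \<zeta> *s v)) has_field_derivative D v) (at \<zeta>)"
      unfolding has_field_derivative_def by simp
    then show "(\<lambda>\<zeta>. f (z + \<zeta> *s v)) field_differentiable at \<zeta> within {\<zeta>. z + \<zeta> *s v \<in> U}"
      using field_differentiable_at_within field_differentiable_def by blast
  qed
qed

lemma holomorphic_vec_on_add:
  assumes "holomorphic_vec_on f U" "holomorphic_vec_on g U"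
  shows "holomorphic_vec_on (\<lambda>z. f z + g z) U"
  unfolding holomorphic_vec_on_def
proof
  fix z assume "z \<in> U"
  then obtain D E where D: "(f has_derivative D) (at z)" "\<And>c v. D (c *s v) = c * D v"
    and E: "(g has_derivative E) (at z)" "\<And>c v. E (c *s v) = c * E v"
    using assms unfolding holomorphic_vec_on_def by metis
  show "\<exists>D. ((\<lambda>z. f z + g z) has_derivative D) (at z) \<and> (\<forall>c v. D (c *s v) = c * D v)"
    using has_derivative_add[OF D(1) E(1)] D(2) E(2) by (intro exI[of _ "\<lambda>h. D h + E h"]) (simp add: distrib_left)
qed

lemma holomorphic_vec_on_mult:
  assumes "holomorphic_vec_on f U" "holomorphic_vec_on g U"
  shows "holomorphic_vec_on (\<lambda>z. f z * g z) U"
  unfolding holomorphic_vec_on_def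
proof
  fix z assume "z \<in> U"
  then obtain D E where D: "(f has_derivative D) (at z)" "\<And>c v. D (c *s v) = c * D v"
    and E: "(g has_derivative E) (at z)" "\<And>c v. E (c *s v) = c * E v"
    using assms unfolding holomorphic_vec_on_def by metis
  show "\<exists>D. ((\<lambda>z. f z * g z) has_derivative D) (at z) \<and> (\<forall>c v. D (c *s v) = c * D v)"
    using has_derivative_mult[OF D(1) E(1)] D(2) E(2)
    by (intro exI[of _ "\<lambda>h. f z * E h + D h * g z"]) (simp add: algebra_simps)
qed

lemma holomorphic_vec_on_translate:
  assumes f: "holomorphic_vec_on f U"
  shows "holomorphic_vec_on (\<lambda>z. f (z + t)) ((\<lambda>z. z + t) -` U)"
  unfolding holomorphic_vec_on_def
proof
  fix z assume "z \<in> (\<lambda>z. z + t) -` U"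
  then obtain D where D: "(f has_derivative D) (at (z + t))" "\<And>c v. D (c *s v) = c * D v"
    using f unfolding holomorphic_vec_on_def by auto
  have "((\<lambda>z. z + t) has_derivative (\<lambda>h. h)) (at z)" by (auto intro!: derivative_eq_intros)
  from diff_chain_at[OF this D(1)] show "\<exists>D. ((\<lambda>z. f (z + t)) has_derivative D) (at z) \<and> (\<forall>c v. D (c *s v) = c * D v)"
    using D(2) by (intro exI[of _ D]) (simp add: o_def)
qed

lemma holomorphic_vec_on_polynomial:
  assumes "p \<in> polynomials"
  shows "holomorphic_vec_on p U"
proof -
  obtain dp where dp: "\<And>z. (p has_derivative pairing (dp z)) (at z)" using polynomials_gradient[OF assms] by blast
  have "pairing l (c *s v) = c * pairing l v" for l c v
    by (simp add: pairing_def sum_distrib_left mult.left_commute)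
  then show ?thesis unfolding holomorphic_vec_on_def using dp by blast
qed

lemma rationals_polynomial: "p \<in> polynomials \<Longrightarrow> p \<in> rationals_holomorphic_near X"
  unfolding rationals_holomorphic_near_def
  by (intro CollectI exI[of _ UNIV] bexI[of _ p] bexI[of _ "\<lambda>_. 1"])
     (auto simp: holomorphic_vec_on_polynomial intro: polynomials_const)

lemma rationals_E:
  assumes "f \<in> rationals_holomorphic_near X"
  obtains U p q where "open U" "X \<subseteq> U" "holomorphic_vec_on f U" "p \<in> polynomials" "q \<in> polynomials"
    "\<exists>z. q z \<noteq> 0" "\<forall>z\<in>U. q z \<noteq> 0 \<longrightarrow> f z = p z / q z"
  using assms unfolding rationals_holomorphic_near_def by blast

lemma rationals_I:
  assumes "open U" "X \<subseteq> U" "holomorphic_vec_on f U" "p \<in> polynomials" "q \<in> polynomials"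
    "\<exists>z. q z \<noteq> 0" "\<And>z. z \<in> U \<Longrightarrow> q z \<noteq> 0 \<Longrightarrow> f z = p z / q z"
  shows "f \<in> rationals_holomorphic_near X"
  using assms unfolding rationals_holomorphic_near_def by blast

lemma rationals_add:
  assumes "f \<in> rationals_holomorphic_near X" "g \<in> rationals_holomorphic_near X"
  shows "(\<lambda>z. f z + g z) \<in> rationals_holomorphic_near X"
proof -
  obtain U p q where f: "open U" "X \<subseteq> U" "holomorphic_vec_on f U" "p \<in> polynomials" "q \<in> polynomials"
    "\<exists>z. q z \<noteq> 0" "\<forall>z\<in>U. q z \<noteq> 0 \<longrightarrow> f z = p z / q z" using rationals_E[OF assms(1)] .
  obtain V p' q' where g: "open V" "X \<subseteq> V" "holomorphic_vec_on g V" "p' \<in> polynomials" "q' \<in> polynomials"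
    "\<exists>z. q' z \<noteq> 0" "\<forall>z\<in>V. q' z \<noteq> 0 \<longrightarrow> g z = p' z / q' z" using rationals_E[OF assms(2)] .
  show ?thesis
  proof (rule rationals_I[of "U \<inter> V"])
    show "holomorphic_vec_on (\<lambda>z. f z + g z) (U \<inter> V)"
      by (intro holomorphic_vec_on_add holomorphic_vec_on_subset[OF f(3)] holomorphic_vec_on_subset[OF g(3)]) auto
    show "(\<lambda>z. p z * q' z + p' z * q z) \<in> polynomials" by (intro polynomials_add polynomials_mult f g)
    show "(\<lambda>z. q z * q' z) \<in> polynomials" by (intro polynomials_mult f g)
    show "\<exists>z. q z * q' z \<noteq> 0" using polynomials_mult_nonzero[OF f(5) g(5)] f(6) g(6) by blast
    show "f z + g z = (p z * q' z + p' z * q z) / (q z * q' z)" if "z \<in> U \<inter> V" "q z * q' z \<noteq> 0" for z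
      using f(7) g(7) that by (simp add: add_frac_eq)
  qed (use f g in auto)
qed

lemma rationals_mult:
  assumes "f \<in> rationals_holomorphic_near X" "g \<in> rationals_holomorphic_near X"
  shows "(\<lambda>z. f z * g z) \<in> rationals_holomorphic_near X"
proof -
  obtain U p q where f: "open U" "X \<subseteq> U" "holomorphic_vec_on f U" "p \<in> polynomials" "q \<in> polynomials"
    "\<exists>z. q z \<noteq> 0" "\<forall>z\<in>U. q z \<noteq> 0 \<longrightarrow> f z = p z / q z" using rationals_E[OF assms(1)] .
  obtain V p' q' where g: "open V" "X \<subseteq> V" "holomorphic_vec_on g V" "p' \<in> polynomials" "q' \<in> polynomials"
    "\<exists>z. q' z \<noteq> 0" "\<forall>z\<in>V. q' z \<noteq> 0 \<longrightarrow> g z = p' z / q' z" using rationals_E[OF assms(2)] .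
  show ?thesis
  proof (rule rationals_I[of "U \<inter> V"])
    show "holomorphic_vec_on (\<lambda>z. f z * g z) (U \<inter> V)"
      by (intro holomorphic_vec_on_mult holomorphic_vec_on_subset[OF f(3)] holomorphic_vec_on_subset[OF g(3)]) auto
    show "(\<lambda>z. p z * p' z) \<in> polynomials" by (intro polynomials_mult f g)
    show "(\<lambda>z. q z * q' z) \<in> polynomials" by (intro polynomials_mult f g)
    show "\<exists>z. q z * q' z \<noteq> 0" using polynomials_mult_nonzero[OF f(5) g(5)] f(6) g(6) by blast
    show "f z * g z = (p z * p' z) / (q z * q' z)" if "z \<in> U \<inter> V" "q z * q' z \<noteq> 0" for z
      using f(7) g(7) that by simp
  qed (use f g in auto)
qed

lemma rationals_slice_hol:
  assumes "f \<in> rationals_holomorphic_near X"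
  obtains W where "open W" "X \<subseteq> W" "slice_hol f W"
  using rationals_E[OF assms] holomorphic_vec_on_imp_slice_hol by metis

lemma fscale_apply: "fscale c f x = c * f x"
  by (simp add: fscale_def)

locale compact_set =
  fixes X :: "(complex ^ 'n::finite) set"
  assumes compact_X: "compact X"
begin

abbreviation F :: "(complex ^ 'n \<Rightarrow> complex) set" where "F \<equiv> rationals_holomorphic_near X"

abbreviation A :: "(complex ^ 'n \<Rightarrow> complex) set" where "A \<equiv> R_alg X"

definition res :: "(complex ^ 'n \<Rightarrow> complex) \<Rightarrow> complex ^ 'n \<Rightarrow> complex" where
  "res g = (\<lambda>z. if z \<in> X then g z else 0)"

lemma res_apply [simp]: "z \<in> X \<Longrightarrow> res g z = g z"
  by (simp add: res_def)

lemma res_in_A: "g \<in> F \<Longrightarrow> res g \<in> A"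
  unfolding R_alg_def uniform_closure_def res_def by (auto intro!: bexI[of _ g])

lemma A_zero: "f \<in> A \<Longrightarrow> z \<notin> X \<Longrightarrow> f z = 0"
  by (auto simp: R_alg_def uniform_closure_def)

lemma A_approx: "f \<in> A \<Longrightarrow> e > 0 \<Longrightarrow> \<exists>g\<in>F. \<forall>z\<in>X. cmod (f z - g z) < e"
  by (auto simp: R_alg_def uniform_closure_def)

lemma A_I:
  assumes "\<And>z. z \<notin> X \<Longrightarrow> f z = 0" "\<And>e. e > 0 \<Longrightarrow> \<exists>g\<in>F. \<forall>z\<in>X. cmod (f z - g z) \<le> e"
  shows "f \<in> A"
  unfolding R_alg_def uniform_closure_def
proof (intro CollectI conjI allI impI)
  fix e :: real assume "e > 0"
  then obtain g where "g \<in> F" "\<forall>z\<in>X. cmod (f z - g z) \<le> e / 2" using assms(2)[of "e/2"] by auto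
  then show "\<exists>g\<in>F. \<forall>z\<in>X. cmod (f z - g z) < e" using \<open>e > 0\<close> by (intro bexI[of _ g]) force+
qed (rule assms(1))

lemma F_bounded:
  assumes "g \<in> F"
  shows "\<exists>B>0. \<forall>z\<in>X. cmod (g z) \<le> B"
proof -
  obtain W where "open W" "X \<subseteq> W" "slice_hol g W" using rationals_slice_hol[OF assms] .
  then have "continuous_on X g" unfolding slice_hol_def using continuous_on_subset by blast
  then have "bounded (g ` X)" using compact_X by (intro compact_imp_bounded compact_continuous_image)
  then obtain B where B: "B > 0" "\<forall>y\<in>g ` X. norm y \<le> B" unfolding bounded_pos by blast
  then show ?thesis by (intro exI[of _ B]) auto
qed

lemma A_bounded:
  assumes "f \<in> A"
  shows "\<exists>B>0. \<forall>z\<in>X. cmod (f z) \<le> B"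
proof -
  obtain g where g: "g \<in> F" "\<forall>z\<in>X. cmod (f z - g z) < 1" using A_approx[OF assms, of 1] by auto
  obtain B where B: "B > 0" "\<forall>z\<in>X. cmod (g z) \<le> B" using F_bounded[OF g(1)] by blast
  have "cmod (f z) \<le> B + 1" if "z \<in> X" for z
  proof -
    have "cmod (f z) \<le> cmod (f z - g z) + cmod (g z)" by (metis diff_add_cancel norm_triangle_ineq)
    then show ?thesis using B(2) g(2) that by force
  qed
  then show ?thesis using B(1) by (intro exI[of _ "B + 1"]) auto
qed

lemma sup_norm_bound: "f \<in> A \<Longrightarrow> z \<in> X \<Longrightarrow> cmod (f z) \<le> sup_norm X f"
proof -
  assume f: "f \<in> A" and z: "z \<in> X"
  obtain B where "\<forall>z\<in>X. cmod (f z) \<le> B" using A_bounded[OF f] by blast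
  then have "bdd_above ((\<lambda>x. cmod (f x)) ` X)" by (auto intro: bdd_aboveI)
  then show ?thesis unfolding sup_norm_def using z by (rule cSUP_upper[rotated])
qed

lemma A_add: "f \<in> A \<Longrightarrow> g \<in> A \<Longrightarrow> f + g \<in> A"
proof (rule A_I)
  assume f: "f \<in> A" and g: "g \<in> A"
  show "(f + g) z = 0" if "z \<notin> X" for z using that f g by (simp add: A_zero)
  fix e :: real assume e: "e > 0"
  obtain f1 where f1: "f1 \<in> F" "\<forall>z\<in>X. cmod (f z - f1 z) < e/2" using A_approx[OF f, of "e/2"] e by auto
  obtain g1 where g1: "g1 \<in> F" "\<forall>z\<in>X. cmod (g z - g1 z) < e/2" using A_approx[OF g, of "e/2"] e by auto
  have "cmod ((f + g) z - (f1 z + g1 z)) \<le> e" if "z \<in> X" for z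
  proof -
    have "cmod ((f z - f1 z) + (g z - g1 z)) \<le> cmod (f z - f1 z) + cmod (g z - g1 z)" by (rule norm_triangle_ineq)
    also have "\<dots> \<le> e/2 + e/2" using f1(2) g1(2) that by (intro add_mono) (auto intro: less_imp_le)
    finally show ?thesis by (simp add: algebra_simps)
  qed
  then show "\<exists>h\<in>F. \<forall>z\<in>X. cmod ((f + g) z - h z) \<le> e"
    using rationals_add[OF f1(1) g1(1)] by (intro bexI[of _ "\<lambda>z. f1 z + g1 z"]) auto
qed

lemma prod_approx:
  assumes "cmod (u - u1) \<le> d" "cmod (v - v1) \<le> d" "cmod u \<le> B" "cmod v1 \<le> B'" "0 \<le> d"
  shows "cmod (u * v - u1 * v1) \<le> (B + B') * d"
proof -
  have "u * v - u1 * v1 = u * (v - v1) + (u - u1) * v1" by (simp add: algebra_simps)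
  also have "cmod \<dots> \<le> cmod u * cmod (v - v1) + cmod (u - u1) * cmod v1"
    using norm_triangle_ineq[of "u * (v - v1)" "(u - u1) * v1"] by (simp add: norm_mult)
  also have "\<dots> \<le> B * d + d * B'"
    using assms norm_ge_zero[of u] by (intro add_mono mult_mono) (auto intro: order_trans[OF norm_ge_zero])
  finally show ?thesis by (simp add: algebra_simps)
qed

lemma A_mult: "f \<in> A \<Longrightarrow> g \<in> A \<Longrightarrow> f * g \<in> A"
proof (rule A_I)
  assume f: "f \<in> A" and g: "g \<in> A"
  show "(f * g) z = 0" if "z \<notin> X" for z using that f g by (simp add: A_zero)
  fix e :: real assume e: "e > 0"
  obtain B where B: "B > 0" "\<forall>z\<in>X. cmod (f z) \<le> B" using A_bounded[OF f] by blast
  obtain B' where B': "B' > 0" "\<forall>z\<in>X. cmod (g z) \<le> B'" using A_bounded[OF g] by blast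
  define d where "d = min 1 (e / (B + (B' + 1)))"
  have d: "d > 0" using B B' e by (simp add: d_def)
  obtain f1 where f1: "f1 \<in> F" "\<forall>z\<in>X. cmod (f z - f1 z) < d" using A_approx[OF f d] by auto
  obtain g1 where g1: "g1 \<in> F" "\<forall>z\<in>X. cmod (g z - g1 z) < d" using A_approx[OF g d] by auto
  have "cmod (f z * g z - f1 z * g1 z) \<le> e" if z: "z \<in> X" for z
  proof -
    have "cmod (g1 z) \<le> cmod (g z) + cmod (g z - g1 z)"
      by (metis add.commute norm_minus_commute norm_triangle_sub)
    also have "\<dots> \<le> B' + 1" using B'(2) g1(2) z by (intro add_mono) (auto simp: d_def intro: less_imp_le)
    finally have "cmod (f z * g z - f1 z * g1 z) \<le> (B + (B' + 1)) * d"
      using f1(2) g1(2) B(2) z d by (intro prod_approx) (auto intro: less_imp_le)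
    also have "\<dots> \<le> (B + (B' + 1)) * (e / (B + (B' + 1)))" using B(1) B'(1) by (intro mult_left_mono) (auto simp: d_def)
    also have "\<dots> = e" using B(1) B'(1) by simp
    finally show ?thesis .
  qed
  then show "\<exists>h\<in>F. \<forall>z\<in>X. cmod ((f * g) z - h z) \<le> e"
    using rationals_mult[OF f1(1) g1(1)] by (intro bexI[of _ "\<lambda>z. f1 z * g1 z"]) auto
qed

lemma F_const: "(\<lambda>z. c) \<in> F"
  by (intro rationals_polynomial polynomials_const)

lemma A_const: "res (\<lambda>z. c) \<in> A"
  by (intro res_in_A F_const)

lemma A_fscale: "f \<in> A \<Longrightarrow> fscale c f \<in> A"
proof -
  assume f: "f \<in> A"
  have "fscale c f = res (\<lambda>z. c) * f" using A_zero[OF f] by (auto simp: fun_eq_iff fscale_def res_def)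
  then show ?thesis using A_mult[OF A_const f] by simp
qed

lemma A_diff: "f \<in> A \<Longrightarrow> g \<in> A \<Longrightarrow> g - f \<in> A"
proof -
  assume "f \<in> A" "g \<in> A"
  then have "g + fscale (-1) f \<in> A" by (intro A_add A_fscale)
  moreover have "g + fscale (-1) f = g - f" by (auto simp: fun_eq_iff fscale_def)
  ultimately show ?thesis by simp
qed

lemma evaluation_in_max_ideal_space:
  assumes "x \<in> X"
  shows "evaluation A x \<in> max_ideal_space A"
  unfolding max_ideal_space_def linear_functional_def evaluation_def
  using assms by (auto simp: A_add A_mult A_fscale fscale_apply intro!: bexI[OF _ A_const[of 1]])

text \<open>
  A bound on \<open>X\<close> holds, with an arbitrarily small loss, on a neighbourhood; so estimates for functions
  bounded by 1 near \<open>X\<close> are estimates in the supremum norm of \<open>X\<close>.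
\<close>

lemma normalise_near:
  assumes "open W" "X \<subseteq> W" "slice_hol f W" "\<forall>z\<in>X. cmod (f z) \<le> B" "B < B'" "0 < B'"
  shows "\<exists>W'. open W' \<and> X \<subseteq> W' \<and> (\<lambda>z. f z * (1 / of_real B')) \<in> unit_slice_hol W'"
proof -
  define W' where "W' = W \<inter> f -` {w. cmod w < B'}"
  have "open W'" unfolding W'_def
    using assms(1,3) by (intro continuous_open_preimage open_Collect_less continuous_intros) (auto simp: slice_hol_def)
  moreover have "X \<subseteq> W'" using assms(2,4,5) by (force simp: W'_def)
  moreover have "slice_hol (\<lambda>z. f z * (1 / of_real B')) W'"
    by (intro slice_hol_mult slice_hol_const slice_hol_subset[OF assms(3)]) (auto simp: W'_def)
  then have "(\<lambda>z. f z * (1 / of_real B')) \<in> unit_slice_hol W'"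
    using assms(6) by (auto simp: unit_slice_hol_def W'_def norm_mult norm_divide field_simps)
  ultimately show ?thesis by blast
qed

lemma gleason_related:
  assumes x: "x \<in> X" and y: "y \<in> X" and c: "c < 2"
    and est: "\<And>W f. open W \<Longrightarrow> X \<subseteq> W \<Longrightarrow> f \<in> unit_slice_hol W \<Longrightarrow> cmod (f x - f y) \<le> c"
  shows "(evaluation A x, evaluation A y) \<in> gleason_rel X A"
proof -
  have c0: "c \<ge> 0"
    using est[of UNIV "\<lambda>_. 0"] slice_hol_const[of 0 UNIV] by (simp add: unit_slice_hol_def)
  have bound: "cmod (f x - f y) \<le> c" if f: "f \<in> A" "sup_norm X f \<le> 1" for f
  proof (rule field_le_epsilon)
    fix e :: real assume e: "e > 0"
    define d where "d = e / (2 + 2 * c)"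
    have d: "d > 0" using e c0 by (simp add: d_def)
    obtain g where g: "g \<in> F" "\<forall>z\<in>X. cmod (f z - g z) < d" using A_approx[OF f(1) d] by auto
    obtain W where W: "open W" "X \<subseteq> W" "slice_hol g W" using rationals_slice_hol[OF g(1)] .
    have gb: "\<forall>z\<in>X. cmod (g z) \<le> 1 + d"
    proof
      fix z assume z: "z \<in> X"
      have "cmod (g z) \<le> cmod (f z) + cmod (f z - g z)" by (metis add.commute norm_minus_commute norm_triangle_sub)
      then show "cmod (g z) \<le> 1 + d" using sup_norm_bound[OF f(1) z] f(2) g(2) z by force
    qed
    obtain W' where W': "open W'" "X \<subseteq> W'" "(\<lambda>z. g z * (1 / of_real (1 + 2 * d))) \<in> unit_slice_hol W'"
      using normalise_near[OF W gb, of "1 + 2 * d"] d by auto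
    have "cmod (g x * (1 / of_real (1 + 2 * d)) - g y * (1 / of_real (1 + 2 * d))) \<le> c" by (rule est[OF W'])
    then have "cmod ((g x - g y) * (1 / of_real (1 + 2 * d))) \<le> c" by (simp only: left_diff_distrib)
    moreover have "cmod (1 / of_real (1 + 2 * d)) = 1 / (1 + 2 * d)"
      using d unfolding norm_divide norm_of_real by simp
    ultimately have "cmod (g x - g y) * (1 / (1 + 2 * d)) \<le> c" by (simp only: norm_mult)
    then have gxy: "cmod (g x - g y) \<le> c * (1 + 2 * d)" using d by (simp add: field_simps)
    have "cmod ((f x - g x) + (g x - g y) - (f y - g y)) \<le> cmod (f x - g x) + cmod (g x - g y) + cmod (f y - g y)"
      by (intro order_trans[OF norm_triangle_ineq4] add_right_mono norm_triangle_ineq)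
    moreover have "cmod (f x - g x) \<le> d" "cmod (f y - g y) \<le> d" using g(2) x y by (auto intro: less_imp_le)
    ultimately have "cmod (f x - f y) \<le> d + c * (1 + 2 * d) + d" using gxy by simp
    also have "\<dots> = c + d * (2 + 2 * c)" by (simp add: algebra_simps)
    also have "d * (2 + 2 * c) = e" using c0 by (simp add: d_def)
    finally show "cmod (f x - f y) \<le> c + e" .
  qed
  have "dual_norm X A (evaluation A x - evaluation A y) \<le> ereal c"
    unfolding dual_norm_def
    by (rule SUP_least) (use bound in \<open>auto simp: evaluation_def\<close>)
  also have "\<dots> < 2" using c by simp
  finally show ?thesis
    unfolding gleason_rel_def using evaluation_in_max_ideal_space x y by simp
qed

text \<open>
  Translations move the zero set of a denominator away from a given point.
\<close>

lemma rationals_translate: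
  assumes "f \<in> F"
  shows "\<exists>d>0. \<forall>t. norm t < d \<longrightarrow> (\<lambda>z. f (z + t)) \<in> F"
proof -
  obtain U p q where f: "open U" "X \<subseteq> U" "holomorphic_vec_on f U" "p \<in> polynomials" "q \<in> polynomials"
    "\<exists>z. q z \<noteq> 0" "\<forall>z\<in>U. q z \<noteq> 0 \<longrightarrow> f z = p z / q z" using rationals_E[OF assms] .
  obtain d where d: "d > 0" "(\<Union>x\<in>X. ball x d) \<subseteq> U"
    using compact_subset_open_imp_ball_epsilon_subset[OF compact_X f(1,2)] by blast
  have "(\<lambda>z. f (z + t)) \<in> F" if t: "norm t < d" for t
  proof (rule rationals_I[of "(\<lambda>z. z + t) -` U"])
    show "open ((\<lambda>z. z + t) -` U)" by (intro open_vimage f(1) continuous_intros)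
    show "X \<subseteq> (\<lambda>z. z + t) -` U"
    proof
      fix x assume x: "x \<in> X"
      have "x + t \<in> ball x d" using t by (simp add: dist_norm)
      then show "x \<in> (\<lambda>z. z + t) -` U" using d(2) x by blast
    qed
    show "holomorphic_vec_on (\<lambda>z. f (z + t)) ((\<lambda>z. z + t) -` U)" using f(3) by (rule holomorphic_vec_on_translate)
    show "(\<lambda>z. p (z + t)) \<in> polynomials" "(\<lambda>z. q (z + t)) \<in> polynomials" using f(4,5) by (auto intro: polynomials_translate)
    obtain w where "q w \<noteq> 0" using f(6) by blast
    then have "q ((w - t) + t) \<noteq> 0" by simp
    then show "\<exists>z. q (z + t) \<noteq> 0" by (rule exI[of _ "w - t"])
    show "f (z + t) = p (z + t) / q (z + t)" if "z \<in> (\<lambda>z. z + t) -` U" "q (z + t) \<noteq> 0" for z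
      using f(7) that by auto
  qed
  then show ?thesis using d(1) by blast
qed

end

section \<open>Bounded point derivations\<close>

lemma dir_deriv_const: "dir_deriv i (\<lambda>z. c) x = 0"
  by (simp add: dir_deriv_def)

lemma dir_deriv_coord: "dir_deriv i (\<lambda>z. z $ j) x = (if i = j then 1 else 0)"
proof -
  have "((\<lambda>\<zeta>. (x + \<zeta> *s axis i 1) $ j) has_field_derivative (if i = j then 1 else 0)) (at 0)"
    by (auto intro!: derivative_eq_intros simp: axis_def)
  then show ?thesis unfolding dir_deriv_def by (rule DERIV_imp_deriv)
qed

lemma dir_deriv_add:
  assumes "slice_hol f W" "slice_hol g W" "open W" "x \<in> W"
  shows "dir_deriv i (\<lambda>z. f z + g z) x = dir_deriv i f x + dir_deriv i g x"
  unfolding dir_deriv_def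
  by (rule deriv_add) (use assms in \<open>auto intro: slice_hol_field_differentiable\<close>)

lemma dir_deriv_mult:
  assumes "slice_hol f W" "slice_hol g W" "open W" "x \<in> W"
  shows "dir_deriv i (\<lambda>z. f z * g z) x = dir_deriv i f x * g x + f x * dir_deriv i g x"
proof -
  have "deriv (\<lambda>\<zeta>. f (x + \<zeta> *s axis i 1) * g (x + \<zeta> *s axis i 1)) 0 =
      f (x + 0 *s axis i 1) * deriv (\<lambda>\<zeta>. g (x + \<zeta> *s axis i 1)) 0 + deriv (\<lambda>\<zeta>. f (x + \<zeta> *s axis i 1)) 0 * g (x + 0 *s axis i 1)"
    by (rule deriv_mult) (use assms in \<open>auto intro: slice_hol_field_differentiable\<close>)
  then show ?thesis by (simp add: dir_deriv_def algebra_simps)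
qed

lemma dir_deriv_cong:
  assumes "open W" "x \<in> W" "\<And>z. z \<in> W \<Longrightarrow> f z = g z"
  shows "dir_deriv i f x = dir_deriv i g x"
  unfolding dir_deriv_def
proof (rule deriv_cong_ev)
  have "open {\<zeta>. x + \<zeta> *s axis i 1 \<in> W}" using assms(1) by (rule open_line)
  moreover have "0 \<in> {\<zeta>. x + \<zeta> *s axis i 1 \<in> W}" using assms(2) by simp
  ultimately have "\<forall>\<^sub>F \<zeta> in nhds 0. \<zeta> \<in> {\<zeta>. x + \<zeta> *s axis i 1 \<in> W}" by (rule eventually_nhds_in_open)
  then show "\<forall>\<^sub>F \<zeta> in nhds 0. f (x + \<zeta> *s axis i 1) = g (x + \<zeta> *s axis i 1)"
    by eventually_elim (simp add: assms(3))
qed simp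

text \<open>
  The bound is required for functions bounded by 1 on a neighbourhood of \<open>X\<close>, as normal families
  provide it; by scaling it becomes a bound in the supremum norm of \<open>X\<close>.
\<close>

locale bounded_derivatives = compact_set X for X :: "(complex ^ 'n::finite) set" +
  fixes x :: "complex ^ 'n" and M :: real
  assumes x: "x \<in> X"
    and unit_bound: "\<And>W f i. open W \<Longrightarrow> X \<subseteq> W \<Longrightarrow> f \<in> unit_slice_hol W \<Longrightarrow> cmod (dir_deriv i f x) \<le> M"
begin

lemma F_add_deriv: "f \<in> F \<Longrightarrow> g \<in> F \<Longrightarrow> dir_deriv i (\<lambda>z. f z + g z) x = dir_deriv i f x + dir_deriv i g x"
  and F_mult_deriv: "f \<in> F \<Longrightarrow> g \<in> F \<Longrightarrow> dir_deriv i (\<lambda>z. f z * g z) x = dir_deriv i f x * g x + f x * dir_deriv i g x"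
proof -
  assume "f \<in> F" "g \<in> F"
  then obtain V W where V: "open V" "X \<subseteq> V" "slice_hol f V" and W: "open W" "X \<subseteq> W" "slice_hol g W"
    using rationals_slice_hol by metis
  have *: "slice_hol f (V \<inter> W)" "slice_hol g (V \<inter> W)" "open (V \<inter> W)" "x \<in> V \<inter> W"
    using V W x by (auto intro: slice_hol_subset)
  show "dir_deriv i (\<lambda>z. f z + g z) x = dir_deriv i f x + dir_deriv i g x" using * by (rule dir_deriv_add)
  show "dir_deriv i (\<lambda>z. f z * g z) x = dir_deriv i f x * g x + f x * dir_deriv i g x" using * by (rule dir_deriv_mult)
qed

lemma M_nonneg: "M \<ge> 0"
  using unit_bound[of UNIV "\<lambda>_. 0"] slice_hol_const[of 0 UNIV]
  by (simp add: unit_slice_hol_def dir_deriv_const)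

lemma F_deriv_bound:
  assumes f: "f \<in> F" and B: "\<forall>z\<in>X. cmod (f z) \<le> B"
  shows "cmod (dir_deriv i f x) \<le> M * B"
proof -
  have B0: "B \<ge> 0" using B x by (auto intro: order_trans[OF norm_ge_zero])
  obtain W where W: "open W" "X \<subseteq> W" "slice_hol f W" using rationals_slice_hol[OF f] .
  have *: "cmod (dir_deriv i f x) \<le> M * B'" if B': "B' > B" for B'
  proof -
    obtain W' where W': "open W'" "X \<subseteq> W'" "(\<lambda>z. f z * (1 / of_real B')) \<in> unit_slice_hol W'"
      using normalise_near[OF W B, of B'] B0 B' by auto
    have "dir_deriv i (\<lambda>z. f z * (1 / of_real B')) x = dir_deriv i f x * (1 / of_real B')"
      using dir_deriv_mult[OF W(3) slice_hol_const W(1), of x i "1 / of_real B'"] W(2) x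
      by (auto simp: dir_deriv_const)
    then have "cmod (dir_deriv i f x * (1 / of_real B')) \<le> M" using unit_bound[OF W', of i] by simp
    then show ?thesis using B0 B' by (simp add: norm_mult norm_divide field_simps)
  qed
  show ?thesis
  proof (rule field_le_epsilon)
    fix e :: real assume e: "e > 0"
    have "cmod (dir_deriv i f x) \<le> M * (B + e / (M + 1))" using M_nonneg e by (intro *) (simp add: add_nonneg_pos)
    also have "\<dots> = M * B + M / (M + 1) * e" by (simp add: algebra_simps)
    also have "\<dots> \<le> M * B + 1 * e" using M_nonneg e by (intro add_left_mono mult_right_mono) (auto simp: field_simps)
    finally show "cmod (dir_deriv i f x) \<le> M * B + e" by simp
  qed
qed

lemma F_deriv_diff_bound:
  assumes f: "f \<in> F" and g: "g \<in> F" and B: "\<forall>z\<in>X. cmod (f z - g z) \<le> B"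
  shows "cmod (dir_deriv i f x - dir_deriv i g x) \<le> M * B"
proof -
  have g': "(\<lambda>z. (-1) * g z) \<in> F" by (intro rationals_mult F_const g)
  have "dir_deriv i (\<lambda>z. (-1) * g z) x = - dir_deriv i g x"
    using F_mult_deriv[OF F_const[of "-1"] g] by (simp add: dir_deriv_const)
  then have "dir_deriv i (\<lambda>z. f z + (-1) * g z) x = dir_deriv i f x - dir_deriv i g x"
    using F_add_deriv[OF f g'] by simp
  moreover have "cmod (dir_deriv i (\<lambda>z. f z + (-1) * g z) x) \<le> M * B"
    using B by (intro F_deriv_bound rationals_add f g') auto
  ultimately show ?thesis by simp
qed

definition approx :: "(complex ^ 'n \<Rightarrow> complex) \<Rightarrow> nat \<Rightarrow> complex ^ 'n \<Rightarrow> complex" where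
  "approx f k = (SOME g. g \<in> F \<and> (\<forall>z\<in>X. cmod (f z - g z) < 1 / (real k + 1)))"

lemma approx:
  assumes "f \<in> A"
  shows "approx f k \<in> F" "z \<in> X \<Longrightarrow> cmod (f z - approx f k z) < 1 / (real k + 1)"
proof -
  have "\<exists>g. g \<in> F \<and> (\<forall>z\<in>X. cmod (f z - g z) < 1 / (real k + 1))"
    using A_approx[OF assms, of "1 / (real k + 1)"] by auto
  from someI_ex[OF this] show "approx f k \<in> F" "z \<in> X \<Longrightarrow> cmod (f z - approx f k z) < 1 / (real k + 1)"
    unfolding approx_def by auto
qed

text \<open>
  Derivatives of uniformly close functions in \<open>F\<close> are close, so the limit exists and does not depend on
  the chosen approximations.
\<close>

definition partial :: "'n \<Rightarrow> (complex ^ 'n \<Rightarrow> complex) \<Rightarrow> complex" where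
  "partial i f = (if f \<in> A then lim (\<lambda>k. dir_deriv i (approx f k) x) else 0)"

lemma tendsto_inverse_Suc: "(\<lambda>k. C * (1 / (real k + 1))) \<longlonglongrightarrow> 0"
proof -
  have "(\<lambda>k. 1 / (real k + 1)) \<longlonglongrightarrow> 0"
    using LIMSEQ_inverse_real_of_nat by (simp add: inverse_eq_divide add.commute)
  from tendsto_mult_left[OF this, of C] show ?thesis by simp
qed

lemma approx_deriv_tendsto:
  assumes f: "f \<in> A"
  shows "(\<lambda>k. dir_deriv i (approx f k) x) \<longlonglongrightarrow> partial i f"
proof -
  have "Cauchy (\<lambda>k. dir_deriv i (approx f k) x)"
  proof (rule CauchyI)
    fix e :: real assume "e > 0"
    then have "\<forall>\<^sub>F k in sequentially. (2 * M) * (1 / (real k + 1)) < e"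
      by (rule order_tendstoD(2)[OF tendsto_inverse_Suc])
    then obtain N where N: "(2 * M) * (1 / (real N + 1)) < e" unfolding eventually_sequentially by blast
    have "norm (dir_deriv i (approx f k) x - dir_deriv i (approx f l) x) < e" if kl: "k \<ge> N" "l \<ge> N" for k l
    proof -
      have le: "1 / (real j + 1) \<le> 1 / (real N + 1)" if "j \<ge> N" for j using that by (intro divide_left_mono) auto
      have "cmod (approx f k z - approx f l z) \<le> 2 * (1 / (real N + 1))" if z: "z \<in> X" for z
      proof -
        have "cmod ((f z - approx f l z) - (f z - approx f k z)) \<le> cmod (f z - approx f l z) + cmod (f z - approx f k z)"
          by (rule norm_triangle_ineq4)
        then show ?thesis using approx(2)[OF f z, of k] approx(2)[OF f z, of l] le[OF kl(1)] le[OF kl(2)] by simp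
      qed
      then have "cmod (dir_deriv i (approx f k) x - dir_deriv i (approx f l) x) \<le> M * (2 * (1 / (real N + 1)))"
        by (intro F_deriv_diff_bound approx(1) f) auto
      then show ?thesis using N by (simp add: mult_ac)
    qed
    then show "\<exists>N. \<forall>k\<ge>N. \<forall>l\<ge>N. norm (dir_deriv i (approx f k) x - dir_deriv i (approx f l) x) < e" by blast
  qed
  then show ?thesis using f unfolding partial_def by (simp add: Cauchy_convergent convergent_LIMSEQ_iff[symmetric])
qed

lemma partial_near:
  assumes f: "f \<in> A" and g: "g \<in> F" and B: "\<forall>z\<in>X. cmod (f z - g z) \<le> B"
  shows "cmod (partial i f - dir_deriv i g x) \<le> M * B"
proof -
  have "cmod (dir_deriv i (approx f k) x - dir_deriv i g x) \<le> M * B + M * (1 / (real k + 1))" for k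
  proof -
    have "cmod (approx f k z - g z) \<le> B + 1 / (real k + 1)" if z: "z \<in> X" for z
    proof -
      have "cmod ((f z - g z) - (f z - approx f k z)) \<le> cmod (f z - g z) + cmod (f z - approx f k z)"
        by (rule norm_triangle_ineq4)
      then show ?thesis using approx(2)[OF f z, of k] bspec[OF B z] by simp
    qed
    then have "cmod (dir_deriv i (approx f k) x - dir_deriv i g x) \<le> M * (B + 1 / (real k + 1))"
      by (intro F_deriv_diff_bound approx(1) f g) auto
    then show ?thesis by (simp add: distrib_left)
  qed
  moreover have "(\<lambda>k. cmod (dir_deriv i (approx f k) x - dir_deriv i g x)) \<longlonglongrightarrow> cmod (partial i f - dir_deriv i g x)"
    by (intro tendsto_intros approx_deriv_tendsto f)
  moreover have "(\<lambda>k. M * B + M * (1 / (real k + 1))) \<longlonglongrightarrow> M * B + 0"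
    by (intro tendsto_add tendsto_const tendsto_inverse_Suc)
  ultimately have "cmod (partial i f - dir_deriv i g x) \<le> M * B + 0"
    by (intro LIMSEQ_le[of _ _ "\<lambda>k. M * B + M * (1 / (real k + 1))"]) auto
  then show ?thesis by simp
qed

lemma partial_tendsto:
  assumes f: "f \<in> A" and g: "\<And>k. g k \<in> F" and B: "\<And>k z. z \<in> X \<Longrightarrow> cmod (f z - g k z) \<le> C * (1 / (real k + 1))"
  shows "(\<lambda>k. dir_deriv i (g k) x) \<longlonglongrightarrow> partial i f"
proof -
  have "(\<lambda>k. dir_deriv i (g k) x - partial i f) \<longlonglongrightarrow> 0"
  proof (rule Lim_null_comparison[OF _ tendsto_inverse_Suc[of "M * C"]])
    show "\<forall>\<^sub>F k in sequentially. norm (dir_deriv i (g k) x - partial i f) \<le> M * C * (1 / (real k + 1))"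
    proof (rule always_eventually, rule allI)
      fix k
      have "cmod (partial i f - dir_deriv i (g k) x) \<le> M * (C * (1 / (real k + 1)))"
        using B by (intro partial_near f g) auto
      then show "norm (dir_deriv i (g k) x - partial i f) \<le> M * C * (1 / (real k + 1))"
        by (simp add: norm_minus_commute)
    qed
  qed
  then show ?thesis by (rule LIM_zero_cancel)
qed

lemma partial_res: "g \<in> F \<Longrightarrow> partial i (res g) = dir_deriv i g x"
  using partial_near[OF res_in_A, of g g 0 i] by simp

lemma partial_mult:
  assumes f: "f \<in> A" and g: "g \<in> A"
  shows "partial i (f * g) = partial i f * g x + f x * partial i g"
proof -
  obtain B where B: "B > 0" "\<forall>z\<in>X. cmod (f z) \<le> B" using A_bounded[OF f] by blast
  obtain B' where B': "B' > 0" "\<forall>z\<in>X. cmod (g z) \<le> B'" using A_bounded[OF g] by blast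
  have gb: "cmod (approx g k z) \<le> B' + 1" if z: "z \<in> X" for k z
  proof -
    have "cmod (approx g k z) \<le> cmod (g z) + cmod (g z - approx g k z)"
      by (metis add.commute norm_minus_commute norm_triangle_sub)
    moreover have "1 / (real k + 1) \<le> 1" by simp
    ultimately show ?thesis using approx(2)[OF g z, of k] bspec[OF B'(2) z] by linarith
  qed
  have "(\<lambda>k. dir_deriv i (\<lambda>z. approx f k z * approx g k z) x) \<longlonglongrightarrow> partial i (f * g)"
  proof (rule partial_tendsto[OF A_mult[OF f g]])
    show "(\<lambda>z. approx f k z * approx g k z) \<in> F" for k by (intro rationals_mult approx(1) f g)
    show "cmod ((f * g) z - approx f k z * approx g k z) \<le> (B + (B' + 1)) * (1 / (real k + 1))" if z: "z \<in> X" for k z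
      using prod_approx[of "f z" "approx f k z" "1 / (real k + 1)" "g z" "approx g k z" B "B' + 1"]
        approx(2)[OF f z, of k] approx(2)[OF g z, of k] B(2) gb[OF z] z by auto
  qed
  moreover have "dir_deriv i (\<lambda>z. approx f k z * approx g k z) x = dir_deriv i (approx f k) x * approx g k x + approx f k x * dir_deriv i (approx g k) x" for k
    by (intro F_mult_deriv approx(1) f g)
  ultimately have lim1: "(\<lambda>k. dir_deriv i (approx f k) x * approx g k x + approx f k x * dir_deriv i (approx g k) x) \<longlonglongrightarrow> partial i (f * g)"
    by simp
  have ax: "(\<lambda>k. approx h k x) \<longlonglongrightarrow> h x" if h: "h \<in> A" for h
  proof (rule LIM_zero_cancel, rule Lim_null_comparison[OF _ tendsto_inverse_Suc[of 1]])
    show "\<forall>\<^sub>F k in sequentially. norm (approx h k x - h x) \<le> 1 * (1 / (real k + 1))"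
      using approx(2)[OF h x] by (intro always_eventually allI) (auto simp: norm_minus_commute intro: less_imp_le)
  qed
  have lim2: "(\<lambda>k. dir_deriv i (approx f k) x * approx g k x + approx f k x * dir_deriv i (approx g k) x) \<longlonglongrightarrow> partial i f * g x + f x * partial i g"
    by (intro tendsto_intros approx_deriv_tendsto ax f g)
  show ?thesis using lim1 lim2 by (rule LIMSEQ_unique)
qed

lemma partial_add:
  assumes f: "f \<in> A" and g: "g \<in> A"
  shows "partial i (f + g) = partial i f + partial i g"
proof -
  have "(\<lambda>k. dir_deriv i (\<lambda>z. approx f k z + approx g k z) x) \<longlonglongrightarrow> partial i (f + g)"
  proof (rule partial_tendsto[OF A_add[OF f g]])
    show "(\<lambda>z. approx f k z + approx g k z) \<in> F" for k by (intro rationals_add approx(1) f g)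
    fix k z assume z: "z \<in> X"
    have "cmod ((f z - approx f k z) + (g z - approx g k z)) \<le> cmod (f z - approx f k z) + cmod (g z - approx g k z)"
      by (rule norm_triangle_ineq)
    then show "cmod ((f + g) z - (approx f k z + approx g k z)) \<le> 2 * (1 / (real k + 1))"
      using approx(2)[OF f z, of k] approx(2)[OF g z, of k] by (simp add: algebra_simps)
  qed
  moreover have "dir_deriv i (\<lambda>z. approx f k z + approx g k z) x = dir_deriv i (approx f k) x + dir_deriv i (approx g k) x" for k
    by (intro F_add_deriv approx(1) f g)
  ultimately have lim1: "(\<lambda>k. dir_deriv i (approx f k) x + dir_deriv i (approx g k) x) \<longlonglongrightarrow> partial i (f + g)" by simp
  have lim2: "(\<lambda>k. dir_deriv i (approx f k) x + dir_deriv i (approx g k) x) \<longlonglongrightarrow> partial i f + partial i g"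
    by (intro tendsto_intros approx_deriv_tendsto f g)
  show ?thesis using lim1 lim2 by (rule LIMSEQ_unique)
qed

lemma partial_fscale:
  assumes f: "f \<in> A"
  shows "partial i (fscale c f) = c * partial i f"
proof -
  have "fscale c f = res (\<lambda>z. c) * f" using A_zero[OF f] by (auto simp: fun_eq_iff fscale_def res_def)
  then have "partial i (fscale c f) = partial i (res (\<lambda>z. c)) * f x + res (\<lambda>z. c) x * partial i f"
    using partial_mult[OF A_const f] by simp
  then show ?thesis using partial_res[OF F_const] x by (simp add: dir_deriv_const)
qed

lemma partial_bound:
  assumes f: "f \<in> A"
  shows "cmod (partial i f) \<le> M * sup_norm X f"
proof -
  have "\<forall>z\<in>X. cmod (f z - 0) \<le> sup_norm X f" using sup_norm_bound[OF f] by simp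
  from partial_near[OF f F_const this, of i] show ?thesis by (simp add: dir_deriv_const)
qed

lemma partial_bounded_point_derivation: "partial i \<in> bounded_point_derivations X A (evaluation A x)"
  unfolding bounded_point_derivations_def point_derivation_def
proof (intro CollectI conjI)
  show "linear_functional A (partial i)"
    unfolding linear_functional_def by (auto simp: partial_add partial_fscale) (simp add: partial_def)
  show "\<forall>f\<in>A. \<forall>g\<in>A. partial i (f * g) = partial i f * evaluation A x g + evaluation A x f * partial i g"
    by (simp add: partial_mult evaluation_def)
  show "continuous_functional X A (partial i)"
    unfolding continuous_functional_def
  proof (intro ballI allI impI)
    fix f and e :: real assume f: "f \<in> A" and e: "e > 0"
    have "cmod (partial i g - partial i f) < e" if g: "g \<in> A" and n: "sup_norm X (g - f) < e / (M + 1)" for g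
    proof -
      have gf: "g - f \<in> A" by (rule A_diff[OF f g])
      have "g = (g - f) + f" by (simp add: fun_eq_iff)
      then have "partial i g = partial i (g - f) + partial i f" using partial_add[OF gf f] by metis
      then have "cmod (partial i g - partial i f) \<le> M * sup_norm X (g - f)" using partial_bound[OF gf] by simp
      also have "\<dots> \<le> M * (e / (M + 1))" using n M_nonneg by (intro mult_left_mono) auto
      also have "\<dots> < e" using M_nonneg e by (simp add: field_simps)
      finally show ?thesis .
    qed
    then show "\<exists>d>0. \<forall>g\<in>A. sup_norm X (g - f) < d \<longrightarrow> cmod (partial i g - partial i f) < e"
      using e M_nonneg by (intro exI[of _ "e / (M + 1)"]) (auto simp: add_nonneg_pos)
  qed
qed

lemma res_add: "res (\<lambda>z. f z + g z) = res f + res g"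
  by (auto simp: res_def fun_eq_iff)

lemma res_mult: "res (\<lambda>z. f z * g z) = res f * res g"
  by (auto simp: res_def fun_eq_iff)

definition coord :: "'n \<Rightarrow> complex ^ 'n \<Rightarrow> complex" where
  "coord i = res (\<lambda>z. z $ i)"

lemma partial_coord: "partial i (coord j) = (if i = j then 1 else 0)"
  unfolding coord_def by (simp add: partial_res rationals_polynomial polynomials_coord dir_deriv_coord)

text \<open>
  A bounded point derivation is determined by its values on the coordinate functions: by the product
  rule on polynomials, hence on quotients \<open>p / q\<close> with \<open>q x \<noteq> 0\<close>.  If \<open>q x = 0\<close>, small translates
  of \<open>p / q\<close> have a denominator that does not vanish at \<open>x\<close>, and they converge uniformly on \<open>X\<close>.
\<close>

lemma derivation_polynomial:
  assumes \<psi>: "point_derivation A (evaluation A x) \<psi>" and p: "p \<in> polynomials"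
  shows "\<psi> (res p) = (\<Sum>i\<in>UNIV. \<psi> (coord i) * dir_deriv i p x)"
  using p
proof (induction p rule: polynomials_induct)
  case (const c)
  have lin: "\<psi> (fscale c f) = c * \<psi> f" if "f \<in> A" for f c
    using \<psi> that unfolding point_derivation_def linear_functional_def by blast
  have "\<psi> (res (\<lambda>z. 1) * res (\<lambda>z. 1)) = \<psi> (res (\<lambda>z. 1)) * 1 + 1 * \<psi> (res (\<lambda>z. 1))"
    using \<psi> A_const[of 1] x unfolding point_derivation_def by (simp add: evaluation_def)
  moreover have "res (\<lambda>z. 1) * res (\<lambda>z. 1) = res (\<lambda>z. 1)" by (auto simp: res_def fun_eq_iff)
  ultimately have "\<psi> (res (\<lambda>z. 1)) = 0" by simp
  moreover have "res (\<lambda>z. c) = fscale c (res (\<lambda>z. 1))" by (auto simp: res_def fscale_def fun_eq_iff)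
  ultimately show ?case using lin[OF A_const[of 1], of c] by (simp add: dir_deriv_const)
next
  case (coord j)
  have "(\<Sum>i\<in>UNIV. \<psi> (coord i) * dir_deriv i (\<lambda>z. z $ j) x) = (\<Sum>i\<in>UNIV. if i = j then \<psi> (coord i) else 0)"
    by (rule sum.cong) (auto simp: dir_deriv_coord)
  then show ?case by (simp add: coord_def)
next
  case (add p q)
  have pq: "p \<in> F" "q \<in> F" using add by (auto intro: rationals_polynomial)
  have "\<psi> (res p + res q) = \<psi> (res p) + \<psi> (res q)"
    using \<psi> pq res_in_A unfolding point_derivation_def linear_functional_def by blast
  then show ?case unfolding res_add F_add_deriv[OF pq] distrib_left sum.distrib by (simp only: add.IH)
next
  case (mult p q)
  have pq: "p \<in> F" "q \<in> F" using mult by (auto intro: rationals_polynomial)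
  have \<psi>_mult: "\<psi> (res p * res q) = \<psi> (res p) * q x + p x * \<psi> (res q)"
    using \<psi> pq res_in_A x unfolding point_derivation_def by (simp add: evaluation_def)
  show ?case unfolding res_mult \<psi>_mult F_mult_deriv[OF pq] mult.IH
    by (simp add: sum.distrib sum_distrib_left sum_distrib_right algebra_simps)
qed

lemma derivation_regular_rational:
  assumes \<psi>: "point_derivation A (evaluation A x) \<psi>" and W: "open W" "X \<subseteq> W" "f \<in> F" "continuous_on W f"
    and p: "p \<in> polynomials" and q: "q \<in> polynomials" "q x \<noteq> 0"
    and f: "\<forall>z\<in>W. q z \<noteq> 0 \<longrightarrow> f z = p z / q z"
  shows "\<psi> (res f) = (\<Sum>i\<in>UNIV. \<psi> (coord i) * dir_deriv i f x)"
proof -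
  \<comment> \<open>the identity \<open>p = q f\<close> holds off the nowhere dense zero set of \<open>q\<close>, hence on \<open>W\<close>\<close>
  have pq: "p z = q z * f z" if z: "z \<in> W" for z
  proof (rule ccontr)
    assume ne: "p z \<noteq> q z * f z"
    define h where "h z = p z - q z * f z" for z
    have "continuous_on W h" unfolding h_def
      by (intro continuous_intros polynomials_continuous_on p q W(4))
    then have "open (W \<inter> h -` (- {0}))" using W(1) by (intro continuous_open_preimage) auto
    moreover have "W \<inter> h -` (- {0}) \<noteq> {}" using z ne by (auto simp: h_def)
    ultimately obtain y where "y \<in> W \<inter> h -` (- {0})" "q y \<noteq> 0" using polynomials_nonzero_dense[OF q] by blast
    then show False using f by (auto simp: h_def)
  qed
  have qF: "q \<in> F" and pF: "p \<in> F" using p q by (auto intro: rationals_polynomial)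
  have "res p = res q * res f" using pq W(2) by (auto simp: res_def fun_eq_iff)
  then have "\<psi> (res p) = \<psi> (res q) * f x + q x * \<psi> (res f)"
    using \<psi> qF W(3) res_in_A x unfolding point_derivation_def by (simp add: evaluation_def)
  moreover have "dir_deriv i p x = dir_deriv i q x * f x + q x * dir_deriv i f x" for i
  proof -
    have "dir_deriv i p x = dir_deriv i (\<lambda>z. q z * f z) x"
      by (rule dir_deriv_cong[OF W(1)]) (use W(2) x pq in auto)
    then show ?thesis using F_mult_deriv[OF qF W(3)] by simp
  qed
  ultimately have "q x * \<psi> (res f) = q x * (\<Sum>i\<in>UNIV. \<psi> (coord i) * dir_deriv i f x)"
    unfolding derivation_polynomial[OF \<psi> p] derivation_polynomial[OF \<psi> q(1)]
    by (simp add: sum.distrib sum_distrib_left sum_distrib_right algebra_simps)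
  then show ?thesis using q(2) by simp
qed

lemma derivation_tendsto:
  assumes \<psi>: "\<psi> \<in> bounded_point_derivations X A (evaluation A x)" and f: "f \<in> A" and g: "\<And>k. g k \<in> A"
    and lim: "\<And>e. e > 0 \<Longrightarrow> \<forall>\<^sub>F k in sequentially. \<forall>z\<in>X. cmod (g k z - f z) \<le> e"
  shows "(\<lambda>k. \<psi> (g k)) \<longlonglongrightarrow> \<psi> f"
proof (rule tendstoI)
  fix e :: real assume e: "e > 0"
  obtain d where d: "d > 0" "\<And>h. h \<in> A \<Longrightarrow> sup_norm X (h - f) < d \<Longrightarrow> cmod (\<psi> h - \<psi> f) < e"
    using \<psi> f e unfolding bounded_point_derivations_def continuous_functional_def by blast
  have "\<forall>\<^sub>F k in sequentially. \<forall>z\<in>X. cmod (g k z - f z) \<le> d / 2" using d(1) by (intro lim) simp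
  then show "\<forall>\<^sub>F k in sequentially. dist (\<psi> (g k)) (\<psi> f) < e"
  proof eventually_elim
    case (elim k)
    have "sup_norm X (g k - f) \<le> d / 2"
      unfolding sup_norm_def by (rule cSUP_least) (use x elim in auto)
    then show ?case using d g[of k] by (simp add: dist_norm)
  qed
qed

lemma derivation_rational:
  assumes \<psi>: "\<psi> \<in> bounded_point_derivations X A (evaluation A x)" and fF: "f \<in> F"
  shows "\<psi> (res f) = (\<Sum>i\<in>UNIV. \<psi> (coord i) * dir_deriv i f x)"
proof -
  obtain U p q where U: "open U" "X \<subseteq> U" "holomorphic_vec_on f U" "p \<in> polynomials" "q \<in> polynomials"
    "\<exists>z. q z \<noteq> 0" "\<forall>z\<in>U. q z \<noteq> 0 \<longrightarrow> f z = p z / q z" using rationals_E[OF fF] .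
  have contU: "continuous_on U f" using holomorphic_vec_on_imp_slice_hol[OF U(3)] by (simp add: slice_hol_def)
  obtain d0 where d0: "d0 > 0" "\<forall>t. norm t < d0 \<longrightarrow> (\<lambda>z. f (z + t)) \<in> F" using rationals_translate[OF fF] by blast
  obtain d1 where d1: "d1 > 0" "(\<Union>x\<in>X. ball x d1) \<subseteq> U"
    using compact_subset_open_imp_ball_epsilon_subset[OF compact_X U(1,2)] by blast
  obtain w where w: "q w \<noteq> 0" using U(6) by blast
  define d where "d = min d0 d1 / 2"
  have d: "d > 0" "d < d0" "d < d1" using d0(1) d1(1) by (auto simp: d_def)
  have "\<forall>k::nat. \<exists>t. norm t < min d (1 / (real k + 1)) \<and> q (x + t) \<noteq> 0"
  proof
    fix k :: nat
    have "x \<in> ball x (min d (1 / (real k + 1)))" using d(1) by simp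
    then have "ball x (min d (1 / (real k + 1))) \<noteq> {}" by blast
    then obtain y where "y \<in> ball x (min d (1 / (real k + 1)))" "q y \<noteq> 0"
      using polynomials_nonzero_dense[OF U(5) w open_ball] by blast
    then show "\<exists>t. norm t < min d (1 / (real k + 1)) \<and> q (x + t) \<noteq> 0"
      by (intro exI[of _ "y - x"]) (simp add: dist_norm norm_minus_commute)
  qed
  from choice[OF this] obtain t where t: "\<forall>k::nat. norm (t k) < min d (1 / (real k + 1)) \<and> q (x + t k) \<noteq> 0" ..
  have td: "norm (t k) < d" for k using t by simp
  define g where "g k z = f (z + t k)" for k z
  have gF: "g k \<in> F" for k unfolding g_def using d0(2) td[of k] d(2) by simp
  define N where "N = {u + y | u y. u \<in> X \<and> y \<in> cball 0 d}"
  have N_I: "u + y \<in> N" if "u \<in> X" "norm y \<le> d" for u y unfolding N_def using that by auto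
  have cN: "compact N" unfolding N_def by (intro compact_sums compact_X compact_cball)
  have NU: "N \<subseteq> U"
  proof
    fix v assume "v \<in> N"
    then obtain u y where "v = u + y" "u \<in> X" "y \<in> cball 0 d" by (auto simp: N_def)
    then have "v \<in> ball u d1" using d(3) by (simp add: dist_norm)
    then show "v \<in> U" using d1(2) \<open>u \<in> X\<close> by blast
  qed
  have uc: "uniformly_continuous_on N f"
    using continuous_on_subset[OF contU NU] cN by (rule compact_uniformly_continuous)
  have close: "\<forall>\<^sub>F k in sequentially. \<forall>z\<in>X. cmod (g k z - f z) \<le> e" if e: "e > 0" for e
  proof -
    obtain \<delta> where \<delta>: "\<delta> > 0" "\<And>u v. u \<in> N \<Longrightarrow> v \<in> N \<Longrightarrow> dist v u < \<delta> \<Longrightarrow> dist (f v) (f u) < e"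
      using uc e unfolding uniformly_continuous_on_def by metis
    have "\<forall>\<^sub>F k in sequentially. 1 * (1 / (real k + 1)) < \<delta>"
      by (rule order_tendstoD(2)[OF tendsto_inverse_Suc \<delta>(1)])
    then show ?thesis
    proof eventually_elim
      case (elim k)
      show ?case
      proof
        fix z assume z: "z \<in> X"
        have "z + t k \<in> N" "z + 0 \<in> N" using z td[of k] d(1) by (intro N_I; simp)+
        moreover have "dist (z + t k) (z + 0) < \<delta>" using spec[OF t, of k] elim by (simp add: dist_norm)
        ultimately have "dist (f (z + t k)) (f (z + 0)) < e" by (intro \<delta>(2))
        then show "cmod (g k z - f z) \<le> e" by (simp add: g_def dist_norm)
      qed
    qed
  qed
  have "\<psi> (res (g k)) = (\<Sum>i\<in>UNIV. \<psi> (coord i) * dir_deriv i (g k) x)" for k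
  proof (rule derivation_regular_rational[where W = "(\<lambda>z. z + t k) -` U" and p = "\<lambda>z. p (z + t k)" and q = "\<lambda>z. q (z + t k)"])
    show "point_derivation A (evaluation A x) \<psi>" using \<psi> by (simp add: bounded_point_derivations_def)
    show "open ((\<lambda>z. z + t k) -` U)" by (intro open_vimage U(1) continuous_intros)
    show "X \<subseteq> (\<lambda>z. z + t k) -` U"
    proof
      fix z assume z: "z \<in> X"
      have "z + t k \<in> N" using z td[of k] by (intro N_I) simp_all
      then show "z \<in> (\<lambda>z. z + t k) -` U" using NU by auto
    qed
    show "continuous_on ((\<lambda>z. z + t k) -` U) (g k)"
      unfolding g_def by (rule continuous_on_compose2[OF contU]) (auto intro!: continuous_intros)
    show "(\<lambda>z. p (z + t k)) \<in> polynomials" "(\<lambda>z. q (z + t k)) \<in> polynomials" using U(4,5) by (auto intro: polynomials_translate)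
    show "q (x + t k) \<noteq> 0" using t by simp
    show "\<forall>z\<in>(\<lambda>z. z + t k) -` U. q (z + t k) \<noteq> 0 \<longrightarrow> g k z = p (z + t k) / q (z + t k)" using U(7) by (auto simp: g_def)
  qed (rule gF)
  moreover have "(\<lambda>k. \<psi> (res (g k))) \<longlonglongrightarrow> \<psi> (res f)"
  proof (rule derivation_tendsto[OF \<psi> res_in_A[OF fF] res_in_A[OF gF]])
    fix e :: real assume "e > 0"
    from close[OF this] show "\<forall>\<^sub>F k in sequentially. \<forall>z\<in>X. cmod (res (g k) z - res f z) \<le> e"
      by eventually_elim simp
  qed
  ultimately have lim1: "(\<lambda>k. \<Sum>i\<in>UNIV. \<psi> (coord i) * dir_deriv i (g k) x) \<longlonglongrightarrow> \<psi> (res f)" by simp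
  have dl: "(\<lambda>k. dir_deriv i (g k) x) \<longlonglongrightarrow> dir_deriv i f x" for i
  proof (rule tendstoI)
    fix e :: real assume e: "e > 0"
    have "e / (M + 1) > 0" using e M_nonneg by (simp add: add_nonneg_pos)
    from close[OF this] show "\<forall>\<^sub>F k in sequentially. dist (dir_deriv i (g k) x) (dir_deriv i f x) < e"
    proof eventually_elim
      case (elim k)
      have "cmod (dir_deriv i (g k) x - dir_deriv i f x) \<le> M * (e / (M + 1))"
        by (rule F_deriv_diff_bound[OF gF fF elim])
      also have "\<dots> < e" using M_nonneg e by (simp add: field_simps)
      finally show ?case by (simp add: dist_norm)
    qed
  qed
  have lim2: "(\<lambda>k. \<Sum>i\<in>UNIV. \<psi> (coord i) * dir_deriv i (g k) x) \<longlonglongrightarrow> (\<Sum>i\<in>UNIV. \<psi> (coord i) * dir_deriv i f x)"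
    by (intro tendsto_sum tendsto_mult_left dl)
  show ?thesis using lim1 lim2 by (rule LIMSEQ_unique)
qed

lemma derivation_expansion:
  assumes \<psi>: "\<psi> \<in> bounded_point_derivations X A (evaluation A x)" and f: "f \<in> A"
  shows "\<psi> f = (\<Sum>i\<in>UNIV. \<psi> (coord i) * partial i f)"
proof -
  have "(\<lambda>k. \<psi> (res (approx f k))) \<longlonglongrightarrow> \<psi> f"
  proof (rule derivation_tendsto[OF \<psi> f res_in_A[OF approx(1)[OF f]]])
    fix e :: real assume "e > 0"
    then have "\<forall>\<^sub>F k in sequentially. 1 * (1 / (real k + 1)) < e"
      by (rule order_tendstoD(2)[OF tendsto_inverse_Suc])
    then show "\<forall>\<^sub>F k in sequentially. \<forall>z\<in>X. cmod (res (approx f k) z - f z) \<le> e"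
    proof eventually_elim
      case (elim k)
      show ?case
      proof
        fix z assume z: "z \<in> X"
        show "cmod (res (approx f k) z - f z) \<le> e" using approx(2)[OF f z, of k] elim z by (simp add: norm_minus_commute)
      qed
    qed
  qed
  moreover have "\<psi> (res (approx f k)) = (\<Sum>i\<in>UNIV. \<psi> (coord i) * dir_deriv i (approx f k) x)" for k
    by (rule derivation_rational[OF \<psi> approx(1)[OF f]])
  ultimately have lim1: "(\<lambda>k. \<Sum>i\<in>UNIV. \<psi> (coord i) * dir_deriv i (approx f k) x) \<longlonglongrightarrow> \<psi> f" by simp
  have lim2: "(\<lambda>k. \<Sum>i\<in>UNIV. \<psi> (coord i) * dir_deriv i (approx f k) x) \<longlonglongrightarrow> (\<Sum>i\<in>UNIV. \<psi> (coord i) * partial i f)"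
    by (intro tendsto_sum tendsto_mult_left approx_deriv_tendsto f)
  show ?thesis using lim1 lim2 by (rule LIMSEQ_unique)
qed

lemma sum_fun_apply: "(\<Sum>i\<in>I. h i) y = (\<Sum>i\<in>I. h i y)" for h :: "'i \<Rightarrow> 'b \<Rightarrow> complex"
  by (induction I rule: infinite_finite_induct) auto

text \<open>
  The extended partial derivatives are dual to the coordinate functions, hence independent, and every
  bounded point derivation is a combination of them with its values on the coordinates as coefficients.
\<close>

lemma dim_bounded_point_derivations:
  "fun_vs.dim (bounded_point_derivations X A (evaluation A x)) = CARD('n)"
proof (rule fun_vs.dim_unique)
  show "range partial \<subseteq> bounded_point_derivations X A (evaluation A x)"
    using partial_bounded_point_derivation by blast
  have inj: "inj partial"
  proof (rule injI)
    fix i j assume "partial i = partial j"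
    then have "partial i (coord j) = partial j (coord j)" by (rule fun_cong)
    then show "i = j" unfolding partial_coord by (auto split: if_splits)
  qed
  show "card (range partial) = CARD('n)" using inj by (rule card_image)
  show "bounded_point_derivations X A (evaluation A x) \<subseteq> fun_vs.span (range partial)"
  proof
    fix \<psi> assume \<psi>: "\<psi> \<in> bounded_point_derivations X A (evaluation A x)"
    have "\<psi> = (\<Sum>i\<in>UNIV. fscale (\<psi> (coord i)) (partial i))"
    proof
      fix f
      show "\<psi> f = (\<Sum>i\<in>UNIV. fscale (\<psi> (coord i)) (partial i)) f"
      proof (cases "f \<in> A")
        case True
        then show ?thesis unfolding sum_fun_apply fscale_apply by (rule derivation_expansion[OF \<psi>])
      next
        case False
        have "linear_functional A \<psi>" using \<psi> by (simp add: bounded_point_derivations_def point_derivation_def)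
        then have "\<psi> f = 0" using False by (simp add: linear_functional_def)
        moreover have "partial i f = 0" for i using False by (simp add: partial_def)
        ultimately show ?thesis by (simp add: sum_fun_apply fscale_apply)
      qed
    qed
    also have "\<dots> \<in> fun_vs.span (range partial)"
      by (intro fun_vs.span_sum fun_vs.span_scale fun_vs.span_base rangeI)
    finally show "\<psi> \<in> fun_vs.span (range partial)" .
  qed
  show "\<not> fun_vs.dependent (range partial)"
  proof
    assume "fun_vs.dependent (range partial)"
    then obtain c \<phi> where \<phi>: "\<phi> \<in> range partial" and c: "c \<phi> \<noteq> 0"
      and s: "(\<Sum>\<phi>\<in>range partial. fscale (c \<phi>) \<phi>) = 0"
      unfolding fun_vs.dependent_finite[OF finite_imageI[OF finite[of UNIV], of partial]] by (elim exE conjE bexE)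
    from \<phi> obtain j where j: "\<phi> = partial j" by (rule rangeE)
    have "0 = (\<Sum>\<phi>\<in>range partial. fscale (c \<phi>) \<phi>) (coord j)" unfolding s by (rule zero_fun_apply[symmetric])
    also have "\<dots> = (\<Sum>\<phi>\<in>range partial. c \<phi> * \<phi> (coord j))" by (simp only: sum_fun_apply fscale_apply)
    also have "\<dots> = (\<Sum>i\<in>UNIV. c (partial i) * partial i (coord j))" by (subst sum.reindex[OF inj]) (simp only: o_def)
    also have "\<dots> = (\<Sum>i\<in>UNIV. if i = j then c (partial i) else 0)" by (rule sum.cong) (simp_all add: partial_coord)
    also have "\<dots> = c (partial j)" by simp
    finally show False using c unfolding j by simp
  qed
qed

end

section \<open>Density of zero-free polynomials and the resulting set\<close>

lemma ball_minus_small_ball: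
  assumes "\<delta> > (0 :: ennreal)"
  shows "\<exists>r. 0 < r \<and> r < 1 \<and> emeasure lebesgue (ball 0 1 - cball (0 :: 'a::euclidean_space) r) < \<delta>"
proof -
  obtain C :: "'a set" where C: "compact C" "C \<subseteq> ball 0 1" "emeasure lebesgue (ball 0 1 - C) < \<delta>"
    using open_compact_exhaustion[of "ball (0 :: 'a) 1" "{}" \<delta>] assms by auto
  obtain r where r: "0 < r" "r < 1" "C \<subseteq> cball 0 r"
  proof (cases "C = {}")
    case True
    then show thesis using that[of "1/2"] by simp
  next
    case False
    obtain x where x: "x \<in> C" "\<forall>y\<in>C. norm y \<le> norm x"
      using continuous_attains_sup[OF C(1) False, of norm] by (auto intro: continuous_intros)
    then have "norm x < 1" using C(2) by auto
    show thesis
    proof (rule that[of "max (norm x) (1/2)"])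
      show "C \<subseteq> cball 0 (max (norm x) (1/2))" using x by fastforce
    qed (use \<open>norm x < 1\<close> in auto)
  qed
  have "emeasure lebesgue (ball 0 1 - cball (0 :: 'a) r) \<le> emeasure lebesgue (ball 0 1 - C)"
    using r(3) C(1) by (intro emeasure_mono sets.Diff) (auto intro: fmeasurableD lmeasurable_compact)
  then show ?thesis using r C(3) by (auto intro: le_less_trans)
qed

text \<open>
  The \<open>n\<close>-th polynomial is going to be perturbed by \<open>1 / (n + 1)\<close>.  As each member of a countable dense
  family recurs infinitely often, the perturbed sequence is still dense.
\<close>

lemma polynomials_recurrent_dense_sequence:
  "\<exists>q :: nat \<Rightarrow> complex ^ 'n::finite \<Rightarrow> complex. (\<forall>n. q n \<in> polynomials) \<and>
    (\<forall>p\<in>polynomials. \<forall>d>0. \<forall>m. \<exists>n\<ge>m. \<forall>z\<in>cball 0 1. cmod (p z - q n z) < d)"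
proof -
  obtain D :: "(complex ^ 'n \<Rightarrow> complex) set" where D: "countable D" "D \<noteq> {}" "D \<subseteq> polynomials"
    "\<forall>p\<in>polynomials. \<forall>e>0. \<exists>d\<in>D. \<forall>z\<in>cball 0 1. cmod (p z - d z) < e"
    using polynomials_countable_dense by blast
  define q where "q n = from_nat_into D (fst (prod_decode n))" for n
  have "q n \<in> polynomials" for n unfolding q_def using from_nat_into[OF D(2)] D(3) by blast
  moreover have "\<exists>n\<ge>m. \<forall>z\<in>cball 0 1. cmod (p z - q n z) < d" if p: "p \<in> polynomials" and d: "d > 0" for p d m
  proof -
    obtain g where g: "g \<in> D" "\<forall>z\<in>cball 0 1. cmod (p z - g z) < d" using D(4) p d by blast
    have "q (prod_encode (to_nat_on D g, m)) = g" using D(1) g(1) by (simp add: q_def)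
    then show ?thesis using g(2) le_prod_encode_2[of m "to_nat_on D g"] by metis
  qed
  ultimately show ?thesis by (intro exI[of _ q]) blast
qed

context carving
begin

lemma zero_free_dense:
  assumes q: "\<forall>p\<in>polynomials. \<forall>d>0. \<forall>m. \<exists>n\<ge>m. \<forall>z\<in>cball 0 1. cmod (p z - q n z) < d"
  shows "uniform_closure (cball 0 1) {p \<in> polynomials. \<forall>z\<in>X. p z \<noteq> 0} = P_alg (cball 0 1)"
proof
  show "uniform_closure (cball 0 1) {p \<in> polynomials. \<forall>z\<in>X. p z \<noteq> 0} \<subseteq> P_alg (cball 0 1)"
    unfolding P_alg_def uniform_closure_def by blast
  show "P_alg (cball 0 1) \<subseteq> uniform_closure (cball 0 1) {p \<in> polynomials. \<forall>z\<in>X. p z \<noteq> 0}"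
  proof
    fix f :: "complex ^ 'n \<Rightarrow> complex" assume f: "f \<in> P_alg (cball 0 1)"
    have "\<exists>g\<in>{p \<in> polynomials. \<forall>z\<in>X. p z \<noteq> 0}. \<forall>z\<in>cball 0 1. cmod (f z - g z) < \<tau>" if \<tau>: "\<tau> > 0" for \<tau>
    proof -
      obtain g where g: "g \<in> polynomials" "\<forall>z\<in>cball 0 1. cmod (f z - g z) < \<tau> / 3"
        using f \<tau> unfolding P_alg_def uniform_closure_def by (auto dest: spec[of _ "\<tau> / 3"])
      obtain m where m: "1 / (real m + 1) < \<tau> / 3"
        using nat_approx_posE[of "\<tau> / 3"] \<tau> by (auto simp: add.commute)
      have "\<tau> / 3 > 0" using \<tau> by simp
      then obtain n where n: "n \<ge> m" "\<forall>z\<in>cball 0 1. cmod (g z - q n z) < \<tau> / 3" using q g(1) by blast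
      have "1 / (real n + 1) \<le> 1 / (real m + 1)" using n(1) by (intro divide_left_mono) auto
      have "cmod (f z - p n z) < \<tau>" if z: "z \<in> cball 0 1" for z
      proof -
        have "cmod ((f z - g z) + (g z - q n z) + (q n z - p n z)) \<le> cmod (f z - g z) + cmod (g z - q n z) + cmod (q n z - p n z)"
          by (intro order_trans[OF norm_triangle_ineq] add_right_mono norm_triangle_ineq)
        then show ?thesis
          using bspec[OF g(2) z] bspec[OF n(2) z] p(2)[OF z, of n] m \<open>1 / (real n + 1) \<le> _\<close> by simp
      qed
      moreover have "\<forall>z\<in>X. p n z \<noteq> 0" using p_nonzero[of _ n] e(1)[of n] by fastforce
      ultimately show ?thesis using p(1)[of n] by blast
    qed
    then show "f \<in> uniform_closure (cball 0 1) {p \<in> polynomials. \<forall>z\<in>X. p z \<noteq> 0}"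
      using f unfolding P_alg_def uniform_closure_def by blast
  qed
qed

lemma compact_set_X: "compact_set X"
  by unfold_locales (rule compact_X)

lemma P_in_gleason_part:
  assumes "P \<noteq> {}"
  shows "\<exists>G\<in>gleason_parts X (R_alg X). evaluation (R_alg X) ` P \<subseteq> G"
proof -
  interpret R: compact_set X by (rule compact_set_X)
  obtain x0 where x0: "x0 \<in> P" using assms by blast
  have "evaluation (R_alg X) x \<in> gleason_rel X (R_alg X) `` {evaluation (R_alg X) x0}" if x: "x \<in> P" for x
  proof -
    obtain c where c: "c < 2" "\<forall>W f. open W \<and> X \<subseteq> W \<and> f \<in> unit_slice_hol W \<longrightarrow> cmod (f x0 - f x) \<le> c"
      using gleason_P[OF x0 x] by blast
    have "(evaluation (R_alg X) x0, evaluation (R_alg X) x) \<in> gleason_rel X (R_alg X)"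
      by (rule R.gleason_related[OF _ _ c(1)]) (use c(2) x0 x P_subset_X in auto)
    then show ?thesis by simp
  qed
  moreover have "evaluation (R_alg X) x0 \<in> max_ideal_space (R_alg X)"
    using x0 P_subset_X by (intro R.evaluation_in_max_ideal_space) auto
  then have "gleason_rel X (R_alg X) `` {evaluation (R_alg X) x0} \<in> gleason_parts X (R_alg X)"
    unfolding gleason_parts_def by (rule quotientI)
  ultimately show ?thesis by blast
qed

lemma dim_bounded_point_derivations_P:
  assumes "x \<in> P"
  shows "fun_vs.dim (bounded_point_derivations X (R_alg X) (evaluation (R_alg X) x)) = CARD('n)"
proof -
  obtain M where M: "\<forall>W f i. open W \<and> X \<subseteq> W \<and> f \<in> unit_slice_hol W \<longrightarrow> cmod (dir_deriv i f x) \<le> M"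
    using dir_deriv_P[OF assms] by blast
  interpret bounded_derivatives X x M
    by unfold_locales (use compact_X assms P_subset_X M in auto)
  show ?thesis by (rule dim_bounded_point_derivations)
qed

end

theorem theorem1p1:
  fixes \<epsilon> :: real
  assumes "\<epsilon> > 0"
  shows "\<exists>X :: (complex ^ 'n::finite) set.
    connected X \<and> compact X \<and> rationally_convex X \<and> X \<subseteq> ball 0 1 \<and>
    emeasure lebesgue X > 0 \<and>
    uniform_closure (cball 0 1) {p \<in> polynomials. \<forall>z\<in>X. p z \<noteq> 0} = P_alg (cball 0 1) \<and>
    (\<exists>P \<subseteq> X. X - P \<in> null_sets lebesgue \<and>
       (\<exists>G \<in> gleason_parts X (R_alg X). evaluation (R_alg X) ` P \<subseteq> G) \<and>
       (\<forall>x\<in>P. fun_vs.dim (bounded_point_derivations X (R_alg X) (evaluation (R_alg X) x))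
                = CARD('n))) \<and>
    emeasure lebesgue (ball 0 1 - X) < ennreal \<epsilon>"
proof -
  \<comment> \<open>less than the volume of the ball must be removed, so that a set of positive measure remains\<close>
  define v where "v = measure lebesgue (ball 0 1 :: (complex ^ 'n) set)"
  have v: "v > 0" unfolding v_def by (simp add: content_ball_pos measure_completion)
  have ev: "emeasure lebesgue (ball 0 1 :: (complex ^ 'n) set) = ennreal v"
    unfolding v_def by (intro emeasure_eq_measure2 fmeasurableD2) auto
  define \<epsilon>0 where "\<epsilon>0 = min \<epsilon> v"
  have \<epsilon>0: "\<epsilon>0 > 0" "\<epsilon>0 \<le> \<epsilon>" "\<epsilon>0 \<le> v" using assms v by (auto simp: \<epsilon>0_def)
  obtain r where r: "0 < r" "r < 1" "emeasure lebesgue (ball 0 1 - cball (0 :: complex ^ 'n) r) < ennreal (\<epsilon>0 / 2)"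
    using ball_minus_small_ball[where 'a = "complex ^ 'n", of "ennreal (\<epsilon>0 / 2)"] \<epsilon>0(1) by auto
  obtain q :: "nat \<Rightarrow> complex ^ 'n \<Rightarrow> complex" where q: "\<forall>n. q n \<in> polynomials"
    "\<forall>p\<in>polynomials. \<forall>d>0. \<forall>m. \<exists>n\<ge>m. \<forall>z\<in>cball 0 1. cmod (p z - q n z) < d"
    using polynomials_recurrent_dense_sequence by blast
  have "\<exists>U K C b e \<eta> p. carving U K C b e \<eta> p q r \<epsilon>0"
    using q(1) r(1,2) \<epsilon>0(1) by (intro carving_exists) auto
  then obtain U K C b e \<eta> p where "carving U K C b e \<eta> p q r \<epsilon>0" by (elim exE)
  then interpret carving U K C b e \<eta> p q r \<epsilon>0 .
  have sets_balls: "ball (0 :: complex ^ 'n) s \<in> sets lebesgue" "cball (0 :: complex ^ 'n) s \<in> sets lebesgue" for s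
    by (auto intro: fmeasurableD lmeasurable_ball lmeasurable_cball)
  have mX: "X \<in> sets lebesgue" using compact_X by (auto intro: fmeasurableD lmeasurable_compact)
  have "emeasure lebesgue (ball 0 1 - X) \<le> emeasure lebesgue ((cball 0 r - X) \<union> (ball 0 1 - cball 0 r))"
    using mX sets_balls by (intro emeasure_mono sets.Diff sets.Un) auto
  also have "\<dots> \<le> emeasure lebesgue (cball 0 r - X) + emeasure lebesgue (ball 0 1 - cball (0 :: complex ^ 'n) r)"
    using mX sets_balls by (intro emeasure_subadditive sets.Diff)
  also have "\<dots> \<le> ennreal (\<epsilon>0 / 2) + emeasure lebesgue (ball 0 1 - cball (0 :: complex ^ 'n) r)"
    using emeasure_removed by (rule add_right_mono)
  also have "\<dots> < ennreal (\<epsilon>0 / 2) + ennreal (\<epsilon>0 / 2)"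
    using r(3) by (simp add: ennreal_add_left_cancel_less)
  also have "\<dots> = ennreal \<epsilon>0" using \<epsilon>0(1) by (simp flip: ennreal_plus)
  finally have small: "emeasure lebesgue (ball 0 1 - X) < ennreal \<epsilon>0" .
  have pos: "emeasure lebesgue X > 0"
  proof (rule ccontr)
    assume "\<not> emeasure lebesgue X > 0"
    then have "emeasure lebesgue X = 0" by simp
    have "ennreal v \<le> emeasure lebesgue ((ball 0 1 - X) \<union> X)"
      unfolding ev[symmetric] using mX sets_balls by (intro emeasure_mono sets.Diff sets.Un) auto
    also have "\<dots> \<le> emeasure lebesgue (ball 0 1 - X) + emeasure lebesgue X"
      using mX sets_balls by (intro emeasure_subadditive sets.Diff)
    also have "\<dots> < ennreal v"
      using less_le_trans[OF small ennreal_leI[OF \<epsilon>0(3)]] \<open>emeasure lebesgue X = 0\<close> by simp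
    finally show False by simp
  qed
  have "P \<noteq> {}"
  proof
    assume "P = {}"
    then show False using null_complement_P pos by (simp add: null_setsD1)
  qed
  show ?thesis
  proof (rule exI[of _ X], intro exI[of _ P] conjI ballI)
    show "emeasure lebesgue (ball 0 1 - X) < ennreal \<epsilon>"
      using small ennreal_leI[OF \<epsilon>0(2)] by (rule less_le_trans)
    show "\<exists>G\<in>gleason_parts X (R_alg X). evaluation (R_alg X) ` P \<subseteq> G"
      using \<open>P \<noteq> {}\<close> by (rule P_in_gleason_part)
    show "uniform_closure (cball 0 1) {p \<in> polynomials. \<forall>z\<in>X. p z \<noteq> 0} = P_alg (cball 0 1)"
      using q(2) by (rule zero_free_dense)
  qed (fact connected_X compact_X rationally_convex_X X_subset_ball pos P_subset_X null_complement_P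
      | erule dim_bounded_point_derivations_P)+
qed

end
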